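(* Suppose that $\Omega\in\mathbb{X}_d$. If either (1) there exists a non-constant holomorphic map $\mathbb{D}\to\mathbb{C}^d$ with image contained in $\partial\Omega$, or (2) $\partial\Omega$ is a $C^\infty$ hypersurface and $\partial\Omega$ has a point of infinite type, then there exist $\Omega_\infty\in\mathrm{AL}(\Omega)$ and a complex affine 2-plane $V$ in $\mathbb{C}^d$ such that $V\cap\Omega_\infty$ is biholomorphic to $\mathbb{D}\times\mathbb{D}$.
   Context: $\mathbb{D}\subset\mathbb{C}$ is the open unit disk. Space of convex domains: $\mathbb{X}_d$ is the set of non-empty convex domains in $\mathbb{C}^d$ which do not contain a complex affine line, and $\mathbb{X}_{d,0}$ is the set of pairs $(\Omega,x)$ with $\Omega\in\mathbb{X}_d$, $x\in\Omega$. For $R>0$ and $A\subset\mathbb{C}^d$ let $A^{(R)}=A\cap\{\|z\|<R\}$, and $d_H^{(R)}(A,B)=d_H(A^{(R)},B^{(R)})$, where $d_H$ is the Euclidean Hausdorff distance between bounded non-empty sets. A sequence $\Omega_n$ converges to $\Omega$ in $\mathbb{X}_d$ if there is $R_0\ge 0$ with $\lim_n d_H^{(R)}(\Omega_n,\Omega)=0$ for all $R\ge R_0$; $(\Omega_n,z_n)\to(\Omega,z)$ in $\mathbb{X}_{d,0}$ if $\Omega_n\to\Omega$ in $\mathbb{X}_d$ and $z_n\to z$. Affine limits: $\mathrm{Aff}(\mathbb{C}^d)$ is the group of (complex) affine automorphisms of $\mathbb{C}^d$, acting by $A(\Omega,z)=(A\Omega,Az)$. For $\Omega\in\mathbb{X}_d$,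 $\mathrm{AL}(\Omega)\subset\mathbb{X}_d$ is the set of $\Omega_\infty\in\mathbb{X}_d$ for which there exist $z_n\in\Omega$, $z_\infty\in\Omega_\infty$ and $A_n\in\mathrm{Aff}(\mathbb{C}^d)$ such that $\{z_n\}$ is compactly divergent in $\Omega$ (eventually leaves every compact subset of $\Omega$) and $A_n(\Omega,z_n)\to(\Omega_\infty,z_\infty)$ in $\mathbb{X}_{d,0}$. Type: for a smooth real hypersurface $\Gamma\subset\mathbb{C}^d$, $p\in\Gamma$, and $r$ a local defining function for $\Gamma$ near $p$, the (D'Angelo) type is $\tau(\Gamma,p)=\sup_z \frac{\nu(r\circ z)}{\nu(z)}$, the supremum being over germs at $0$ of non-constant holomorphic maps $z$ from $\mathbb{C}$ to $\mathbb{C}^d$ with $z(0)=p$, where $\nu(h)$ is the order of vanishing of $h-h(0)$ at $0$. The point $p$ is of infinite type if $\tau(\Gamma,p)=\infty$. *)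

theory Defs
  imports "HOL-Analysis.Analysis"
begin

section \<open>Complex affine geometry\<close>

text \<open>The space \<open>\<complex>\<^sup>d\<close> is \<^typ>\<open>complex^'d\<close>; complex scalar multiplication is \<open>*s\<close>, and
  \<open>vec.subspace\<close>, \<open>vec.dim\<close> are the notions over the field \<^typ>\<open>complex\<close>.\<close>

definition complex_affine_plane :: "nat \<Rightarrow> (complex^'d) set \<Rightarrow> bool" where
  "complex_affine_plane k V \<longleftrightarrow>
     (\<exists>p W. vec.subspace W \<and> vec.dim W = k \<and> V = (+) p ` W)"

definition complex_affine_group :: "(complex^'d \<Rightarrow> complex^'d) set" where
  "complex_affine_group = {\<phi>. \<exists>(A :: complex^'d^'d) b. invertible A \<and> \<phi> = (\<lambda>z. A *v z + b)}"

section \<open>The space of convex domains and its topology\<close>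

definition convex_domains :: "(complex^'d) set set" where
  "convex_domains = {\<Omega>. open \<Omega> \<and> convex \<Omega> \<and> \<Omega> \<noteq> {} \<and>
     \<not> (\<exists>L. complex_affine_plane 1 L \<and> L \<subseteq> \<Omega>)}"

text \<open>Values in \<^typ>\<open>ennreal\<close> make the formula meaningful for the empty set: an empty and a
  non-empty set are at distance \<open>\<infinity>\<close>.\<close>

definition hausdorff_distance :: "'a::metric_space set \<Rightarrow> 'a set \<Rightarrow> ennreal" where
  "hausdorff_distance A B =
     max (SUP a\<in>A. INF b\<in>B. ennreal (dist a b)) (SUP b\<in>B. INF a\<in>A. ennreal (dist a b))"

definition hausdorff_distance_upto :: "real \<Rightarrow> (complex^'d) set \<Rightarrow> (complex^'d) set \<Rightarrow> ennreal" where
  "hausdorff_distance_upto R A B =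
     hausdorff_distance (A \<inter> {z. norm z < R}) (B \<inter> {z. norm z < R})"

definition domains_converge :: "(nat \<Rightarrow> (complex^'d) set) \<Rightarrow> (complex^'d) set \<Rightarrow> bool" where
  "domains_converge \<Omega>s \<Omega> \<longleftrightarrow>
     (\<exists>R\<^sub>0\<ge>0. \<forall>R\<ge>R\<^sub>0. (\<lambda>n. hausdorff_distance_upto R (\<Omega>s n) \<Omega>) \<longlonglongrightarrow> 0)"

definition compactly_divergent :: "'a::topological_space set \<Rightarrow> (nat \<Rightarrow> 'a) \<Rightarrow> bool" where
  "compactly_divergent \<Omega> z \<longleftrightarrow>
     (\<forall>K. compact K \<and> K \<subseteq> \<Omega> \<longrightarrow> (\<forall>\<^sub>F n in sequentially. z n \<notin> K))"

definition affine_limits :: "(complex^'d) set \<Rightarrow> (complex^'d) set set" where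
  "affine_limits \<Omega> = {\<Omega>'. \<Omega>' \<in> convex_domains \<and>
     (\<exists>z z' A. (\<forall>n. z n \<in> \<Omega>) \<and> z' \<in> \<Omega>' \<and> (\<forall>n. A n \<in> complex_affine_group) \<and>
        compactly_divergent \<Omega> z \<and>
        domains_converge (\<lambda>n. A n ` \<Omega>) \<Omega>' \<and> (\<lambda>n. A n (z n)) \<longlonglongrightarrow> z')}"

section \<open>Holomorphic maps\<close>

definition holomorphic_curve_on :: "(complex \<Rightarrow> complex^'d) \<Rightarrow> complex set \<Rightarrow> bool" where
  "holomorphic_curve_on f S \<longleftrightarrow> (\<forall>i. (\<lambda>t. f t $ i) holomorphic_on S)"

text \<open>For \<open>S\<close> relatively open in a complex affine subspace, the derivative within \<open>S\<close> is the
  derivative along that subspace, so this is holomorphy on the complex manifold \<open>S\<close>. It is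
  used only for such \<open>S\<close>.\<close>

definition holomorphic_map_on :: "(complex^'m \<Rightarrow> complex^'n) \<Rightarrow> (complex^'m) set \<Rightarrow> bool" where
  "holomorphic_map_on f S \<longleftrightarrow>
     (\<forall>x\<in>S. \<exists>L. (f has_derivative L) (at x within S) \<and> Vector_Spaces.linear (*s) (*s) L)"

definition biholomorphic :: "(complex^'m) set \<Rightarrow> (complex^'n) set \<Rightarrow> bool" where
  "biholomorphic S T \<longleftrightarrow>
     (\<exists>f g. holomorphic_map_on f S \<and> holomorphic_map_on g T \<and> f ` S = T \<and> g ` T = S \<and>
        (\<forall>x\<in>S. g (f x) = x) \<and> (\<forall>y\<in>T. f (g y) = y))"

definition bidisk :: "(complex^2) set" where
  "bidisk = {z. z $ 1 \<in> ball 0 1 \<and> z $ 2 \<in> ball 0 1}"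

section \<open>Smooth hypersurfaces and D'Angelo type\<close>

text \<open>Iterated directional derivatives: \<open>iterated_derivative [v\<^sub>1, \<dots>, v\<^sub>k] f\<close> is
  \<open>\<partial>\<^bsub>v\<^sub>k\<^esub> \<dots> \<partial>\<^bsub>v\<^sub>1\<^esub> f\<close>. All derivatives are real derivatives.\<close>

primrec iterated_derivative ::
  "'a::real_normed_vector list \<Rightarrow> ('a \<Rightarrow> 'b::real_normed_vector) \<Rightarrow> 'a \<Rightarrow> 'b" where
  "iterated_derivative [] f = f"
| "iterated_derivative (v # vs) f = iterated_derivative vs (\<lambda>x. frechet_derivative f (at x) v)"

definition smooth_on :: "'a::real_normed_vector set \<Rightarrow> ('a \<Rightarrow> 'b::real_normed_vector) \<Rightarrow> bool" where
  "smooth_on U f \<longleftrightarrow> (\<forall>vs. \<forall>x\<in>U. iterated_derivative vs f differentiable (at x))"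

definition local_defining_function ::
  "(complex^'d) set \<Rightarrow> complex^'d \<Rightarrow> (complex^'d \<Rightarrow> real) \<Rightarrow> bool" where
  "local_defining_function \<Gamma> p r \<longleftrightarrow>
     (\<exists>U. open U \<and> p \<in> U \<and> smooth_on U r \<and> \<Gamma> \<inter> U = {x\<in>U. r x = 0} \<and>
        (\<forall>x\<in>U. frechet_derivative r (at x) \<noteq> (\<lambda>v. 0)))"

definition smooth_hypersurface :: "(complex^'d) set \<Rightarrow> bool" where
  "smooth_hypersurface \<Gamma> \<longleftrightarrow> (\<forall>p\<in>\<Gamma>. \<exists>r. local_defining_function \<Gamma> p r)"

text \<open>The order of vanishing of \<open>h - h 0\<close> at \<open>0\<close>, i.e. the least order \<open>k \<ge> 1\<close> of a derivative
  of \<open>h\<close> that does not vanish at \<open>0\<close>, and \<open>\<infinity>\<close> if there is none. For holomorphic \<open>h\<close> this is the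
  order of the first non-zero term of the power series of \<open>h - h 0\<close>.\<close>

definition vanishing_order :: "(complex \<Rightarrow> 'b::real_normed_vector) \<Rightarrow> enat" where
  "vanishing_order h =
     (INF vs\<in>{vs. vs \<noteq> [] \<and> iterated_derivative vs h 0 \<noteq> 0}. enat (length vs))"

definition nonconstant_germs :: "complex^'d \<Rightarrow> (complex \<Rightarrow> complex^'d) set" where
  "nonconstant_germs p = {z. (\<exists>S. open S \<and> 0 \<in> S \<and> holomorphic_curve_on z S) \<and> z 0 = p \<and>
     \<not> (\<forall>\<^sub>F t in nhds 0. z t = p)}"

text \<open>The type computed with the defining function \<open>r\<close>; it depends only on the hypersurface
  germ at \<open>p\<close>.\<close>

definition dangelo_type :: "(complex^'d \<Rightarrow> real) \<Rightarrow> complex^'d \<Rightarrow> ereal" where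
  "dangelo_type r p = (SUP z\<in>nonconstant_germs p.
     ereal_of_enat (vanishing_order (r \<circ> z)) / ereal_of_enat (vanishing_order z))"

definition infinite_type :: "(complex^'d) set \<Rightarrow> complex^'d \<Rightarrow> bool" where
  "infinite_type \<Gamma> p \<longleftrightarrow> (\<exists>r. local_defining_function \<Gamma> p r \<and> dangelo_type r p = \<infinity>)"

end

theory Submission
  imports Defs "HOL-Complex_Analysis.Complex_Analysis" "HOL-Real_Asymp.Real_Asymp"
begin

text \<open>Averaging a holomorphic curve \<open>p + t\<^sup>k g t\<close> over the circle of radius \<open>\<rho>\<close> with the
  non-negative weights \<open>1 + Re (\<zeta> t\<^sup>-\<^sup>k \<rho>\<^sup>k)\<close> produces the flat disc \<open>p + (\<rho>\<^sup>k / 2) \<zeta> g 0\<close>. As \<open>\<Omega>\<close> is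
  convex, a curve in the boundary, or a curve with contact of order \<open>m k\<close>, therefore yields a
  complex line through \<open>p\<close> with contact of every order, respectively of order \<open>m\<close>. The directions with
  contact of order at least \<open>m\<close> form a decreasing sequence of subspaces, so in both cases one
  direction \<open>a\<close> has contact of infinite order.

  Let \<open>\<nu>\<close> point from \<open>p\<close> into \<open>\<Omega>\<close>. The slices of \<open>\<Omega>\<close> in direction \<open>a\<close> through \<open>p + \<epsilon> \<nu>\<close> shrink more
  slowly than any power of \<open>\<epsilon>\<close>, so along some sequence \<open>\<epsilon>\<^sub>n \<rightarrow> 0\<close> the normalised slices at heights
  \<open>\<epsilon>\<^sub>n\<close> and \<open>s \<epsilon>\<^sub>n\<close> become equal for every \<open>s > 0\<close>. Rescale \<open>\<nu>\<close> by \<open>\<epsilon>\<^sub>n\<close>, \<open>a\<close> by the size of the slice,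
  and the remaining directions by an Auerbach argument, which gives compactness. In the limit the
  slice spanned by \<open>\<nu>\<close> and \<open>a\<close> is a tangent cone times a fixed planar convex set, and the Riemann
  mapping theorem applies to both factors.\<close>

section \<open>Minkowski functionals\<close>

text \<open>Infinite contact says only that the slice sizes decay slowly; on many scales they may
  still vary abruptly, so a blow-up along arbitrary \<epsilon> need not produce a product. What
  rescues the argument is that a function growing by a fixed factor over every window of fixed ratio
  would grow like a power; hence quiet windows exist arbitrarily near 0. The shape of the slice is
  kept quiet together with its size by adding the gauges of finitely many directions before the
  window is chosen. Domains are handled through their gauges, so that convergence of domains becomes
  pointwise convergence of uniformly Lipschitz sublinear functions. A domain may be unbounded and
  its gauge may vanish in real directions; the sum of the gauge over the rotations 1, -1, \<i>,
  -\<i> vanishes only at 0, because no complex line fits inside, and this sum plays the role of a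
  complex norm. The choice of scales compares slices over positive real heights only; convexity of
  the limit and its conical slice carry the product structure to complex heights.\<close>

definition minkowski_functional :: "'a::real_vector set \<Rightarrow> 'a \<Rightarrow> 'a \<Rightarrow> real" where
  "minkowski_functional \<Omega> z v = Inf {t. 0 < t \<and> z + inverse t *\<^sub>R v \<in> \<Omega>}"

lemma open_contains_small_multiple:
  fixes z :: "'a::real_normed_vector"
  assumes "open \<Omega>" "z \<in> \<Omega>"
  obtains e where "0 < e" "\<And>s. \<bar>s\<bar> < e \<Longrightarrow> z + s *\<^sub>R v \<in> \<Omega>"
proof -
  have "open ((\<lambda>s. z + s *\<^sub>R v) -` \<Omega>)"
    by (intro open_vimage continuous_intros assms)
  moreover have "0 \<in> (\<lambda>s. z + s *\<^sub>R v) -` \<Omega>" using assms by simp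
  ultimately obtain e where "e > 0" "ball 0 e \<subseteq> (\<lambda>s. z + s *\<^sub>R v) -` \<Omega>"
    using open_contains_ball by blast
  then show ?thesis by (intro that[of e]) (auto simp: dist_norm subset_iff)
qed

text \<open>Convexity makes the set of admissible \<open>t\<close> upward closed and openness
  removes its least element, so it is an open half-line. The strict inequality lets
  \<open>\<Omega>\<close> be recovered exactly as a sublevel set.\<close>

lemma minkowski_functional_less_iff:
  fixes z :: "'a::real_normed_vector"
  assumes "open \<Omega>" "convex \<Omega>" "z \<in> \<Omega>" "0 < s"
  shows "minkowski_functional \<Omega> z v < s \<longleftrightarrow> z + inverse s *\<^sub>R v \<in> \<Omega>"
proof -
  let ?T = "{t. 0 < t \<and> z + inverse t *\<^sub>R v \<in> \<Omega>}"
  obtain e where e: "0 < e" "\<And>s. \<bar>s\<bar> < e \<Longrightarrow> z + s *\<^sub>R v \<in> \<Omega>"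
    using open_contains_small_multiple[OF assms(1,3)] by metis
  have "inverse (e / 2) \<in> ?T" using e(1) e(2)[of "e/2"] by simp
  then have ne: "?T \<noteq> {}" by blast
  have bdd: "bdd_below ?T" by (rule bdd_belowI[of _ 0]) auto
  have up: "u \<in> ?T" if "t \<in> ?T" "t \<le> u" for t u
  proof -
    have "(1 - t / u) *\<^sub>R z + (t / u) *\<^sub>R (z + inverse t *\<^sub>R v) \<in> \<Omega>"
      using that by (intro convexD[OF assms(2)]) (auto simp: assms(3) field_simps)
    moreover have "(1 - t / u) *\<^sub>R z + (t / u) *\<^sub>R (z + inverse t *\<^sub>R v) = z + inverse u *\<^sub>R v"
      using that by (simp add: algebra_simps inverse_eq_divide)
    ultimately show ?thesis using that by simp
  qed
  have dn: "\<exists>u\<in>?T. u < t" if t: "t \<in> ?T" for t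
  proof -
    obtain d where d: "0 < d" "\<And>s. \<bar>s\<bar> < d \<Longrightarrow> (z + inverse t *\<^sub>R v) + s *\<^sub>R v \<in> \<Omega>"
      using open_contains_small_multiple[OF assms(1), of "z + inverse t *\<^sub>R v" v] t by blast
    have "(z + inverse t *\<^sub>R v) + (d/2) *\<^sub>R v \<in> \<Omega>" using d by simp
    then have "z + inverse (inverse (inverse t + d/2)) *\<^sub>R v \<in> \<Omega>" by (simp add: algebra_simps)
    moreover have "0 < inverse (inverse t + d/2)" using that d(1) by (simp add: add_pos_pos)
    moreover have "inverse (inverse t + d/2) < t"
      using that d(1) by (simp add: field_simps add_pos_pos)
    ultimately show ?thesis by blast
  qed
  show ?thesis
  proof
    assume "minkowski_functional \<Omega> z v < s"
    then obtain t where "t \<in> ?T" "t < s"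
      using cInf_lessD[OF ne] unfolding minkowski_functional_def by blast
    with up[of t s] show "z + inverse s *\<^sub>R v \<in> \<Omega>" by simp
  next
    assume "z + inverse s *\<^sub>R v \<in> \<Omega>"
    with dn[of s] assms(4) obtain u where "u \<in> ?T" "u < s" by auto
    then show "minkowski_functional \<Omega> z v < s"
      using cInf_lower[OF _ bdd, of u] unfolding minkowski_functional_def by simp
  qed
qed

lemma minkowski_functional_nonneg:
  fixes z :: "'a::real_normed_vector"
  assumes "open \<Omega>" "z \<in> \<Omega>"
  shows "0 \<le> minkowski_functional \<Omega> z v"
proof -
  obtain e where e: "0 < e" "\<And>s. \<bar>s\<bar> < e \<Longrightarrow> z + s *\<^sub>R v \<in> \<Omega>"
    using open_contains_small_multiple[OF assms(1,2)] by metis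
  have "inverse (e / 2) \<in> {t. 0 < t \<and> z + inverse t *\<^sub>R v \<in> \<Omega>}"
    using e(1) e(2)[of "e/2"] by simp
  then show ?thesis unfolding minkowski_functional_def by - (rule cInf_greatest, blast, simp)
qed

lemma minkowski_functional_leI:
  fixes z :: "'a::real_normed_vector"
  assumes "open \<Omega>" "convex \<Omega>" "z \<in> \<Omega>" "0 \<le> s"
    and "\<And>t. s < t \<Longrightarrow> z + inverse t *\<^sub>R v \<in> \<Omega>"
  shows "minkowski_functional \<Omega> z v \<le> s"
proof (rule field_le_epsilon)
  fix e :: real assume "0 < e"
  then show "minkowski_functional \<Omega> z v \<le> s + e"
    using minkowski_functional_less_iff[OF assms(1-3), of "s + e" v] assms(4) assms(5)[of "s + e"] by auto
qed

text \<open>Asymmetric gauges. Non-negativity is part of the definition because it does not follow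
  from subadditivity and positive homogeneity.\<close>

definition sublinear :: "('a::real_vector \<Rightarrow> real) \<Rightarrow> bool" where
  "sublinear N \<longleftrightarrow> (\<forall>x. 0 \<le> N x) \<and> (\<forall>x y. N (x + y) \<le> N x + N y) \<and>
     (\<forall>c x. 0 \<le> c \<longrightarrow> N (c *\<^sub>R x) = c * N x)"

lemma sublinearD:
  assumes "sublinear N"
  shows sublinear_nonneg: "0 \<le> N x"
    and sublinear_add: "N (x + y) \<le> N x + N y"
    and sublinear_scaleR: "0 \<le> c \<Longrightarrow> N (c *\<^sub>R x) = c * N x"
  using assms unfolding sublinear_def by blast+

lemma sublinear_zero: "sublinear N \<Longrightarrow> N 0 = 0"
  using sublinear_scaleR[of N 0 0] by simp

lemma sublinear_sum:
  assumes "sublinear N"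
  shows "N (\<Sum>i\<in>I. f i) \<le> (\<Sum>i\<in>I. N (f i))"
proof (induction I rule: infinite_finite_induct)
  case (insert x F)
  then show ?case using sublinear_add[OF assms, of "f x" "sum f F"] by simp
qed (simp_all add: sublinear_zero[OF assms])

lemma sublinear_abs_diff_le:
  fixes N :: "'a::real_normed_vector \<Rightarrow> real"
  assumes "sublinear N" "\<And>v. N v \<le> B * norm v"
  shows "\<bar>N x - N y\<bar> \<le> B * norm (x - y)"
  using sublinear_add[OF assms(1), of y "x - y"] sublinear_add[OF assms(1), of x "y - x"]
    assms(2)[of "x - y"] assms(2)[of "y - x"] by (simp add: norm_minus_commute)

lemma sublinear_minkowski_functional:
  fixes z :: "'a::real_normed_vector"
  assumes "open \<Omega>" "convex \<Omega>" "z \<in> \<Omega>"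
  shows "sublinear (minkowski_functional \<Omega> z)"
proof -
  let ?N = "minkowski_functional \<Omega> z"
  note less = minkowski_functional_less_iff[OF assms]
  have nn: "0 \<le> ?N v" for v using minkowski_functional_nonneg[OF assms(1,3)] .
  have le: "?N (c *\<^sub>R x) \<le> c * ?N x" if "0 < c" for c x
  proof (rule minkowski_functional_leI[OF assms])
    show "0 \<le> c * ?N x" using nn that by simp
    fix t assume t: "c * ?N x < t"
    then have "0 < t" using nn[of x] that by (metis le_less_trans less_eq_real_def mult_nonneg_nonneg)
    have "?N x < t / c" using t that by (simp add: field_simps)
    then have "z + inverse (t / c) *\<^sub>R x \<in> \<Omega>" using less[of "t/c" x] \<open>0 < t\<close> that by simp
    then show "z + inverse t *\<^sub>R c *\<^sub>R x \<in> \<Omega>" by (simp add: field_simps)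
  qed
  have hom: "?N (c *\<^sub>R x) = c * ?N x" if "0 < c" for c x
    using le[OF that, of x] le[of "inverse c" "c *\<^sub>R x"] that by (simp add: field_simps)
  have zero: "?N 0 \<le> 0" by (rule minkowski_functional_leI[OF assms]) (simp_all add: assms)
  have sub: "?N (x + y) \<le> ?N x + ?N y" for x y
  proof (rule field_le_epsilon)
    fix e :: real assume e: "0 < e"
    define s t where "s = ?N x + e/2" and "t = ?N y + e/2"
    have pos: "0 < s" "0 < t" using nn e by (auto simp: s_def t_def add_nonneg_pos)
    have "z + inverse s *\<^sub>R x \<in> \<Omega>" "z + inverse t *\<^sub>R y \<in> \<Omega>"
      using less[of s x] less[of t y] pos e by (auto simp: s_def t_def)
    \<comment> \<open>The weights \<open>s/(s+t)\<close> and \<open>t/(s+t)\<close> turn the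
      reciprocal scales \<open>1/s\<close> and \<open>1/t\<close> into the common scale
      \<open>1/(s+t)\<close>.\<close>
    then have "(s/(s+t)) *\<^sub>R (z + inverse s *\<^sub>R x) + (t/(s+t)) *\<^sub>R (z + inverse t *\<^sub>R y) \<in> \<Omega>"
      using pos by (intro convexD[OF assms(2)]) (auto simp: add_divide_distrib[symmetric])
    moreover have "(s/(s+t)) *\<^sub>R (z + inverse s *\<^sub>R x) + (t/(s+t)) *\<^sub>R (z + inverse t *\<^sub>R y)
       = ((s/(s+t)) + (t/(s+t))) *\<^sub>R z + inverse (s+t) *\<^sub>R (x + y)"
      using pos by (simp add: algebra_simps inverse_eq_divide)
    moreover have "(s/(s+t)) + (t/(s+t)) = 1" using pos by (simp add: add_divide_distrib[symmetric])
    ultimately have "z + inverse (s+t) *\<^sub>R (x + y) \<in> \<Omega>" by simp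
    then show "?N (x + y) \<le> ?N x + ?N y + e"
      using less[of "s+t" "x+y"] pos by (simp add: s_def t_def)
  qed
  show ?thesis unfolding sublinear_def
    using nn sub hom zero by (metis antisym less_eq_real_def mult_zero_left scaleR_zero_left)
qed

lemma minkowski_functional_less_one_iff:
  fixes z :: "'a::real_normed_vector"
  assumes "open \<Omega>" "convex \<Omega>" "z \<in> \<Omega>"
  shows "minkowski_functional \<Omega> z v < 1 \<longleftrightarrow> z + v \<in> \<Omega>"
  using minkowski_functional_less_iff[OF assms, of 1 v] by simp

lemma convex_sublevel_sublinear:
  assumes "sublinear N"
  shows "convex {x. N x < c}"
proof (rule convexI)
  fix x y u v assume *: "x \<in> {x. N x < c}" "y \<in> {x. N x < c}" "0 \<le> u" "0 \<le> v" "u + v = (1::real)"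
  have "N (u *\<^sub>R x + v *\<^sub>R y) \<le> u * N x + v * N y"
    using sublinear_add[OF assms, of "u *\<^sub>R x" "v *\<^sub>R y"] * by (simp add: sublinear_scaleR[OF assms])
  also have "\<dots> < c" using * convex_bound_lt[of "N x" c "N y" u v] by simp
  finally show "u *\<^sub>R x + v *\<^sub>R y \<in> {x. N x < c}" by simp
qed

lemma continuous_on_sublinear:
  fixes N :: "'a::real_normed_vector \<Rightarrow> real"
  assumes "sublinear N" "\<And>v. N v \<le> B * norm v"
  shows "continuous_on S N"
proof -
  have "(max B 0)-lipschitz_on S N"
  proof (rule lipschitz_onI)
    fix x y
    show "dist (N x) (N y) \<le> max B 0 * dist x y"
      using sublinear_abs_diff_le[OF assms, of x y]
      by (simp add: dist_norm) (meson max.cobounded1 mult_right_mono norm_ge_zero order_trans)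
  qed simp
  then show ?thesis by (rule lipschitz_on_continuous_on)
qed

section \<open>Compactness for families of gauges\<close>

lemma equi_lipschitz_tendsto:
  fixes N :: "nat \<Rightarrow> 'a::real_normed_vector \<Rightarrow> real"
  assumes lim: "\<And>x. (\<lambda>n. N n x) \<longlonglongrightarrow> M x"
    and lip: "\<And>n x y. \<bar>N n x - N n y\<bar> \<le> B * norm (x - y)"
    and x: "x \<longlonglongrightarrow> l"
  shows "(\<lambda>n. N n (x n)) \<longlonglongrightarrow> M l"
proof -
  have "(\<lambda>n. N n (x n) - N n l) \<longlonglongrightarrow> 0"
  proof (rule tendsto_rabs_zero_cancel, rule tendsto_sandwich[of "\<lambda>_. 0"])
    show "(\<lambda>n. B * norm (x n - l)) \<longlonglongrightarrow> 0"
      using x by (simp add: LIM_zero tendsto_mult_right_zero tendsto_norm_zero)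
  qed (use lip in auto)
  then show ?thesis using tendsto_add[OF _ lim[of l]] by fastforce
qed

text \<open>A diagonal subsequence converges on a countable dense set, and the common Lipschitz
  constant spreads the Cauchy property to every point.\<close>

lemma equi_lipschitz_convergent_subsequence:
  fixes N :: "nat \<Rightarrow> 'a::{real_normed_vector,second_countable_topology} \<Rightarrow> real"
  assumes bound: "\<And>n x. \<bar>N n x\<bar> \<le> B * norm x"
    and lip: "\<And>n x y. \<bar>N n x - N n y\<bar> \<le> B * norm (x - y)"
  obtains r M where "strict_mono (r :: nat \<Rightarrow> nat)" "\<And>x. (\<lambda>n. N (r n) x) \<longlonglongrightarrow> M x"
proof -
  obtain D :: "'a set" where D: "countable D" "\<And>X. open X \<Longrightarrow> X \<noteq> {} \<Longrightarrow> \<exists>d\<in>D. d \<in> X"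
    using countable_dense_setE by blast
  \<comment> \<open>Division by \<open>1 + norm x\<close> turns the linear bound into one uniform in
    \<open>x\<close>, as the diagonal extraction on \<open>D\<close> requires.\<close>
  obtain r where r: "strict_mono (r :: nat \<Rightarrow> nat)"
    and conv: "\<And>x. x \<in> D \<Longrightarrow> \<exists>l. (\<lambda>n. N (r n) x / (1 + norm x)) \<longlonglongrightarrow> l"
  proof (rule function_convergent_subsequence[OF D(1), of "\<lambda>n x. N n x / (1 + norm x)" "\<bar>B\<bar>"])
    fix n and x :: 'a
    have "\<bar>N n x\<bar> \<le> \<bar>B\<bar> * norm x"
      using bound[of n x] by (meson abs_ge_self mult_right_mono norm_ge_zero order_trans)
    also have "\<dots> \<le> \<bar>B\<bar> * (1 + norm x)" by (simp add: mult_left_mono)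
    finally show "norm (N n x / (1 + norm x)) \<le> \<bar>B\<bar>"
      by (simp add: divide_le_eq add_pos_nonneg)
  qed blast
  have convD: "convergent (\<lambda>n. N (r n) x)" if xD: "x \<in> D" for x
  proof -
    obtain l where "(\<lambda>n. N (r n) x / (1 + norm x)) \<longlonglongrightarrow> l" using conv xD by blast
    then have "(\<lambda>n. (1 + norm x) * (N (r n) x / (1 + norm x))) \<longlonglongrightarrow> (1 + norm x) * l"
      by (rule tendsto_mult_left)
    moreover have "1 + norm x \<noteq> 0" by (metis add_pos_nonneg norm_ge_zero order_less_irrefl zero_less_one)
    ultimately show ?thesis by (simp add: convergent_def) blast
  qed
  have "Cauchy (\<lambda>n. N (r n) x)" for x
  proof (rule metric_CauchyI)
    fix e :: real assume e: "0 < e"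
    let ?d = "e / (3 * (1 + \<bar>B\<bar>))"
    have "0 < ?d" using e by simp
    then obtain y where y: "y \<in> D" "y \<in> ball x ?d" using D(2)[of "ball x ?d"] by auto
    have close: "\<bar>N n x - N n y\<bar> \<le> e/3" for n
    proof -
      have "\<bar>N n x - N n y\<bar> \<le> (1 + \<bar>B\<bar>) * norm (x - y)"
        using lip[of n x y] by (smt (verit) mult_right_mono norm_ge_zero)
      also have "\<dots> \<le> (1 + \<bar>B\<bar>) * ?d" using y by (intro mult_left_mono) (auto simp: dist_norm)
      also have "\<dots> = e/3" by (simp add: field_simps)
      finally show ?thesis .
    qed
    obtain k where k: "\<forall>m\<ge>k. \<forall>n\<ge>k. dist (N (r m) y) (N (r n) y) < e/3"
      using metric_CauchyD[OF convergent_Cauchy[OF convD[OF y(1)]], of "e/3"] e by auto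
    have "dist (N (r m) x) (N (r n) x) < e" if "m \<ge> k" "n \<ge> k" for m n
    proof -
      have "dist (N (r m) y) (N (r n) y) < e/3" using k that by blast
      then show ?thesis using close[of "r m"] close[of "r n"] unfolding dist_real_def by linarith
    qed
    then show "\<exists>k. \<forall>m\<ge>k. \<forall>n\<ge>k. dist (N (r m) x) (N (r n) x) < e" by blast
  qed
  then have "\<exists>M. \<forall>x. (\<lambda>n. N (r n) x) \<longlonglongrightarrow> M x"
    by (intro choice allI) (simp add: real_Cauchy_convergent convergent_def[symmetric])
  then show ?thesis using that r by blast
qed

section \<open>Convergence of convex domains\<close>

text \<open>Convergence in the sense of inner and outer limits implies Hausdorff convergence of the
  truncations by compactness. The radius exceeds \<open>norm x0\<close> so that a point of the
  closure with norm at most \<open>R\<close> can be pushed towards \<open>x0\<close> into the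
  truncated set itself.\<close>

lemma domains_convergeI:
  fixes C :: "(complex^'d) set"
  assumes "convex C" "open C" "x0 \<in> C"
    and inner: "\<And>x. x \<in> C \<Longrightarrow> \<exists>e>0. \<forall>\<^sub>F n in sequentially. ball x e \<subseteq> Cs n"
    and outer: "\<And>r x l. strict_mono (r::nat\<Rightarrow>nat) \<Longrightarrow> (\<And>n. x n \<in> Cs (r n)) \<Longrightarrow> x \<longlonglongrightarrow> l \<Longrightarrow> l \<in> closure C"
  shows "domains_converge Cs C"
  unfolding domains_converge_def
proof (intro exI conjI allI impI)
  show "0 \<le> norm x0 + 1" by simp
  fix R assume R: "norm x0 + 1 \<le> R"
  define D where "D = C \<inter> {z. norm z < R}"
  define Ds where "Ds n = Cs n \<inter> {z. norm z < R}" for n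
  have x0D: "x0 \<in> D" using R assms(3) by (simp add: D_def)
  have near: "\<forall>\<^sub>F n in sequentially. \<forall>a\<in>Ds n. \<exists>b\<in>D. dist a b < e" if "0 < e" for e
  proof (rule ccontr)
    assume "\<not> ?thesis"
    then have "infinite {n. \<exists>a\<in>Ds n. \<forall>b\<in>D. e \<le> dist a b}"
      by (simp add: eventually_sequentially infinite_nat_iff_unbounded_le not_le not_less)
    then obtain s where s: "strict_mono (s::nat\<Rightarrow>nat)" "\<forall>n. s n \<in> {n. \<exists>a\<in>Ds n. \<forall>b\<in>D. e \<le> dist a b}"
      using infinite_enumerate by blast
    then have "\<forall>n. \<exists>a. a \<in> Ds (s n) \<and> (\<forall>b\<in>D. e \<le> dist a b)" by blast
    then obtain a where "\<forall>n. a n \<in> Ds (s n) \<and> (\<forall>b\<in>D. e \<le> dist (a n) b)" by (rule choice[THEN exE])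
    then have a: "\<And>n. a n \<in> Ds (s n)" "\<And>n b. b \<in> D \<Longrightarrow> e \<le> dist (a n) b" by blast+
    have "\<forall>n. a n \<in> cball 0 R" using a(1) by (auto simp: Ds_def intro: less_imp_le)
    then obtain l r where l: "l \<in> cball 0 R" "strict_mono (r::nat\<Rightarrow>nat)" "(a \<circ> r) \<longlonglongrightarrow> l"
      using compact_cball[of "0::complex^'d" R] unfolding compact_def by blast
    have "l \<in> closure C"
      by (rule outer[of "s \<circ> r" "a \<circ> r"])
         (use s(1) l a(1) in \<open>auto simp: strict_mono_o Ds_def\<close>)
    \<comment> \<open>Pushing \<open>l\<close> towards \<open>x0\<close> by the fraction
      \<open>t\<close> moves it by at most \<open>e / 2\<close> and lands both in \<open>C\<close>
      and strictly inside the ball of radius \<open>R\<close>.\<close>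
    define t where "t = min 1 (e / (2 * (1 + norm (l - x0))))"
    have t: "0 < t" "t \<le> 1" "t * (1 + norm (l - x0)) \<le> e / 2"
    proof -
      have pos: "0 < 1 + norm (l - x0)" by (simp add: add_pos_nonneg)
      then show "0 < t" "t \<le> 1" using that by (auto simp: t_def)
      have "t \<le> (e/2) / (1 + norm (l - x0))" by (simp add: t_def)
      then show "t * (1 + norm (l - x0)) \<le> e / 2" using pos by (simp only: pos_le_divide_eq)
    qed
    define y where "y = l - t *\<^sub>R (l - x0)"
    have yC: "y \<in> C"
      using mem_interior_closure_convex_shrink[OF assms(1), of x0 l t] \<open>l \<in> closure C\<close> t assms(2,3)
      by (simp add: interior_open y_def)
    have "norm y = norm ((1 - t) *\<^sub>R l + t *\<^sub>R x0)" by (simp add: y_def algebra_simps)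
    also have "\<dots> \<le> (1 - t) * norm l + t * norm x0"
      using t norm_triangle_ineq[of "(1 - t) *\<^sub>R l" "t *\<^sub>R x0"] by simp
    also have "\<dots> < (1 - t) * R + t * R"
    proof (rule add_le_less_mono)
      show "(1 - t) * norm l \<le> (1 - t) * R" using t l(1) by (intro mult_left_mono) auto
      show "t * norm x0 < t * R" using t R by simp
    qed
    finally have "y \<in> D" using yC by (simp add: D_def algebra_simps)
    have "(\<lambda>n. dist ((a \<circ> r) n) y) \<longlonglongrightarrow> dist l y" by (intro tendsto_intros l(3))
    then have "e \<le> dist l y"
      by (rule LIMSEQ_le_const) (use a(2)[OF \<open>y \<in> D\<close>] in auto)
    moreover have "dist l y \<le> e / 2"
    proof -
      have "dist l y = t * norm (l - x0)" using t by (simp add: dist_norm y_def)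
      also have "\<dots> \<le> t * (1 + norm (l - x0))" using t by simp
      finally show ?thesis using t(3) by simp
    qed
    ultimately show False using that by simp
  qed
  have cover: "\<forall>\<^sub>F n in sequentially. \<forall>b\<in>D. \<exists>a\<in>Ds n. dist a b < e" if "0 < e" for e
  proof -
    have "bounded D" by (rule bounded_subset[of "cball 0 R"]) (auto simp: D_def)
    then have "compact (closure D)" by (simp add: compact_closure)
    moreover have "closure D \<subseteq> (\<Union>x\<in>D. ball x e)"
      using that by (force simp: closure_approachable)
    ultimately obtain F where F: "F \<subseteq> D" "finite F" "closure D \<subseteq> (\<Union>x\<in>F. ball x e)"
      using compactE_image[of "closure D" D "\<lambda>x. ball x e"] by (metis open_ball)
    have "\<forall>\<^sub>F n in sequentially. \<forall>x\<in>F. x \<in> Ds n"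
    proof (rule eventually_ball_finite[OF F(2)], rule ballI)
      fix x assume "x \<in> F"
      then have x: "x \<in> C" "norm x < R" using F(1) by (auto simp: D_def)
      then obtain d where "0 < d" "\<forall>\<^sub>F n in sequentially. ball x d \<subseteq> Cs n" using inner by blast
      then show "\<forall>\<^sub>F n in sequentially. x \<in> Ds n"
        using x by (auto simp: Ds_def elim!: eventually_mono)
    qed
    then show ?thesis
    proof (rule eventually_mono)
      fix n assume "\<forall>x\<in>F. x \<in> Ds n"
      then show "\<forall>b\<in>D. \<exists>a\<in>Ds n. dist a b < e"
        using F(3) closure_subset[of D] by fastforce
    qed
  qed
  have "\<forall>\<^sub>F n in sequentially. hausdorff_distance (Ds n) D \<le> ennreal e" if "0 < e" for e
    using near[OF that] cover[OF that]
  proof eventually_elim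
    case (elim n)
    show ?case unfolding hausdorff_distance_def
    proof (intro max.boundedI SUP_least)
      fix a assume "a \<in> Ds n"
      then obtain b where "b \<in> D" "dist a b < e" using elim(1) by blast
      then show "(INF b\<in>D. ennreal (dist a b)) \<le> ennreal e"
        by (intro INF_lower2[of b]) (auto intro: ennreal_leI)
    next
      fix b assume "b \<in> D"
      then obtain a where "a \<in> Ds n" "dist a b < e" using elim(2) by blast
      then show "(INF a\<in>Ds n. ennreal (dist a b)) \<le> ennreal e"
        by (intro INF_lower2[of a]) (auto intro: ennreal_leI)
    qed
  qed note le = this
  have "(\<lambda>n. hausdorff_distance (Ds n) D) \<longlonglongrightarrow> 0"
  proof (rule order_tendstoI)
    fix c :: ennreal assume "0 < c"
    then obtain y where y: "0 < y" "y < c" using dense by blast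
    then have "y < top" by (metis order_less_le_trans top_greatest)
    then have "0 < enn2real y" "ennreal (enn2real y) = y" using y(1) by (auto simp: enn2real_positive_iff)
    then show "\<forall>\<^sub>F n in sequentially. hausdorff_distance (Ds n) D < c"
      using le[of "enn2real y"] y(2) by (auto elim!: eventually_mono)
  qed simp
  then show "(\<lambda>n. hausdorff_distance_upto R (Cs n) C) \<longlonglongrightarrow> 0"
    by (simp add: hausdorff_distance_upto_def D_def Ds_def)
qed

text \<open>The common Lipschitz constant gives the inner condition, and convergence along moving
  points gives the outer one.\<close>

lemma domains_converge_sublevel:
  fixes N :: "nat \<Rightarrow> complex^'d \<Rightarrow> real"
  assumes "\<And>n. sublinear (N n)" "\<And>n v. N n v \<le> B * norm v"
    and lim: "\<And>x. (\<lambda>n. N n x) \<longlonglongrightarrow> M x" and "sublinear M" "\<And>v. M v \<le> B * norm v"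
  shows "domains_converge (\<lambda>n. {x. N n x < 1}) {x. M x < 1}"
proof (rule domains_convergeI[of _ 0])
  show "convex {x. M x < 1}" by (rule convex_sublevel_sublinear[OF assms(4)])
  have contM: "continuous_on UNIV M" by (rule continuous_on_sublinear[OF assms(4,5)])
  then show "open {x. M x < 1}" by (intro open_Collect_less) auto
  show "0 \<in> {x. M x < 1}" using sublinear_zero[OF assms(4)] by simp
  have lip: "\<bar>N n x - N n y\<bar> \<le> (1 + \<bar>B\<bar>) * norm (x - y)" for n x y
    using sublinear_abs_diff_le[OF assms(1,2), of n x y]
    by (smt (verit) mult_right_mono norm_ge_zero)
  {
    fix x assume "x \<in> {x. M x < 1}"
    \<comment> \<open>The slack \<open>1 - M x\<close> is shared equally between the convergence of
      \<open>N n x\<close> and the Lipschitz variation on the ball.\<close>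
    define e where "e = (1 - M x) / (2 * (1 + \<bar>B\<bar>))"
    have e: "0 < e" using \<open>x \<in> _\<close> by (simp add: e_def)
    have "\<forall>\<^sub>F n in sequentially. N n x < (1 + M x) / 2"
      using order_tendstoD(2)[OF lim[of x], of "(1 + M x) / 2"] \<open>x \<in> _\<close> by simp
    then have "\<forall>\<^sub>F n in sequentially. ball x e \<subseteq> {x. N n x < 1}"
    proof (rule eventually_mono)
      fix n assume n: "N n x < (1 + M x) / 2"
      show "ball x e \<subseteq> {x. N n x < 1}"
      proof
        fix y assume "y \<in> ball x e"
        then have "(1 + \<bar>B\<bar>) * norm (y - x) \<le> (1 + \<bar>B\<bar>) * e"
          by (intro mult_left_mono) (auto simp: dist_norm norm_minus_commute)
        also have "\<dots> = (1 - M x) / 2" by (simp add: e_def field_simps)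
        finally show "y \<in> {x. N n x < 1}" using lip[of n y x] n by (simp add: field_simps)
      qed
    qed
    then show "\<exists>e>0. \<forall>\<^sub>F n in sequentially. ball x e \<subseteq> {x. N n x < 1}" using e by blast
  }
  {
    fix r x l assume r: "strict_mono (r::nat\<Rightarrow>nat)" and x: "\<And>n. x n \<in> {x. N (r n) x < 1}" "x \<longlonglongrightarrow> l"
    have "(\<lambda>n. N (r n) (x n)) \<longlonglongrightarrow> M l"
      by (rule equi_lipschitz_tendsto[OF _ lip x(2)])
         (use LIMSEQ_subseq_LIMSEQ[OF lim r] in \<open>simp add: o_def\<close>)
    then have Ml: "M l \<le> 1"
      by (rule LIMSEQ_le_const2) (use x(1) in \<open>auto intro: less_imp_le\<close>)
    \<comment> \<open>In the limit only \<open>M l \<le> 1\<close> survives; contracting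
      \<open>l\<close> towards 0 restores the strict inequality.\<close>
    have "(\<lambda>n. (1 - inverse (real (Suc n))) *\<^sub>R l) \<longlonglongrightarrow> (1 - 0) *\<^sub>R l"
      by (intro tendsto_intros LIMSEQ_inverse_real_of_nat)
    moreover have "(1 - inverse (real (Suc n))) *\<^sub>R l \<in> {x. M x < 1}" for n
    proof -
      have "M ((1 - inverse (real (Suc n))) *\<^sub>R l) = (1 - inverse (real (Suc n))) * M l"
        by (rule sublinear_scaleR[OF assms(4)]) (simp add: field_simps)
      also have "\<dots> \<le> (1 - inverse (real (Suc n))) * 1"
        using Ml by (intro mult_left_mono) (auto simp: field_simps)
      also have "\<dots> < 1" by simp
      finally show ?thesis by simp
    qed
    ultimately show "l \<in> closure {x. M x < 1}"
      unfolding closure_sequential by (intro exI[of _ "\<lambda>n. (1 - inverse (real (Suc n))) *\<^sub>R l"]) simp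
  }
qed

section \<open>Normalising affine maps\<close>

lemma complex_scaleR_eq: "complex_of_real r *s v = r *\<^sub>R (v :: complex^'d)"
  by (simp add: vec_eq_iff) (simp add: scaleR_conv_of_real)

lemma vector_smult_Re_Im:
  "c *s (v :: complex^'d) = Re c *\<^sub>R v + Im c *\<^sub>R (\<i> *s v)"
  by (simp add: vec_eq_iff complex_eq_iff)

lemma complex_line_plane:
  assumes "(v :: complex^'d) \<noteq> 0"
  shows "complex_affine_plane 1 (range (\<lambda>c. p + c *s v))"
  unfolding complex_affine_plane_def
proof (intro exI conjI)
  show "vec.subspace (vec.span {v})" by simp
  show "vec.dim (vec.span {v}) = 1" using assms by simp
  show "range (\<lambda>c. p + c *s v) = (+) p ` vec.span {v}"
    by (auto simp: vec.span_singleton)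
qed

text \<open>Summing over the fourth roots of unity makes the gauge symmetric and invariant under
  \<i>. Complex scalars then cost only a factor 2, which suffices wherever a complex norm would be
  used.\<close>

definition rotation_sum :: "(complex^'d \<Rightarrow> real) \<Rightarrow> complex^'d \<Rightarrow> real" where
  "rotation_sum N v = N v + N (- v) + N (\<i> *s v) + N (- (\<i> *s v))"

lemma rotation_sum_ge: "sublinear N \<Longrightarrow> N v \<le> rotation_sum N v"
  unfolding rotation_sum_def using sublinear_nonneg[of N] by (smt (verit))

lemma rotation_sum_nonneg: "sublinear N \<Longrightarrow> 0 \<le> rotation_sum N v"
  using rotation_sum_ge[of N v] sublinear_nonneg[of N v] by linarith

lemma rotation_sum_add:
  assumes "sublinear N"
  shows "rotation_sum N (v + w) \<le> rotation_sum N v + rotation_sum N w"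
  unfolding rotation_sum_def
  using sublinear_add[OF assms, of v w] sublinear_add[OF assms, of "-v" "-w"]
    sublinear_add[OF assms, of "\<i> *s v" "\<i> *s w"] sublinear_add[OF assms, of "-(\<i> *s v)" "-(\<i> *s w)"]
  by (simp add: vector_add_ldistrib)

lemma matrix_vector_mult_scaleR_complex: "A *v (r *\<^sub>R c) = r *\<^sub>R ((A :: complex^'n^'m) *v c)"
  by (simp only: complex_scaleR_eq[symmetric] vec.scale)

lemma smult_scaleR_commute: "c *s (r *\<^sub>R v) = r *\<^sub>R (c *s (v :: complex^'d))"
  by (simp add: vec_eq_iff)

lemma rotation_sum_scaleR:
  assumes "sublinear N"
  shows "rotation_sum N (r *\<^sub>R v) = \<bar>r\<bar> * rotation_sum N v"
proof (cases "0 \<le> r")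
  case True
  then show ?thesis
    using sublinear_scaleR[OF assms, of r v] sublinear_scaleR[OF assms, of r "-v"]
      sublinear_scaleR[OF assms, of r "\<i> *s v"] sublinear_scaleR[OF assms, of r "-(\<i> *s v)"]
    by (simp add: rotation_sum_def smult_scaleR_commute algebra_simps)
next
  case False
  then show ?thesis
    using sublinear_scaleR[OF assms, of "-r" v] sublinear_scaleR[OF assms, of "-r" "-v"]
      sublinear_scaleR[OF assms, of "-r" "\<i> *s v"] sublinear_scaleR[OF assms, of "-r" "-(\<i> *s v)"]
    by (simp add: rotation_sum_def smult_scaleR_commute algebra_simps)
qed

lemma rotation_sum_i: "rotation_sum N (\<i> *s v) = rotation_sum N v"
proof -
  have "\<i> *s (\<i> *s v) = - v" by (simp add: vec_eq_iff)
  then show ?thesis by (simp add: rotation_sum_def)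
qed

lemma abs_Re_Im_le: "\<bar>Re c\<bar> + \<bar>Im c\<bar> \<le> 2 * cmod c"
  using abs_Re_le_cmod[of c] abs_Im_le_cmod[of c] by linarith

lemma rotation_sum_smult_le:
  assumes "sublinear N"
  shows "rotation_sum N (c *s v) \<le> 2 * cmod c * rotation_sum N v"
proof -
  have "rotation_sum N (c *s v) \<le> \<bar>Re c\<bar> * rotation_sum N v + \<bar>Im c\<bar> * rotation_sum N v"
    using rotation_sum_add[OF assms, of "Re c *\<^sub>R v" "Im c *\<^sub>R (\<i> *s v)"]
    by (simp add: vector_smult_Re_Im[of c v] rotation_sum_scaleR[OF assms] rotation_sum_i)
  also have "\<dots> = (\<bar>Re c\<bar> + \<bar>Im c\<bar>) * rotation_sum N v" by (simp add: algebra_simps)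
  also have "\<dots> \<le> 2 * cmod c * rotation_sum N v"
    by (intro mult_right_mono abs_Re_Im_le rotation_sum_nonneg assms)
  finally show ?thesis .
qed

lemma rotation_sum_sum:
  assumes "sublinear N"
  shows "rotation_sum N (\<Sum>i\<in>I. f i) \<le> (\<Sum>i\<in>I. rotation_sum N (f i))"
proof (induction I rule: infinite_finite_induct)
  case (insert x F)
  then show ?case using rotation_sum_add[OF assms, of "f x" "sum f F"] by simp
qed (simp_all add: rotation_sum_def sublinear_zero[OF assms])

text \<open>The basis is indexed by the coordinate type, with the two given vectors in prescribed
  positions, so that it can form the columns of a square matrix.\<close>

lemma independent_family_extend:
  fixes e1 e2 :: "complex^'d"
  assumes "vec.independent {e1, e2}" "e1 \<noteq> e2" "i1 \<noteq> i2"
  obtains h where "h i1 = e1" "h i2 = e2"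
    "\<And>c. (\<Sum>i\<in>UNIV. c i *s h i) = 0 \<Longrightarrow> \<forall>i::'d. c i = 0"
proof -
  obtain B where B: "{e1, e2} \<subseteq> B" "vec.independent B" "UNIV \<subseteq> vec.span B"
    using vec.maximal_independent_subset_extend[OF subset_UNIV assms(1)] by metis
  have "card B = CARD('d)"
    using vec.basis_card_eq_dim[OF subset_UNIV B(3,2)] by (simp add: card_cart_basis)
  moreover have finB: "finite B" using B(2) vec.finiteI_independent by blast
  ultimately have "card (B - {e1, e2}) = card (UNIV - {i1, i2})"
    using B(1) assms(2,3) by (subst (1 2) card_Diff_subset) auto
  then obtain g where g: "bij_betw g (UNIV - {i1, i2}) (B - {e1, e2})"
    using finB by (metis finite_Diff finite_same_card_bij finite)
  define h where "h i = (if i = i1 then e1 else if i = i2 then e2 else g i)" for i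
  have gin: "g i \<in> B - {e1, e2}" if "i \<noteq> i1" "i \<noteq> i2" for i
    using bij_betwE[OF g] that by simp
  have ginj: "g i = g j \<Longrightarrow> i = j" if "i \<noteq> i1" "i \<noteq> i2" "j \<noteq> i1" "j \<noteq> i2" for i j
    using inj_onD[OF bij_betw_imp_inj_on[OF g], of i j] that by simp
  have inj: "inj h"
  proof (rule injI)
    fix i j assume "h i = h j"
    then show "i = j" using gin[of i] gin[of j] ginj[of i j] assms(2)
      by (auto simp: h_def split: if_splits)
  qed
  have ran: "range h \<subseteq> B" using gin B(1) by (auto simp: h_def)
  show ?thesis
  proof (rule that[of h])
    show "h i1 = e1" "h i2 = e2" using assms(3) by (auto simp: h_def)
    fix c assume "(\<Sum>i\<in>UNIV. c i *s h i) = 0"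
    then have "(\<Sum>b\<in>range h. c (inv h b) *s b) = 0"
      by (subst sum.reindex[OF inj]) (simp add: inv_f_f[OF inj])
    then have "c (inv h (h i)) = 0" for i
      by (intro vec.independentD[OF B(2) _ ran]) auto
    then show "\<forall>i. c i = 0" by (simp add: inv_f_f[OF inj])
  qed
qed

section \<open>Bounded families of bases and maximal determinants\<close>

lemma continuous_on_det: "continuous_on S (det :: complex^'n^'n \<Rightarrow> complex)"
  unfolding det_def by (intro continuous_intros)

lemma continuous_on_column: "continuous_on S (\<lambda>A :: complex^'n^'m. column j A)"
  unfolding column_def by (intro continuous_intros)

lemma bounded_matrix_columns:
  assumes "\<And>A j. A \<in> K \<Longrightarrow> norm (column j (A :: complex^'n^'m)) \<le> b j"
  shows "bounded K"
proof (rule boundedI)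
  fix A assume A: "A \<in> K"
  have "norm A \<le> (\<Sum>i\<in>UNIV. norm (A $ i))"
    unfolding norm_vec_def by (intro L2_set_le_sum) simp
  also have "\<dots> \<le> (\<Sum>i\<in>(UNIV::'m set). \<Sum>j\<in>UNIV. b j)"
  proof (rule sum_mono)
    fix i
    have "norm (A $ i) \<le> (\<Sum>j\<in>UNIV. norm (A $ i $ j))"
      unfolding norm_vec_def[of "A $ i"] by (intro L2_set_le_sum) simp
    also have "\<dots> \<le> (\<Sum>j\<in>UNIV. b j)"
    proof (rule sum_mono)
      fix j
      have "norm (A $ i $ j) = norm (column j A $ i)" by (simp add: column_def)
      also have "\<dots> \<le> norm (column j A)" by (rule Finite_Cartesian_Product.norm_nth_le)
      also have "\<dots> \<le> b j" by (rule assms[OF A])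
      finally show "norm (A $ i $ j) \<le> b j" .
    qed
    finally show "norm (A $ i) \<le> (\<Sum>j\<in>UNIV. b j)" .
  qed
  finally show "norm A \<le> (\<Sum>i\<in>(UNIV::'m set). \<Sum>j\<in>UNIV. b j)" .
qed

text \<open>Auerbach's argument: the remaining columns are chosen in the unit ball so as to maximise
  the modulus of the determinant, and Cramer's rule then bounds the coordinates.\<close>

lemma auerbach_extension:
  fixes M :: "complex^'d \<Rightarrow> real" and e1 e2 :: "complex^'d" and i1 i2 :: 'd
  assumes "vec.independent {e1, e2}" "e1 \<noteq> e2" "i1 \<noteq> i2"
    and lower: "0 < b" "\<And>v. b * norm v \<le> M v"
    and cont: "continuous_on UNIV M"
    and hom: "\<And>r v. 0 \<le> r \<Longrightarrow> M (r *\<^sub>R v) = r * M v"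
  obtains A where "invertible A" "column i1 A = e1" "column i2 A = e2"
    "\<And>j. j \<noteq> i1 \<Longrightarrow> j \<noteq> i2 \<Longrightarrow> M (column j A) \<le> 1"
    "\<And>j c. j \<noteq> i1 \<Longrightarrow> j \<noteq> i2 \<Longrightarrow> cmod (c $ j) \<le> M (A *v c)"
proof -
  have Mpos: "0 < M v" if "v \<noteq> 0" for v
    using lower(1) lower(2)[of v] that by (meson less_le_trans mult_pos_pos zero_less_norm_iff)
  define K where "K = {A :: complex^'d^'d. column i1 A = e1 \<and> column i2 A = e2 \<and>
     (\<forall>j. j \<noteq> i1 \<and> j \<noteq> i2 \<longrightarrow> M (column j A) \<le> 1)}"
  have "closed K" unfolding K_def
    by (intro closed_Collect_conj closed_Collect_all closed_Collect_imp open_Collect_const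
        closed_Collect_eq closed_Collect_le continuous_on_column continuous_on_const
        continuous_on_compose2[OF cont]) auto
  moreover have "bounded K"
  proof (rule bounded_matrix_columns)
    fix A j assume "A \<in> K"
    show "norm (column j A) \<le> norm e1 + norm e2 + 1 / b"
    proof (cases "j = i1 \<or> j = i2")
      case True
      then show ?thesis using \<open>A \<in> K\<close> lower(1) by (auto simp: K_def add_increasing add_increasing2)
    next
      case False
      then have "b * norm (column j A) \<le> 1"
        using \<open>A \<in> K\<close> lower(2)[of "column j A"] by (auto simp: K_def intro: order_trans)
      then have "norm (column j A) \<le> 1 / b" using lower(1) by (simp add: field_simps)
      then show ?thesis by (simp add: add_increasing)
    qed
  qed
  ultimately have "compact K" by (simp add: compact_eq_bounded_closed)
  obtain h where h: "h i1 = e1" "h i2 = e2"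
    "\<And>c. (\<Sum>i\<in>UNIV. c i *s h i) = 0 \<Longrightarrow> \<forall>i::'d. c i = 0"
    using independent_family_extend[OF assms(1-3)] by metis
  have hnz: "h i \<noteq> 0" for i
  proof
    assume "h i = 0"
    then have "(\<Sum>j\<in>UNIV. (if j = i then 1 else 0) *s h j) = 0"
      by (intro sum.neutral) auto
    from h(3)[OF this] show False by (metis one_neq_zero)
  qed
  \<comment> \<open>Rescaling the free basis vectors to \<open>M\<close>-value 1 puts an invertible
    matrix into \<open>K\<close>, so the maximal determinant is non-zero.\<close>
  define s where "s i = (if i = i1 \<or> i = i2 then 1 else 1 / M (h i))" for i
  have spos: "s i > 0" for i using Mpos[OF hnz] by (simp add: s_def)
  define A0 :: "complex^'d^'d" where "A0 = (\<chi> i j. (s j *\<^sub>R h j) $ i)"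
  have col: "column j A0 = s j *\<^sub>R h j" for j
    by (simp add: A0_def column_def vec_eq_iff)
  have "A0 \<in> K"
    using h(1,2) Mpos[OF hnz] by (auto simp: K_def col s_def hom less_imp_le)
  have "\<exists>B. B ** A0 = mat 1"
    unfolding matrix_left_invertible_independent_columns col
  proof (intro allI impI)
    fix c i assume "(\<Sum>i\<in>UNIV. c i *s s i *\<^sub>R h i) = 0"
    moreover have "c i *s s i *\<^sub>R h i = (c i * of_real (s i)) *s h i" for i
      by (simp add: complex_scaleR_eq[symmetric] vector_smult_assoc)
    ultimately have "c i * of_real (s i) = 0" using h(3)[of "\<lambda>i. c i * of_real (s i)"] by simp
    then show "c i = 0" using spos[of i] by simp
  qed
  then have "det A0 \<noteq> 0" by (metis invertible_det_nz invertible_left_inverse)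
  obtain A where A: "A \<in> K" "\<And>B. B \<in> K \<Longrightarrow> cmod (det B) \<le> cmod (det A)"
    using continuous_attains_sup[OF \<open>compact K\<close> _ continuous_on_norm[OF continuous_on_det]] \<open>A0 \<in> K\<close>
    by (metis empty_iff)
  have "0 < cmod (det A0)" using \<open>det A0 \<noteq> 0\<close> by simp
  then have detA: "0 < cmod (det A)" using A(2)[OF \<open>A0 \<in> K\<close>] by linarith
  show ?thesis
  proof (rule that[of A])
    show "invertible A" using detA by (auto simp: invertible_det_nz)
    show "column i1 A = e1" "column i2 A = e2"
      "\<And>j. j \<noteq> i1 \<Longrightarrow> j \<noteq> i2 \<Longrightarrow> M (column j A) \<le> 1" using A(1) by (auto simp: K_def)
    fix j c assume j: "j \<noteq> i1" "j \<noteq> i2"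
    have unit: "cmod (c $ j) \<le> 1" if "M (A *v c) \<le> 1" for c
    proof -
      \<comment> \<open>By Cramer's rule, replacing column \<open>j\<close> by \<open>A *v c\<close>
        multiplies the determinant by \<open>c $ j\<close>; the new matrix stays in
        \<open>K\<close>, and maximality bounds the factor.\<close>
      define B :: "complex^'d^'d" where "B = (\<chi> i k. if k = j then (A *v c) $ i else A $ i $ k)"
      have "column k B = (if k = j then A *v c else column k A)" for k
        by (auto simp: B_def column_def vec_eq_iff)
      then have "B \<in> K" using A(1) j that by (auto simp: K_def)
      then have "cmod (c $ j * det A) \<le> cmod (det A)"
        using A(2)[of B] cramer_lemma[of j A c] by (simp add: B_def)
      then show ?thesis using detA by (simp add: norm_mult)
    qed
    show "cmod (c $ j) \<le> M (A *v c)"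
    proof (cases "c = 0")
      case True
      then show ?thesis using hom[of 0 0] by simp
    next
      case False
      then have "A *v c \<noteq> 0" using detA
        by (metis invertible_det_nz matrix_left_invertible_ker invertible_left_inverse zero_less_norm_iff)
      then have m: "0 < M (A *v c)" by (rule Mpos)
      let ?r = "inverse (M (A *v c))"
      have "A *v (?r *\<^sub>R c) = ?r *\<^sub>R (A *v c)"
        by (rule matrix_vector_mult_scaleR_complex)
      then have "cmod ((?r *\<^sub>R c) $ j) \<le> 1"
        using m by (intro unit) (simp add: hom)
      then show ?thesis using m by (simp add: field_simps)
    qed
  qed
qed

section \<open>Domains without complex lines in terms of gauges\<close>

lemma minkowski_functional_bound:
  fixes z :: "'a::real_normed_vector"
  assumes "open \<Omega>" "convex \<Omega>" "z \<in> \<Omega>"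
  shows "\<exists>B. \<forall>v. minkowski_functional \<Omega> z v \<le> B * norm v"
proof -
  obtain r where r: "0 < r" "ball z r \<subseteq> \<Omega>" using assms open_contains_ball by blast
  have "minkowski_functional \<Omega> z v \<le> inverse r * norm v" for v
  proof (rule minkowski_functional_leI[OF assms])
    fix t assume t: "inverse r * norm v < t"
    moreover have "0 \<le> inverse r * norm v" using r(1) by simp
    ultimately have "0 < t" by linarith
    then have "norm (inverse t *\<^sub>R v) < r" using t r(1) by (simp add: field_simps)
    then have "z + inverse t *\<^sub>R v \<in> ball z r" by (simp add: dist_norm)
    then show "z + inverse t *\<^sub>R v \<in> \<Omega>" using r(2) by blast
  qed (use r(1) in simp)
  then show ?thesis by blast
qed

lemma continuous_on_rotation_sum:
  assumes "sublinear N" "\<And>v. N v \<le> B * norm v"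
  shows "continuous_on S (rotation_sum N)"
proof -
  have N: "continuous_on UNIV N" by (rule continuous_on_sublinear[OF assms])
  have i: "continuous_on S (\<lambda>v. \<i> *s v)" for S :: "(complex^'a) set"
    unfolding vector_scalar_mult_def by (intro continuous_intros)
  show ?thesis unfolding rotation_sum_def
    by (intro continuous_intros continuous_on_compose2[OF N] i) auto
qed

text \<open>If the sum vanished at \<open>v\<close>, the gauge would vanish on all complex multiples
  of \<open>v\<close>, and the complex line through \<open>z\<close> in direction \<open>v\<close>
  would lie in \<open>\<Omega>\<close>. Compactness of the unit sphere turns positivity into a
  constant.\<close>

lemma rotation_sum_minkowski_lower:
  fixes \<Omega> :: "(complex^'d) set"
  assumes "\<Omega> \<in> convex_domains" "z \<in> \<Omega>"
  obtains b where "0 < b" "\<And>v. b * norm v \<le> rotation_sum (minkowski_functional \<Omega> z) v"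
proof -
  let ?G = "minkowski_functional \<Omega> z"
  have \<Omega>: "open \<Omega>" "convex \<Omega>" using assms(1) by (auto simp: convex_domains_def)
  have sub: "sublinear ?G" using sublinear_minkowski_functional[OF \<Omega> assms(2)] .
  have pos: "0 < rotation_sum ?G v" if "v \<noteq> 0" for v
  proof (rule ccontr)
    assume "\<not> ?thesis"
    then have "rotation_sum ?G v \<le> 0" by simp
    have "?G (c *s v) < 1" for c
    proof -
      have "?G (c *s v) \<le> 2 * cmod c * rotation_sum ?G v"
        using rotation_sum_ge[OF sub] rotation_sum_smult_le[OF sub] order_trans by blast
      also have "\<dots> \<le> 0" using \<open>rotation_sum ?G v \<le> 0\<close> by (simp add: mult_nonneg_nonpos)
      finally show ?thesis by simp
    qed
    then have "range (\<lambda>c. z + c *s v) \<subseteq> \<Omega>"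
      using minkowski_functional_less_one_iff[OF \<Omega> assms(2)] by auto
    then show False using assms(1) complex_line_plane[OF that] by (auto simp: convex_domains_def)
  qed
  obtain B where B: "\<And>v. ?G v \<le> B * norm v" using minkowski_functional_bound[OF \<Omega> assms(2)] by blast
  have cont: "continuous_on UNIV (rotation_sum ?G)" by (rule continuous_on_rotation_sum[OF sub B])
  have "axis undefined 1 \<in> sphere (0::complex^'d) 1" by simp
  then obtain u where u: "u \<in> sphere 0 1" "\<And>v. v \<in> sphere 0 1 \<Longrightarrow> rotation_sum ?G u \<le> rotation_sum ?G v"
    using continuous_attains_inf[OF compact_sphere _ continuous_on_subset[OF cont subset_UNIV]]
    by (metis empty_iff)
  show ?thesis
  proof (rule that[of "rotation_sum ?G u"])
    show "0 < rotation_sum ?G u" using u(1) by (intro pos) auto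
    fix v show "rotation_sum ?G u * norm v \<le> rotation_sum ?G v"
    proof (cases "v = 0")
      case False
      then have "rotation_sum ?G u \<le> rotation_sum ?G (inverse (norm v) *\<^sub>R v)"
        by (intro u(2)) simp
      then show ?thesis using False by (simp add: rotation_sum_scaleR[OF sub] field_simps)
    qed (simp add: rotation_sum_nonneg[OF sub])
  qed
qed

lemma matrix_vector_mult_columns:
  "A *v c = (\<Sum>j\<in>UNIV. c $ j *s column j (A :: complex^'n^'m))"
  by (simp add: matrix_mult_sum)

text \<open>A complex line anywhere in the sublevel set forces the gauge to vanish on its direction,
  even when the line misses the origin. This is how the absence of complex lines is checked for a
  limit.\<close>

lemma sublevel_in_convex_domains:
  fixes N :: "complex^'d \<Rightarrow> real"
  assumes N: "sublinear N" "\<And>v. N v \<le> B * norm v"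
    and pos: "\<And>v. v \<noteq> 0 \<Longrightarrow> 0 < rotation_sum N v"
  shows "{v. N v < 1} \<in> convex_domains"
proof -
  have "continuous_on UNIV N" by (rule continuous_on_sublinear[OF N])
  then have "open {v. N v < 1}" by (intro open_Collect_less) auto
  moreover have "convex {v. N v < 1}" by (rule convex_sublevel_sublinear[OF N(1)])
  moreover have "0 \<in> {v. N v < 1}" using sublinear_zero[OF N(1)] by simp
  moreover have False if L: "complex_affine_plane 1 L" "L \<subseteq> {v. N v < 1}" for L
  proof -
    obtain p W where W: "vec.subspace W" "vec.dim W = 1" "L = (+) p ` W"
      using L(1) unfolding complex_affine_plane_def by blast
    then obtain v where v: "v \<in> W" "v \<noteq> 0"
      by (metis vec.dim_eq_0 One_nat_def nat.distinct(1) subset_singletonD subsetI singleton_iff empty_subsetI)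
    have N0: "N (c *s v) \<le> 0" for c
    proof (rule ccontr)
      assume "\<not> N (c *s v) \<le> 0"
      then have cv: "0 < N (c *s v)" by simp
      \<comment> \<open>With this \<open>s\<close> the gauge of \<open>s *\<^sub>R (c *s v)\<close>
        is exactly \<open>1 + N (- p)\<close>, whereas subadditivity bounds it strictly below that
        value.\<close>
      define s where "s = (1 + N (- p)) / N (c *s v)"
      have s: "0 \<le> s" using sublinear_nonneg[OF N(1), of "-p"] cv by (simp add: s_def)
      have "p + (of_real s * c) *s v \<in> L"
        unfolding W(3) using W(1) v(1) by (intro imageI vec.subspace_scale)
      then have "p + s *\<^sub>R (c *s v) \<in> L" by (simp add: complex_scaleR_eq[symmetric] vector_smult_assoc)
      then have "N (p + s *\<^sub>R (c *s v)) < 1" using L(2) by blast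
      moreover have "N (s *\<^sub>R (c *s v)) \<le> N (p + s *\<^sub>R (c *s v)) + N (- p)"
        using sublinear_add[OF N(1), of "p + s *\<^sub>R (c *s v)" "-p"] by simp
      moreover have "N (s *\<^sub>R (c *s v)) = 1 + N (- p)"
        using cv by (simp add: sublinear_scaleR[OF N(1) s]) (simp add: s_def)
      ultimately show False by simp
    qed
    have "rotation_sum N v \<le> 0"
      using N0[of 1] N0[of "-1"] N0[of "\<i>"] N0[of "-\<i>"]
      by (simp add: rotation_sum_def)
    then show False using pos[OF v(2)] by simp
  qed
  ultimately show ?thesis unfolding convex_domains_def by blast
qed

text \<open>\<open>B\<close> is the inverse of \<open>A\<close>, and the affine map moves
  \<open>z\<close> to the origin. The gauge of the image is therefore the old gauge composed with
  \<open>A\<close>.\<close>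

lemma image_affine_eq_sublevel:
  fixes \<Omega> :: "(complex^'d) set" and A :: "complex^'d^'d"
  assumes "open \<Omega>" "convex \<Omega>" "z \<in> \<Omega>" "A ** B = mat 1"
  shows "(\<lambda>x. B *v x + - (B *v z)) ` \<Omega> = {x. minkowski_functional \<Omega> z (A *v x) < 1}"
proof -
  have BA: "B ** A = mat 1" using assms(4) by (simp add: matrix_left_right_inverse)
  have 1: "A *v (B *v x) = x" for x
    by (simp add: matrix_vector_mul_assoc assms(4))
  have 2: "B *v (A *v x) = x" for x
    by (simp add: matrix_vector_mul_assoc BA)
  show ?thesis
    unfolding minkowski_functional_less_one_iff[OF assms(1-3)]
  proof (intro set_eqI iffI)
    fix y assume "y \<in> (\<lambda>x. B *v x + - (B *v z)) ` \<Omega>"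
    then obtain x where x: "x \<in> \<Omega>" "y = B *v x + - (B *v z)" by blast
    then have "z + A *v y = x" by (simp add: matrix_vector_mult_diff_distrib 1)
    then show "y \<in> {x. z + A *v x \<in> \<Omega>}" using x(1) by simp
  next
    fix y assume "y \<in> {x. z + A *v x \<in> \<Omega>}"
    then show "y \<in> (\<lambda>x. B *v x + - (B *v z)) ` \<Omega>"
      by (intro image_eqI[of _ _ "z + A *v y"]) (simp_all add: matrix_vector_right_distrib 2)
  qed
qed

section \<open>Extraction of affine limits\<close>

lemma compactly_divergent_tendsto:
  fixes z :: "nat \<Rightarrow> 'a::t2_space"
  assumes "z \<longlonglongrightarrow> p" "p \<notin> \<Omega>"
  shows "compactly_divergent \<Omega> z"
  unfolding compactly_divergent_def
proof (intro allI impI)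
  fix K assume K: "compact K \<and> K \<subseteq> \<Omega>"
  then have "open (- K)" "p \<in> - K" using assms(2) by (auto intro: compact_imp_closed)
  then show "\<forall>\<^sub>F n in sequentially. z n \<notin> K"
    using topological_tendstoD[OF assms(1)] by fastforce
qed

lemma rotation_sum_matrix:
  "rotation_sum N (A *v v) = rotation_sum (\<lambda>v. N (A *v v)) (v :: complex^'d)"
proof -
  have "A *v (c *s v) = c *s (A *v v)" for c by (simp add: vec.scale)
  moreover have "A *v (- w) = - (A *v w)" for w by (simp add: vec.neg)
  ultimately show ?thesis by (simp add: rotation_sum_def)
qed

lemma matrix_vector_mult_axis:
  "A *v axis i s = s *s column i (A :: complex^'d^'d)"
  by (simp add: vec_eq_iff matrix_vector_mult_def column_def axis_def if_distrib cong: if_cong)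

text \<open>The compactness step. The upper bounds make the rescaled gauges uniformly Lipschitz, so
  a subsequence converges; the lower bounds keep every coordinate under control, so the limit
  contains no complex line. Estimates are demanded only on the plane of \<open>e1 n\<close> and
  \<open>e2 n\<close>, since the other columns are chosen by maximal determinants. The last
  conclusion identifies the limit gauge on that plane.\<close>

lemma affine_limit_extraction:
  fixes \<Omega> :: "(complex^'d) set" and z e1 e2 :: "nat \<Rightarrow> complex^'d" and i1 i2 :: 'd
  defines "G \<equiv> \<lambda>n. minkowski_functional \<Omega> (z n)"
  assumes \<Omega>: "\<Omega> \<in> convex_domains" and z: "\<And>n. z n \<in> \<Omega>" "z \<longlonglongrightarrow> p" "p \<notin> \<Omega>"
    and i12: "i1 \<noteq> i2" and ind: "\<And>n. vec.independent {e1 n, e2 n}" "\<And>n. e1 n \<noteq> e2 n"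
    and up: "\<And>n. rotation_sum (G n) (e1 n) \<le> B" "\<And>n. rotation_sum (G n) (e2 n) \<le> B"
    and k: "0 \<le> k" and low1: "\<And>n s t. cmod s \<le> k * rotation_sum (G n) (s *s e1 n + t *s e2 n)"
    and low2: "\<And>n s t. cmod t \<le> k * rotation_sum (G n) (s *s e1 n + t *s e2 n)"
  obtains r N C where "strict_mono (r :: nat \<Rightarrow> nat)" "sublinear N" "\<And>v. N v \<le> C * norm v"
    "{v. N v < 1} \<in> affine_limits \<Omega>"
    "\<And>s t. (\<lambda>n. G (r n) (s *s e1 (r n) + t *s e2 (r n))) \<longlonglongrightarrow> N (axis i1 s + axis i2 t)"
proof -
  have oc: "open \<Omega>" "convex \<Omega>" using \<Omega> by (auto simp: convex_domains_def)
  have G: "sublinear (G n)" for n unfolding G_def by (rule sublinear_minkowski_functional[OF oc z(1)])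
  have "\<exists>A. invertible A \<and> column i1 A = e1 n \<and> column i2 A = e2 n \<and>
     (\<forall>j. j \<noteq> i1 \<longrightarrow> j \<noteq> i2 \<longrightarrow> rotation_sum (G n) (column j A) \<le> 1 \<and>
       (\<forall>c. cmod (c $ j) \<le> rotation_sum (G n) (A *v c)))" for n
  proof -
    obtain b where b: "0 < b" "\<And>v. b * norm v \<le> rotation_sum (G n) v"
      unfolding G_def using rotation_sum_minkowski_lower[OF \<Omega> z(1)] by metis
    obtain B where "\<And>v. G n v \<le> B * norm v"
      unfolding G_def using minkowski_functional_bound[OF oc z(1)] by metis
    then have "continuous_on UNIV (rotation_sum (G n))" by (rule continuous_on_rotation_sum[OF G])
    moreover have "rotation_sum (G n) (r *\<^sub>R v) = r * rotation_sum (G n) v" if "0 \<le> r" for r v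
      using that by (simp add: rotation_sum_scaleR[OF G])
    ultimately obtain A where "invertible A" "column i1 A = e1 n" "column i2 A = e2 n"
      "\<And>j. j \<noteq> i1 \<Longrightarrow> j \<noteq> i2 \<Longrightarrow> rotation_sum (G n) (column j A) \<le> 1"
      "\<And>j c. j \<noteq> i1 \<Longrightarrow> j \<noteq> i2 \<Longrightarrow> cmod (c $ j) \<le> rotation_sum (G n) (A *v c)"
      using auerbach_extension[OF ind i12 b, of n] by metis
    then show ?thesis by blast
  qed
  then obtain A where A: "\<And>n. invertible (A n)" "\<And>n. column i1 (A n) = e1 n" "\<And>n. column i2 (A n) = e2 n"
    and A1: "\<And>n j. j \<noteq> i1 \<Longrightarrow> j \<noteq> i2 \<Longrightarrow> rotation_sum (G n) (column j (A n)) \<le> 1"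
    and A2: "\<And>n j c. j \<noteq> i1 \<Longrightarrow> j \<noteq> i2 \<Longrightarrow> cmod (c $ j) \<le> rotation_sum (G n) (A n *v c)"
    by metis
  \<comment> \<open>\<open>P n\<close> is the gauge at \<open>z n\<close> in the coordinates given
    by the columns of \<open>A n\<close>.\<close>
  define P where "P n v = G n (A n *v v)" for n v
  have Psub: "sublinear (P n)" for n
    unfolding sublinear_def P_def
    using sublinear_nonneg[OF G] sublinear_add[OF G] sublinear_scaleR[OF G]
    by (simp add: matrix_vector_right_distrib matrix_vector_mult_scaleR_complex)
  define B' where "B' = max B 1"
  have colB: "rotation_sum (G n) (column j (A n)) \<le> B'" for n j
    using A1[of j n] up[of n] A(2,3)[of n] by (cases "j = i1 \<or> j = i2") (auto simp: B'_def)
  have B'1: "1 \<le> B'" by (simp add: B'_def)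
  define C where "C = real CARD('d) * (2 * B')"
  have Pbound: "P n v \<le> C * norm v" for n v
  proof -
    have "P n v \<le> (\<Sum>j\<in>UNIV. G n (v $ j *s column j (A n)))"
      unfolding P_def matrix_vector_mult_columns by (rule sublinear_sum[OF G])
    also have "\<dots> \<le> (\<Sum>j\<in>(UNIV::'d set). 2 * B' * norm v)"
    proof (rule sum_mono)
      fix j
      have "G n (v $ j *s column j (A n)) \<le> 2 * cmod (v $ j) * rotation_sum (G n) (column j (A n))"
        using rotation_sum_ge[OF G] rotation_sum_smult_le[OF G] order_trans by blast
      also have "\<dots> \<le> 2 * norm v * B'"
        by (intro mult_mono colB mult_left_mono Finite_Cartesian_Product.norm_nth_le rotation_sum_nonneg G) auto
      finally show "G n (v $ j *s column j (A n)) \<le> 2 * B' * norm v" by (simp add: mult_ac)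
    qed
    finally show ?thesis by (simp add: C_def)
  qed
  have Plip: "\<bar>P n x - P n y\<bar> \<le> C * norm (x - y)" for n x y
    by (rule sublinear_abs_diff_le[OF Psub Pbound])
  have Pabs: "\<bar>P n x\<bar> \<le> C * norm x" for n x
    using Pbound[of n x] sublinear_nonneg[OF Psub, of n x] by simp
  \<comment> \<open>The summand 1 serves the free coordinates. For the two distinguished ones the
    free columns are subtracted first, at a cost of at most twice the rotation sum each, and then
    \<open>low1\<close> and \<open>low2\<close> apply with the constant \<open>k\<close>.\<close>
  define K where "K = 1 + k * (1 + real CARD('d) * 2)"
  have K: "cmod (v $ j) \<le> K * rotation_sum (P n) v" for n v j
  proof -
    have rs: "rotation_sum (P n) v = rotation_sum (G n) (A n *v v)"
      unfolding P_def by (rule rotation_sum_matrix[symmetric])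
    have nn: "0 \<le> rotation_sum (G n) (A n *v v)" by (rule rotation_sum_nonneg[OF G])
    define J where "J = UNIV - {i1, i2}"
    define w where "w = v $ i1 *s e1 n + v $ i2 *s e2 n"
    have J: "UNIV = insert i1 (insert i2 J)" "i1 \<notin> insert i2 J" "i2 \<notin> J"
      using i12 by (auto simp: J_def)
    have "A n *v v = (\<Sum>j\<in>insert i1 (insert i2 J). v $ j *s column j (A n))"
      unfolding matrix_vector_mult_columns by (rule sum.cong[OF J(1) refl])
    then have "A n *v v = w + (\<Sum>j\<in>J. v $ j *s column j (A n))"
      using J(2,3) by (simp add: A w_def add.assoc)
    then have w: "A n *v v + (\<Sum>j\<in>J. (- v $ j) *s column j (A n)) = w"
      by (simp add: sum_negf)
    have "rotation_sum (G n) w \<le> rotation_sum (G n) (A n *v v) +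
        rotation_sum (G n) (\<Sum>j\<in>J. (- v $ j) *s column j (A n))"
      unfolding w[symmetric] by (rule rotation_sum_add[OF G])
    also have "\<dots> \<le> rotation_sum (G n) (A n *v v) +
        (\<Sum>j\<in>J. rotation_sum (G n) ((- v $ j) *s column j (A n)))"
      by (intro add_left_mono rotation_sum_sum G)
    also have "\<dots> \<le> rotation_sum (G n) (A n *v v) + (\<Sum>j\<in>J. 2 * rotation_sum (G n) (A n *v v))"
    proof (intro add_left_mono sum_mono)
      fix j assume "j \<in> J"
      then have j: "j \<noteq> i1" "j \<noteq> i2" by (auto simp: J_def)
      have "rotation_sum (G n) ((- v $ j) *s column j (A n)) \<le> 2 * cmod (v $ j) * rotation_sum (G n) (column j (A n))"
        using rotation_sum_smult_le[OF G, of n "- v $ j"] by simp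
      also have "\<dots> \<le> 2 * rotation_sum (G n) (A n *v v) * 1"
        by (intro mult_mono A1 j mult_left_mono A2 rotation_sum_nonneg G) (auto intro: nn)
      finally show "rotation_sum (G n) ((- v $ j) *s column j (A n)) \<le> 2 * rotation_sum (G n) (A n *v v)" by simp
    qed
    also have "\<dots> \<le> (1 + real CARD('d) * 2) * rotation_sum (G n) (A n *v v)"
    proof -
      have "real (card J) \<le> real CARD('d)" by (simp add: card_mono)
      then have "real (card J) * (2 * rotation_sum (G n) (A n *v v)) \<le> real CARD('d) * (2 * rotation_sum (G n) (A n *v v))"
        by (intro mult_right_mono) (use nn in auto)
      then show ?thesis by (simp add: algebra_simps)
    qed
    finally have rw: "k * rotation_sum (G n) w \<le> (k * (1 + real CARD('d) * 2)) * rotation_sum (G n) (A n *v v)"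
      using k by (simp add: mult_left_mono mult.assoc)
    show ?thesis
    proof (cases "j = i1 \<or> j = i2")
      case True
      then have "cmod (v $ j) \<le> k * rotation_sum (G n) w"
        using low1[of "v $ i1" n "v $ i2"] low2[of "v $ i2" n "v $ i1"] by (auto simp: w_def)
      then show ?thesis using rw nn unfolding rs K_def by (simp add: algebra_simps)
    next
      case False
      then have "cmod (v $ j) \<le> rotation_sum (G n) (A n *v v)" using A2 by blast
      also have "\<dots> \<le> K * rotation_sum (G n) (A n *v v)"
        using mult_right_mono[of 1 K, OF _ nn] k by (simp add: K_def)
      finally show ?thesis unfolding rs .
    qed
  qed
  obtain r N where r: "strict_mono (r :: nat \<Rightarrow> nat)" and lim: "\<And>x. (\<lambda>n. P (r n) x) \<longlonglongrightarrow> N x"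
    using equi_lipschitz_convergent_subsequence[of P C, OF Pabs Plip] by metis
  have Nsub: "sublinear N"
    unfolding sublinear_def
  proof (intro conjI allI impI)
    fix x y show "0 \<le> N x"
      by (rule LIMSEQ_le_const[OF lim]) (use sublinear_nonneg[OF Psub] in blast)
    show "N (x + y) \<le> N x + N y"
      by (rule LIMSEQ_le[OF lim tendsto_add[OF lim lim]]) (use sublinear_add[OF Psub] in blast)
  next
    fix c :: real and x assume "0 \<le> c"
    then have "(\<lambda>n. P (r n) (c *\<^sub>R x)) \<longlonglongrightarrow> c * N x"
      by (simp add: sublinear_scaleR[OF Psub] tendsto_mult_left lim)
    then show "N (c *\<^sub>R x) = c * N x" using LIMSEQ_unique lim by blast
  qed
  have Nbound: "N v \<le> C * norm v" for v
    by (rule LIMSEQ_le_const2[OF lim]) (use Pbound in blast)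
  have NK: "cmod (v $ j) \<le> K * rotation_sum N v" for v j
  proof (rule LIMSEQ_le_const)
    show "(\<lambda>n. K * rotation_sum (P (r n)) v) \<longlonglongrightarrow> K * rotation_sum N v"
      unfolding rotation_sum_def by (intro tendsto_intros lim)
  qed (use K in blast)
  have dom: "{v. N v < 1} \<in> convex_domains"
  proof (rule sublevel_in_convex_domains[OF Nsub Nbound])
    fix v :: "complex^'d" assume "v \<noteq> 0"
    then obtain j where "0 < cmod (v $ j)" by (auto simp: vec_eq_iff)
    then have "0 < K * rotation_sum N v" using NK[of v j] by linarith
    then show "0 < rotation_sum N v" using rotation_sum_nonneg[OF Nsub, of v] by (metis less_eq_real_def mult_zero_right order_less_irrefl)
  qed
  have "\<forall>n. \<exists>B. A n ** B = mat 1" using A(1) by (auto simp: invertible_def)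
  then obtain I where I: "\<And>n. A n ** I n = mat 1" by metis
  \<comment> \<open>The affine maps send \<open>z (r n)\<close> to the origin, so the base points
    converge trivially.\<close>
  define F where "F n x = I (r n) *v x + - (I (r n) *v z (r n))" for n x
  have "{v. N v < 1} \<in> affine_limits \<Omega>"
    unfolding affine_limits_def
  proof (intro CollectI conjI dom exI)
    show "\<forall>n. z (r n) \<in> \<Omega>" using z(1) by blast
    show "N 0 < 1" using sublinear_zero[OF Nsub] by simp
    show "\<forall>n. F n \<in> complex_affine_group"
    proof
      fix n
      have "invertible (I (r n))" using I[of "r n"] by (metis invertible_def matrix_left_right_inverse)
      then show "F n \<in> complex_affine_group" unfolding complex_affine_group_def F_def[abs_def] by blast
    qed
    have "(\<lambda>n. z (r n)) \<longlonglongrightarrow> p" using LIMSEQ_subseq_LIMSEQ[OF z(2) r] by (simp add: o_def)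
    then show "compactly_divergent \<Omega> (\<lambda>n. z (r n))" by (rule compactly_divergent_tendsto[OF _ z(3)])
    have "F n ` \<Omega> = {v. P (r n) v < 1}" for n
      unfolding F_def[abs_def] P_def G_def by (rule image_affine_eq_sublevel[OF oc z(1) I])
    then show "domains_converge (\<lambda>n. F n ` \<Omega>) {v. N v < 1}"
      using domains_converge_sublevel[of "\<lambda>n. P (r n)" C N, OF Psub Pbound lim Nsub Nbound] by simp
    show "(\<lambda>n. F n (z (r n))) \<longlonglongrightarrow> 0" by (simp add: F_def)
  qed
  moreover have "(\<lambda>n. G (r n) (s *s e1 (r n) + t *s e2 (r n))) \<longlonglongrightarrow> N (axis i1 s + axis i2 t)" for s t
    using lim[of "axis i1 s + axis i2 t"]
    by (simp add: P_def matrix_vector_right_distrib matrix_vector_mult_axis A)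
  ultimately show ?thesis using that r Nsub Nbound by blast
qed

section \<open>Averaging a holomorphic curve over a circle\<close>

text \<open>On the circle of radius \<open>\<rho>\<close> the function \<open>Q\<close> in the proof has the same real part as
  \<open>h t - b\<close> multiplied by the non-negative weight \<open>2 + 2 Re (u t\<^sup>k / \<rho>\<^sup>k)\<close>.\<close>

lemma coefficient_bound_of_Re_ge:
  assumes hol: "h holomorphic_on ball 0 R" "G holomorphic_on ball 0 R"
    and "0 < \<rho>" "\<rho> < R" "1 \<le> k"
    and h: "\<And>t. t \<in> ball 0 R \<Longrightarrow> h t = h0 + t ^ k * G t"
    and Re: "\<And>t. cmod t = \<rho> \<Longrightarrow> b \<le> Re (h t)"
  shows "\<rho> ^ k * cmod (G 0) \<le> 2 * (Re h0 - b)"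
proof -
  \<comment> \<open>\<open>u\<close> is the phase for which \<open>cnj u * G 0\<close> is minus
    \<open>cmod (G 0)\<close>; if \<open>G 0 = 0\<close> any unimodular value has this
    property.\<close>
  define u where "u = (if G 0 = 0 then 1 else - sgn (G 0))"
  have u: "cmod u = 1" by (simp add: u_def norm_sgn)
  have uG: "cnj u * G 0 = - complex_of_real (cmod (G 0))"
  proof (cases "G 0 = 0")
    case False
    then have "cnj u * G 0 = - (G 0 * cnj (G 0)) / of_real (cmod (G 0))" by (simp add: u_def sgn_eq)
    also have "\<dots> = - of_real (cmod (G 0))"
      using False by (simp add: complex_norm_square[symmetric] power2_eq_square)
    finally show ?thesis .
  qed simp
  define c where "c = u / of_real \<rho> ^ k"
  define h' where "h' t = h t - of_real b" for t
  define h1 where "h1 = h0 - of_real b"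
  \<comment> \<open>Put \<open>w = c * t ^ k\<close>, of modulus 1 on the circle. The
    non-holomorphic factor \<open>cnj w\<close> is eliminated: \<open>cnj w * t ^ k\<close> is
    constant on the circle, and \<open>cnj h1 * w\<close> has the same real part as
    \<open>cnj w * h1\<close>.\<close>
  define Q where "Q t = 2 * h' t + c * t ^ k * h' t + cnj u * of_real \<rho> ^ k * G t + cnj h1 * c * t ^ k" for t
  have Qhol: "Q holomorphic_on ball 0 R"
    unfolding Q_def h'_def by (intro holomorphic_intros hol)
  have Re_Q: "0 \<le> Re (Q t)" if t: "cmod t = \<rho>" for t
  proof -
    have "t \<in> ball 0 R" using t assms(4) by simp
    then have ht: "h' t = h1 + t ^ k * G t" by (simp add: h'_def h1_def h)
    define w where "w = c * t ^ k"
    have tn: "t \<noteq> 0" using t assms(3) by auto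
    have "cnj t * t = of_real (\<rho>\<^sup>2)" using t complex_norm_square[of t] by (simp only: mult.commute)
    then have "cnj t ^ k * t ^ k = of_real \<rho> ^ k * of_real \<rho> ^ k"
      by (simp add: power_mult_distrib[symmetric] power2_eq_square)
    then have wt: "cnj w * t ^ k = cnj u * of_real \<rho> ^ k"
      using assms(3) by (simp add: w_def c_def field_simps)
    have "cmod w = 1" using u t assms(3) by (simp add: w_def c_def norm_mult norm_divide norm_power)
    then have "- 1 \<le> Re w" using abs_Re_le_cmod[of w] by linarith
    have "cnj w * h' t = cnj w * h1 + cnj u * of_real \<rho> ^ k * G t"
      unfolding ht distrib_left using wt by (metis mult.assoc)
    then have "Q t = (2 + w + cnj w) * h' t + (cnj h1 * w - cnj w * h1)"
      by (simp add: Q_def w_def algebra_simps)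
    moreover have "2 + w + cnj w = of_real (2 + 2 * Re w)" by (simp add: complex_eq_iff)
    ultimately have "Re (Q t) = Re (of_real (2 + 2 * Re w) * h' t) + Re (cnj h1 * w - cnj w * h1)"
      by (simp only: plus_complex.sel)
    then have "Re (Q t) = (2 + 2 * Re w) * Re (h' t)" by simp
    moreover have "0 \<le> Re (h' t)" using Re[OF t] by (simp add: h'_def)
    ultimately show ?thesis using \<open>- 1 \<le> Re w\<close> by simp
  qed
  \<comment> \<open>The maximum principle carries the sign from the circle to the centre, where the
    value of \<open>Q\<close> exhibits the coefficient.\<close>
  have "Re (- Q 0) \<le> 0"
  proof (rule maximum_real_frontier[of "\<lambda>t. - Q t" "cball 0 \<rho>" 0 0])
    show "(\<lambda>t. - Q t) holomorphic_on interior (cball 0 \<rho>)"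
      using assms(4) by (intro holomorphic_intros holomorphic_on_subset[OF Qhol]) auto
    show "continuous_on (closure (cball 0 \<rho>)) (\<lambda>t. - Q t)"
      using assms(4) by (intro holomorphic_on_imp_continuous_on holomorphic_intros holomorphic_on_subset[OF Qhol]) auto
    show "Re (- Q z) \<le> 0" if "z \<in> frontier (cball 0 \<rho>)" for z
      using that Re_Q[of z] by simp
  qed (use assms(3) in auto)
  moreover have "Q 0 = 2 * h1 - of_real (\<rho> ^ k * cmod (G 0))"
  proof -
    have "h' 0 = h1" using assms(3-5) by (simp add: h'_def h1_def h)
    moreover have "cnj u * of_real \<rho> ^ k * G 0 = - of_real (\<rho> ^ k * cmod (G 0))"
    proof -
      have "cnj u * of_real \<rho> ^ k * G 0 = of_real \<rho> ^ k * (cnj u * G 0)" by (simp only: mult_ac)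
      then show ?thesis by (simp add: uG)
    qed
    ultimately show ?thesis using assms(5) by (simp add: Q_def power_0_left)
  qed
  ultimately show ?thesis by (simp add: h1_def)
qed

lemma inner_complex_vec: "a \<bullet> (x :: complex^'d) = Re (\<Sum>i\<in>UNIV. cnj (a $ i) * x $ i)"
  by (simp add: inner_vec_def inner_complex_def)

text \<open>A missing point is separated strictly from \<open>C\<close> by a real functional. It is
  the real part of a complex linear one, and composing the curve with the latter contradicts the
  scalar coefficient bound.\<close>

lemma averaged_disc_in_convex:
  fixes f g :: "complex \<Rightarrow> complex^'d"
  assumes C: "closed C" "convex C"
    and hol: "holomorphic_curve_on f (ball 0 R)" "holomorphic_curve_on g (ball 0 R)"
    and \<rho>: "0 < \<rho>" "\<rho> < R" "1 \<le> k"
    and fact: "\<And>t. t \<in> ball 0 R \<Longrightarrow> f t = p + t ^ k *s g t"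
    and fC: "\<And>t. cmod t = \<rho> \<Longrightarrow> f t \<in> C" and c: "cmod c \<le> 1"
  shows "p + (c * of_real (\<rho> ^ k / 2)) *s g 0 \<in> C"
proof (rule ccontr)
  assume "\<not> ?thesis"
  then obtain a b where ab: "a \<bullet> (p + (c * of_real (\<rho> ^ k / 2)) *s g 0) < b" "\<And>x. x \<in> C \<Longrightarrow> b < a \<bullet> x"
    using separating_hyperplane_closed_point[OF C(2,1)] by metis
  define l where "l x = (\<Sum>i\<in>UNIV. cnj (a $ i) * x $ i)" for x :: "complex^'d"
  have l: "Re (l x) = a \<bullet> x" for x by (simp add: l_def inner_complex_vec)
  have ladd: "l (x + s *s y) = l x + s * l y" for x y s
    by (simp add: l_def distrib_left sum.distrib sum_distrib_left mult_ac)
  have "\<rho> ^ k * cmod (l (g 0)) \<le> 2 * (Re (l p) - b)"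
  proof (rule coefficient_bound_of_Re_ge[of "\<lambda>t. l (f t)" R "\<lambda>t. l (g t)"])
    show "(\<lambda>t. l (f t)) holomorphic_on ball 0 R" "(\<lambda>t. l (g t)) holomorphic_on ball 0 R"
      using hol unfolding holomorphic_curve_on_def l_def by (auto intro!: holomorphic_intros)
    show "l (f t) = l p + t ^ k * l (g t)" if "t \<in> ball 0 R" for t
      using fact[OF that] ladd by simp
    show "b \<le> Re (l (f t))" if "cmod t = \<rho>" for t
      using ab(2)[OF fC[OF that]] by (simp add: l)
  qed (use \<rho> in auto)
  moreover have "a \<bullet> (p + (c * of_real (\<rho> ^ k / 2)) *s g 0) = Re (l p) + Re (c * of_real (\<rho> ^ k / 2) * l (g 0))"
    by (simp only: l[symmetric] ladd plus_complex.sel)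
  moreover have "\<bar>Re (c * of_real (\<rho> ^ k / 2) * l (g 0))\<bar> \<le> \<rho> ^ k / 2 * cmod (l (g 0))"
  proof -
    have "cmod (c * of_real (\<rho> ^ k / 2) * l (g 0)) = cmod c * (\<rho> ^ k / 2 * cmod (l (g 0)))"
      using \<rho>(1) by (simp add: norm_mult norm_power norm_divide)
    also have "\<dots> \<le> 1 * (\<rho> ^ k / 2 * cmod (l (g 0)))"
      using \<rho>(1) by (intro mult_right_mono c) auto
    finally show ?thesis using abs_Re_le_cmod order_trans by fastforce
  qed
  ultimately have "b \<le> a \<bullet> (p + (c * of_real (\<rho> ^ k / 2)) *s g 0)"
    by (smt (verit) field_sum_of_halves times_divide_eq_left)
  then show False using ab(1) by simp
qed

text \<open>Each non-constant component is factored at 0, and \<open>k\<close> is the least of the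
  orders found. A component of this least order makes \<open>g 0\<close> non-zero.\<close>

lemma holomorphic_curve_factor:
  fixes z :: "complex \<Rightarrow> complex^'d"
  assumes hol: "holomorphic_curve_on z (ball 0 R0)" and "0 < R0" and nc: "\<not> z constant_on ball 0 R0"
  obtains R k g where "0 < R" "R \<le> R0" "1 \<le> k" "holomorphic_curve_on g (ball 0 R)" "g 0 \<noteq> 0"
    "\<And>t. t \<in> ball 0 R \<Longrightarrow> z t = z 0 + t ^ k *s g t"
proof -
  \<comment> \<open>Constant components have no finite order and are set aside; they contribute 0 to
    \<open>g\<close>.\<close>
  define I where "I = {i. \<not> (\<lambda>t. z t $ i) constant_on ball 0 R0}"
  have zero: "0 \<in> ball (0::complex) R0" using assms(2) by simp
  have const: "z t $ i = z 0 $ i" if "i \<notin> I" "t \<in> ball 0 R0" for i t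
  proof -
    have "(\<lambda>t. z t $ i) constant_on ball 0 R0" using that(1) by (simp add: I_def)
    then show ?thesis using that(2) zero unfolding constant_on_def by metis
  qed
  have "I \<noteq> {}"
  proof
    assume "I = {}"
    then have "z t = z 0" if "t \<in> ball 0 R0" for t using const that by (simp add: vec_eq_iff)
    then have "z constant_on ball 0 R0" unfolding constant_on_def by blast
    then show False using nc by blast
  qed
  define P where "P i g r n \<longleftrightarrow> 0 < n \<and> 0 < r \<and> ball 0 r \<subseteq> ball (0::complex) R0 \<and> g holomorphic_on ball 0 r \<and>
      (\<forall>w\<in>ball 0 r. z w $ i - z 0 $ i = w ^ n * g w) \<and> (\<forall>w\<in>ball 0 r. g w \<noteq> 0)" for i g r n
  have "\<exists>g r n. P i g r n" if "i \<in> I" for i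
  proof -
    have 1: "(\<lambda>t. z t $ i - z 0 $ i) holomorphic_on ball 0 R0"
      using hol unfolding holomorphic_curve_on_def by (auto intro!: holomorphic_intros)
    have 2: "\<not> (\<lambda>t. z t $ i - z 0 $ i) constant_on ball 0 R0"
    proof
      assume "(\<lambda>t. z t $ i - z 0 $ i) constant_on ball 0 R0"
      then obtain y where "\<And>t. t \<in> ball 0 R0 \<Longrightarrow> z t $ i - z 0 $ i = y" unfolding constant_on_def by blast
      then have "\<And>t. t \<in> ball 0 R0 \<Longrightarrow> z t $ i = y + z 0 $ i" by (metis diff_add_cancel)
      then show False using that unfolding I_def constant_on_def by blast
    qed
    show ?thesis
    proof (rule holomorphic_factor_zero_nonconstant[OF 1 open_ball connected_ball zero _ 2])
      fix g :: "complex \<Rightarrow> complex" and r :: real and n :: nat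
      assume *: "0 < n" "0 < r" "ball 0 r \<subseteq> ball (0::complex) R0" "g holomorphic_on ball 0 r"
        "\<And>w. w \<in> ball 0 r \<Longrightarrow> z w $ i - z 0 $ i = (w - 0) ^ n * g w" "\<And>w. w \<in> ball 0 r \<Longrightarrow> g w \<noteq> 0"
      have "P i g r n" unfolding P_def
        by (intro conjI ballI) (use * in auto)
      then show ?thesis by blast
    qed simp
  qed
  then obtain g r n where "\<forall>i\<in>I. P i (g i) (r i) (n i)" by metis
  then have g: "\<forall>i\<in>I. 0 < n i \<and> 0 < r i \<and> ball 0 (r i) \<subseteq> ball (0::complex) R0 \<and> g i holomorphic_on ball 0 (r i) \<and>
      (\<forall>w\<in>ball 0 (r i). z w $ i - z 0 $ i = w ^ n i * g i w) \<and> (\<forall>w\<in>ball 0 (r i). g i w \<noteq> 0)"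
    by (simp add: P_def)
  define R where "R = min R0 (Min (r ` I))"
  define k where "k = Min (n ` I)"
  define G :: "complex \<Rightarrow> complex^'d" where "G t = (\<chi> i. if i \<in> I then t ^ (n i - k) * g i t else 0)" for t
  have fin: "finite I" by simp
  have Rr: "R \<le> r i" if "i \<in> I" for i unfolding R_def using that fin by (simp add: min.coboundedI2)
  have kn: "k \<le> n i" if "i \<in> I" for i unfolding k_def using that fin by simp
  have "k \<in> n ` I" unfolding k_def using fin \<open>I \<noteq> {}\<close> by (intro Min_in) auto
  then obtain j where j: "j \<in> I" "n j = k" by blast
  show ?thesis
  proof (rule that[of R k G])
    show R: "0 < R" unfolding R_def using fin \<open>I \<noteq> {}\<close> g assms(2) by auto
    show "R \<le> R0" by (simp add: R_def)
    show "1 \<le> k" using j g by fastforce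
    have "(\<lambda>t. G t $ i) holomorphic_on ball 0 R" for i
    proof (cases "i \<in> I")
      case True
      then have "g i holomorphic_on ball 0 R"
        using g Rr[OF True] by (meson holomorphic_on_subset subset_ball)
      then show ?thesis using True by (auto simp: G_def intro!: holomorphic_intros)
    qed (simp add: G_def)
    then show "holomorphic_curve_on G (ball 0 R)" unfolding holomorphic_curve_on_def by blast
    have "g j 0 \<noteq> 0" using g j(1) by fastforce
    then have "G 0 $ j \<noteq> 0" using j by (simp add: G_def)
    then show "G 0 \<noteq> 0" by (metis zero_index)
    fix t :: complex assume t: "t \<in> ball 0 R"
    have "z t $ i = z 0 $ i + t ^ k * G t $ i" for i
    proof (cases "i \<in> I")
      case True
      then have "z t $ i - z 0 $ i = t ^ n i * g i t" using g t Rr[OF True] by auto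
      also have "t ^ n i = t ^ k * t ^ (n i - k)" using kn[OF True] by (simp add: power_add[symmetric])
      finally show ?thesis using True by (simp add: G_def algebra_simps)
    next
      case False
      then show ?thesis using const[OF False, of t] t by (simp add: G_def R_def)
    qed
    then show "z t = z 0 + t ^ k *s G t" by (simp add: vec_eq_iff)
  qed
qed

section \<open>Slow variation\<close>

text \<open>Growth at 0 of order at most \<open>x\<close> to the power \<open>-1/m\<close> for every
  \<open>m\<close>, written without roots.\<close>

definition subpolynomial_at_0 :: "(real \<Rightarrow> real) \<Rightarrow> bool" where
  "subpolynomial_at_0 \<phi> \<longleftrightarrow>
     (\<forall>m::nat. 1 \<le> m \<longrightarrow> (\<exists>C e. 0 < e \<and> (\<forall>x. 0 < x \<and> x < e \<longrightarrow> \<bar>\<phi> x\<bar> ^ m * x \<le> C)))"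

lemma abs_add_power_le: "\<bar>a + b :: real\<bar> ^ m \<le> 2 ^ m * (\<bar>a\<bar> ^ m + \<bar>b\<bar> ^ m)"
proof -
  have "\<bar>a + b\<bar> ^ m \<le> (2 * max \<bar>a\<bar> \<bar>b\<bar>) ^ m" by (intro power_mono) auto
  also have "\<dots> = 2 ^ m * (max \<bar>a\<bar> \<bar>b\<bar>) ^ m" by (simp add: power_mult_distrib)
  also have "\<dots> \<le> 2 ^ m * (\<bar>a\<bar> ^ m + \<bar>b\<bar> ^ m)" by (intro mult_left_mono) (auto simp: max_def)
  finally show ?thesis .
qed

lemma subpolynomial_at_0_add:
  assumes "subpolynomial_at_0 f" "subpolynomial_at_0 g"
  shows "subpolynomial_at_0 (\<lambda>x. f x + g x)"
  unfolding subpolynomial_at_0_def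
proof (intro allI impI)
  fix m :: nat assume m: "1 \<le> m"
  obtain C e where 1: "0 < e" "\<And>x. 0 < x \<and> x < e \<Longrightarrow> \<bar>f x\<bar> ^ m * x \<le> C"
    using assms(1) m unfolding subpolynomial_at_0_def by metis
  obtain D d where 2: "0 < d" "\<And>x. 0 < x \<and> x < d \<Longrightarrow> \<bar>g x\<bar> ^ m * x \<le> D"
    using assms(2) m unfolding subpolynomial_at_0_def by metis
  have "\<bar>f x + g x\<bar> ^ m * x \<le> 2 ^ m * (C + D)" if x: "0 < x \<and> x < min e d" for x
  proof -
    have "\<bar>f x + g x\<bar> ^ m * x \<le> 2 ^ m * (\<bar>f x\<bar> ^ m + \<bar>g x\<bar> ^ m) * x"
      using x by (intro mult_right_mono abs_add_power_le) auto
    also have "\<dots> = 2 ^ m * (\<bar>f x\<bar> ^ m * x + \<bar>g x\<bar> ^ m * x)" by (simp add: algebra_simps)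
    also have "\<dots> \<le> 2 ^ m * (C + D)" using 1(2)[of x] 2(2)[of x] x by (intro mult_left_mono) auto
    finally show ?thesis .
  qed
  then show "\<exists>C e. 0 < e \<and> (\<forall>x. 0 < x \<and> x < e \<longrightarrow> \<bar>f x + g x\<bar> ^ m * x \<le> C)"
    using 1(1) 2(1) by (intro exI[of _ "2 ^ m * (C + D)"] exI[of _ "min e d"]) auto
qed

lemma subpolynomial_at_0_sum:
  assumes "\<And>j. j \<in> J \<Longrightarrow> subpolynomial_at_0 (f j)"
  shows "subpolynomial_at_0 (\<lambda>x. \<Sum>j\<in>J. f j x)"
  using assms
proof (induction J rule: infinite_finite_induct)
  case (insert x F)
  then show ?case by (simp add: subpolynomial_at_0_add)
qed (auto simp: subpolynomial_at_0_def power_0_left intro!: exI[of _ 1])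

text \<open>If the conclusion failed at all small scales, \<open>\<phi>\<close> would gain the
  factor \<open>1 + \<eta>\<close> with each division of \<open>x\<close> by \<open>K ^ 2\<close>,
  which is growth at least like a negative power of \<open>x\<close>.\<close>

lemma slow_variation:
  fixes \<phi> :: "real \<Rightarrow> real"
  assumes pos: "\<And>x. 0 < x \<Longrightarrow> x \<le> 1/2 \<Longrightarrow> 0 < \<phi> x" and sub: "subpolynomial_at_0 \<phi>"
    and "1 < K" "0 < \<eta>" "0 < e"
  obtains x where "0 < x" "x < e" "K * x \<le> 1/2" "\<phi> (x / K) \<le> (1 + \<eta>) * \<phi> (K * x)"
proof (rule ccontr)
  note found = that
  assume "\<not> thesis"
  then have no: "(1 + \<eta>) * \<phi> (K * x) < \<phi> (x / K)" if "0 < x" "x < e" "K * x \<le> 1/2" for x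
    using found[OF that] by (meson not_le)
  define y0 where "y0 = min (e / 2) (1 / (4 * K))"
  have y0: "0 < y0" "y0 < e" "K * y0 \<le> 1/2" using assms(3,5) by (auto simp: y0_def min_def field_simps)
  \<comment> \<open>Successive scales differ by \<open>K ^ 2\<close>, the ratio between the points
    \<open>K * x\<close> and \<open>x / K\<close> that are compared.\<close>
  define y where "y j = y0 / (K ^ 2) ^ j" for j :: nat
  have K2: "1 < K ^ 2" using assms(3) by (simp add: one_less_power)
  have y: "0 < y j" "y j \<le> y0" for j
  proof -
    have "1 \<le> (K ^ 2) ^ j" by (rule one_le_power) (rule less_imp_le[OF K2])
    then show "0 < y j" "y j \<le> y0" using y0(1) by (auto simp: y_def divide_le_eq intro!: divide_pos_pos)
  qed
  have y1: "y j \<le> 1/2" for j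
  proof -
    have "y j \<le> K * y0" using y[of j] y0(1) assms(3) by (smt (verit) mult_le_cancel_right1)
    then show ?thesis using y0(3) by simp
  qed
  have grow: "(1 + \<eta>) ^ j * \<phi> (y 0) \<le> \<phi> (y j)" for j
  proof (induction j)
    case (Suc j)
    have "(1 + \<eta>) * \<phi> (K * (y j / K)) < \<phi> (y j / K / K)"
    proof (rule no)
      show "0 < y j / K" using y(1) assms(3) by simp
      have "y j / K \<le> y j" using y(1)[of j] assms(3) by (simp add: divide_le_eq)
      then show "y j / K < e" using y(2)[of j] y0(2) by linarith
      show "K * (y j / K) \<le> 1/2" using y1[of j] assms(3) by simp
    qed
    moreover have "y j / K / K = y (Suc j)" by (simp add: y_def power2_eq_square field_simps)
    ultimately have "(1 + \<eta>) * \<phi> (y j) < \<phi> (y (Suc j))" using assms(3) by simp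
    moreover have "(1 + \<eta>) * ((1 + \<eta>) ^ j * \<phi> (y 0)) \<le> (1 + \<eta>) * \<phi> (y j)"
      using Suc assms(4) by (intro mult_left_mono) auto
    ultimately show ?case by (simp add: mult.assoc)
  qed simp
  \<comment> \<open>With this exponent the gain in the power of \<open>\<phi>\<close> outweighs the
    loss \<open>K ^ 2\<close> in \<open>y j\<close> by a factor 2, so the bounded product would
    double at every step. Passing to \<open>Suc m0\<close> keeps the exponent at least 1.\<close>
  obtain m0 :: nat where "2 * K ^ 2 < (1 + \<eta>) ^ m0"
    using real_arch_pow[of "1 + \<eta>" "2 * K ^ 2"] assms(4) by auto
  also have "\<dots> \<le> (1 + \<eta>) ^ Suc m0" using assms(4) by (intro power_increasing) auto
  finally have m: "2 * K ^ 2 \<le> (1 + \<eta>) ^ Suc m0" by simp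
  let ?m = "Suc m0"
  obtain C d where C: "0 < d" "\<And>x. 0 < x \<and> x < d \<Longrightarrow> \<bar>\<phi> x\<bar> ^ ?m * x \<le> C"
    using sub unfolding subpolynomial_at_0_def by (metis le_add1 plus_1_eq_Suc)
  have p0: "0 < \<phi> (y 0)" by (rule pos[OF y(1) y1])
  have big: "2 ^ j * (\<phi> (y 0) ^ ?m * y0) \<le> C" if "y j < d" for j
  proof -
    have "2 ^ j * (\<phi> (y 0) ^ ?m * y0) = (2 * K ^ 2) ^ j * \<phi> (y 0) ^ ?m * y j"
      using assms(3) by (simp add: y_def power_mult_distrib)
    also have "\<dots> \<le> ((1 + \<eta>) ^ ?m) ^ j * \<phi> (y 0) ^ ?m * y j"
      using m p0 y(1)[of j] K2 by (intro mult_right_mono power_mono) auto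
    also have "\<dots> = ((1 + \<eta>) ^ j * \<phi> (y 0)) ^ ?m * y j"
      by (simp only: power_mult_distrib power_mult[symmetric] mult.commute)
    also have "\<dots> \<le> \<bar>\<phi> (y j)\<bar> ^ ?m * y j"
    proof (intro mult_right_mono power_mono)
      show "(1 + \<eta>) ^ j * \<phi> (y 0) \<le> \<bar>\<phi> (y j)\<bar>" using grow[of j] by linarith
      show "0 \<le> (1 + \<eta>) ^ j * \<phi> (y 0)" using p0 assms(4) by simp
    qed (use y(1)[of j] in simp)
    also have "\<dots> \<le> C" using C(2)[of "y j"] y(1) that by blast
    finally show ?thesis .
  qed
  have "inverse (K\<^sup>2) < 1" using K2 assms(3) by (simp add: inverse_less_1_iff)
  then have "(\<lambda>j. y0 * inverse (K\<^sup>2) ^ j) \<longlonglongrightarrow> y0 * 0"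
    by (intro tendsto_intros LIMSEQ_power_zero) simp
  then have "y \<longlonglongrightarrow> 0" by (simp add: y_def[abs_def] divide_inverse power_inverse)
  then have ev: "\<forall>\<^sub>F j in sequentially. y j < d" using C(1) by (simp add: order_tendstoD(2))
  have q: "0 < \<phi> (y 0) ^ ?m * y0" using p0 y0(1) by simp
  have "\<forall>\<^sub>F j in sequentially. C / (\<phi> (y 0) ^ ?m * y0) < 2 ^ j"
    by real_asymp
  with ev have "\<forall>\<^sub>F j in sequentially. False"
  proof eventually_elim
    case (elim j)
    then have "C < 2 ^ j * (\<phi> (y 0) ^ ?m * y0)" using q by (simp add: pos_divide_less_eq)
    then show False using big[OF elim(1)] by linarith
  qed
  then show False by simp
qed

section \<open>Directions of infinite contact\<close>

text \<open>Over height \<open>e\<close> the domain contains a disc in direction \<open>a\<close>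
  whose radius is comparable to the \<open>m\<close>-th root of \<open>e\<close>. Contact is
  measured through \<open>\<Omega>\<close> alone, so the notion makes sense for non-smooth
  boundaries too.\<close>

definition contact_order_ge :: "(complex^'d) set \<Rightarrow> complex^'d \<Rightarrow> complex^'d \<Rightarrow> nat \<Rightarrow> complex^'d \<Rightarrow> bool" where
  "contact_order_ge \<Omega> p \<nu> m a \<longleftrightarrow>
     (\<exists>c>0. \<exists>e0>0. \<forall>e. 0 < e \<and> e < e0 \<longrightarrow> (\<forall>\<zeta>. cmod \<zeta> ^ m \<le> c * e \<longrightarrow> p + e *\<^sub>R \<nu> + \<zeta> *s a \<in> \<Omega>))"

text \<open>Both hypotheses of the theorem reduce to these data, after which only convex geometry
  remains. The point \<open>p + \<nu>\<close> serves as a centre of homotheties, and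
  \<open>p\<close> becomes the apex of the limiting cone.\<close>

locale infinite_contact =
  fixes \<Omega> :: "(complex^'d) set" and p \<nu> a :: "complex^'d"
  assumes dom: "\<Omega> \<in> convex_domains"
    and p: "p \<in> closure \<Omega>" "p \<notin> \<Omega>" and \<nu>: "p + \<nu> \<in> \<Omega>"
    and a: "a \<noteq> 0" and contact: "\<And>m. 1 \<le> m \<Longrightarrow> contact_order_ge \<Omega> p \<nu> m a"
begin

section \<open>Slices in the direction of infinite contact\<close>

lemma open_dom: "open \<Omega>" and convex_dom: "convex \<Omega>"
  using dom by (auto simp: convex_domains_def)

lemma cone_in:
  assumes "p + \<nu> + w \<in> \<Omega>" "0 < e" "e \<le> 1"
  shows "p + e *\<^sub>R (\<nu> + w) \<in> \<Omega>"
proof -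
  have "p - e *\<^sub>R (p - (p + \<nu> + w)) \<in> interior \<Omega>"
    using assms p(1) open_dom convex_dom
    by (intro mem_interior_closure_convex_shrink) (auto simp: interior_open)
  then show ?thesis using open_dom by (simp add: interior_open algebra_simps)
qed

definition G :: "real \<Rightarrow> complex^'d \<Rightarrow> real" where "G e = minkowski_functional \<Omega> (p + e *\<^sub>R \<nu>)"

lemma base_in: "0 < e \<Longrightarrow> e \<le> 1 \<Longrightarrow> p + e *\<^sub>R \<nu> \<in> \<Omega>"
  using cone_in[of 0 e] \<nu> by simp

lemma G_sublinear: "0 < e \<Longrightarrow> e \<le> 1 \<Longrightarrow> sublinear (G e)"
  unfolding G_def by (rule sublinear_minkowski_functional[OF open_dom convex_dom base_in])

lemma G_less_iff: "0 < e \<Longrightarrow> e \<le> 1 \<Longrightarrow> 0 < s \<Longrightarrow> G e v < s \<longleftrightarrow> p + e *\<^sub>R \<nu> + inverse s *\<^sub>R v \<in> \<Omega>"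
  unfolding G_def by (rule minkowski_functional_less_iff[OF open_dom convex_dom base_in])

lemma G_leI:
  "0 < e \<Longrightarrow> e \<le> 1 \<Longrightarrow> 0 \<le> s \<Longrightarrow> (\<And>t. s < t \<Longrightarrow> p + e *\<^sub>R \<nu> + inverse t *\<^sub>R v \<in> \<Omega>) \<Longrightarrow> G e v \<le> s"
  unfolding G_def by (rule minkowski_functional_leI[OF open_dom convex_dom base_in])

text \<open>The homothety with centre \<open>p + \<nu>\<close> and ratio
  \<open>(1 - e) / (1 - e')\<close> maps \<open>\<Omega>\<close> into itself and takes the base
  point at height \<open>e'\<close> to the one at height \<open>e\<close>.\<close>

lemma G_antimono:
  assumes "0 < e'" "e' \<le> e" "e < 1"
  shows "(1 - e) * G e v \<le> (1 - e') * G e' v"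
proof -
  define l where "l = (1 - e) / (1 - e')"
  have l: "0 < l" "l \<le> 1" "l * (1 - e') = 1 - e" using assms by (auto simp: l_def)
  have "G e v \<le> G e' v / l"
  proof (rule G_leI)
    show "0 \<le> G e' v / l" using sublinear_nonneg[OF G_sublinear] assms l(1) by simp
    fix t assume t: "G e' v / l < t"
    then have lt: "G e' v < l * t" using l(1) by (simp add: field_simps)
    moreover have "0 \<le> G e' v" using sublinear_nonneg[OF G_sublinear] assms by simp
    ultimately have "0 < l * t" by linarith
    then have "0 < t" using l(1) by (simp add: zero_less_mult_iff)
    have "p + e' *\<^sub>R \<nu> + inverse (l * t) *\<^sub>R v \<in> \<Omega>"
      using lt \<open>0 < l * t\<close> G_less_iff[of e' "l * t" v] assms by simp
    then have "l *\<^sub>R (p + e' *\<^sub>R \<nu> + inverse (l * t) *\<^sub>R v) + (1 - l) *\<^sub>R (p + \<nu>) \<in> \<Omega>"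
      using l \<nu> by (intro convexD[OF convex_dom]) auto
    moreover have "l *\<^sub>R (p + e' *\<^sub>R \<nu> + inverse (l * t) *\<^sub>R v) + (1 - l) *\<^sub>R (p + \<nu>)
       = p + (1 - l * (1 - e')) *\<^sub>R \<nu> + inverse t *\<^sub>R v"
      using l(1) by (simp add: algebra_simps)
    ultimately show "p + e *\<^sub>R \<nu> + inverse t *\<^sub>R v \<in> \<Omega>" using l(3) by simp
  qed (use assms in auto)
  then have "l * G e v \<le> G e' v" using l(1) by (simp add: field_simps)
  then have "(1 - e') * (l * G e v) \<le> (1 - e') * G e' v" using assms by (intro mult_left_mono) auto
  then show ?thesis using l(3) by (metis mult.assoc mult.commute)
qed

text \<open>The weight \<open>1 - e\<close> is the one that makes the slice gauge antimonotone in
  \<open>e\<close>; it tends to 1 at the boundary and disappears from limits.\<close>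

definition g :: "real \<Rightarrow> complex \<Rightarrow> real" where "g e \<zeta> = (1 - e) * G e (\<zeta> *s a)"

text \<open>The reciprocal of this number is the scale by which the slice is normalised.\<close>

definition M :: "real \<Rightarrow> real" where "M e = (1 - e) * rotation_sum (G e) a"

lemma M_eq: "M e = g e 1 + g e (-1) + g e \<i> + g e (-\<i>)"
  by (simp add: M_def g_def rotation_sum_def distrib_left)

lemma g_antimono: "0 < e' \<Longrightarrow> e' \<le> e \<Longrightarrow> e < 1 \<Longrightarrow> g e \<zeta> \<le> g e' \<zeta>"
  unfolding g_def by (rule G_antimono)

lemma M_antimono: "0 < e' \<Longrightarrow> e' \<le> e \<Longrightarrow> e < 1 \<Longrightarrow> M e \<le> M e'"
  unfolding M_eq by (intro add_mono g_antimono)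

lemma g_nonneg: "0 < e \<Longrightarrow> e < 1 \<Longrightarrow> 0 \<le> g e \<zeta>"
  unfolding g_def using sublinear_nonneg[OF G_sublinear, of e] by simp

lemma M_pos: "0 < e \<Longrightarrow> e < 1 \<Longrightarrow> 0 < M e"
proof -
  assume e: "0 < e" "e < 1"
  obtain b where "0 < b" "b * norm a \<le> rotation_sum (G e) a"
    using rotation_sum_minkowski_lower[OF dom base_in[of e]] e unfolding G_def by (metis less_imp_le)
  then have "0 < rotation_sum (G e) a" using a by (meson less_le_trans mult_pos_pos zero_less_norm_iff)
  then show ?thesis using e by (simp add: M_def)
qed

lemma g_le: "0 < e \<Longrightarrow> e < 1 \<Longrightarrow> g e \<zeta> \<le> 2 * cmod \<zeta> * M e"
proof -
  assume e: "0 < e" "e < 1"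
  have "G e (\<zeta> *s a) \<le> 2 * cmod \<zeta> * rotation_sum (G e) a"
    using rotation_sum_ge rotation_sum_smult_le G_sublinear e order_trans by (metis less_imp_le)
  then have "(1 - e) * G e (\<zeta> *s a) \<le> (1 - e) * (2 * cmod \<zeta> * rotation_sum (G e) a)"
    using e by (intro mult_left_mono) auto
  then show ?thesis by (simp add: g_def M_def mult_ac)
qed

lemma g_sublinear: "0 < e \<Longrightarrow> e < 1 \<Longrightarrow> sublinear (g e)"
  unfolding sublinear_def
proof (intro conjI allI impI)
  assume e: "0 < e" "e < 1"
  note G = G_sublinear[of e]
  fix x y :: complex and c :: real
  show "0 \<le> g e x" using g_nonneg e .
  have "G e (x *s a + y *s a) \<le> G e (x *s a) + G e (y *s a)" using sublinear_add G e by simp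
  then show "g e (x + y) \<le> g e x + g e y"
    using e unfolding g_def by (simp add: vector_sadd_rdistrib mult_left_mono flip: distrib_left)
  assume "0 \<le> c"
  moreover have "(c *\<^sub>R x) *s a = c *\<^sub>R (x *s a)"
    by (simp add: complex_scaleR_eq[symmetric] vector_smult_assoc scaleR_conv_of_real)
  ultimately show "g e (c *\<^sub>R x) = c * g e x" unfolding g_def using sublinear_scaleR[OF G] e by simp
qed

lemma g_lipschitz: "0 < e \<Longrightarrow> e < 1 \<Longrightarrow> \<bar>g e x - g e y\<bar> \<le> 2 * M e * cmod (x - y)"
  using sublinear_abs_diff_le[OF g_sublinear, of e "2 * M e" x y] g_le[of e] by (simp add: mult_ac)

text \<open>If \<open>?G ^ m * x\<close> exceeded \<open>cmod \<zeta> ^ m / c\<close>, then \<zeta>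
  divided by its gauge would lie in the disc supplied by contact of order \<open>m\<close>, hence in
  \<open>\<Omega>\<close>; but a vector of gauge exactly 1 does not lead into the open set.\<close>

lemma g_subpolynomial: "subpolynomial_at_0 (\<lambda>e. g e \<zeta>)"
  unfolding subpolynomial_at_0_def
proof (intro allI impI)
  fix m :: nat assume m: "1 \<le> m"
  obtain c e0 where c: "0 < c" "0 < e0"
    "\<And>e \<zeta>. 0 < e \<Longrightarrow> e < e0 \<Longrightarrow> cmod \<zeta> ^ m \<le> c * e \<Longrightarrow> p + e *\<^sub>R \<nu> + \<zeta> *s a \<in> \<Omega>"
    using contact[OF m] unfolding contact_order_ge_def by blast
  have "\<bar>g x \<zeta>\<bar> ^ m * x \<le> cmod \<zeta> ^ m / c" if x: "0 < x \<and> x < min e0 1" for x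
  proof -
    let ?G = "G x (\<zeta> *s a)"
    have nn: "0 \<le> ?G" using sublinear_nonneg[OF G_sublinear] x by simp
    have "?G ^ m * x \<le> cmod \<zeta> ^ m / c"
    proof (rule ccontr)
      assume "\<not> ?thesis"
      then have *: "cmod \<zeta> ^ m < ?G ^ m * x * c" using c(1) by (simp add: field_simps)
      have "?G \<noteq> 0"
      proof
        assume "?G = 0"
        then have "?G ^ m = 0" using m by (simp add: power_0_left)
        then have "?G ^ m * x * c = 0" by (simp only: mult_zero_left)
        then show False using * zero_le_power[OF norm_ge_zero, of \<zeta> m] by linarith
      qed
      then have Gpos: "0 < ?G" using nn by simp
      have "cmod (of_real (inverse ?G) * \<zeta>) ^ m = cmod \<zeta> ^ m / ?G ^ m"
        using Gpos by (simp add: norm_mult power_mult_distrib divide_inverse power_inverse norm_inverse)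
      also have "\<dots> \<le> c * x" using * Gpos by (simp add: field_simps)
      finally have le: "cmod (of_real (inverse ?G) * \<zeta>) ^ m \<le> c * x" .
      have "p + x *\<^sub>R \<nu> + (of_real (inverse ?G) * \<zeta>) *s a \<in> \<Omega>"
        by (rule c(3)[OF _ _ le]) (use x in auto)
      moreover have "(of_real (inverse ?G) * \<zeta>) *s a = inverse ?G *\<^sub>R (\<zeta> *s a)"
        by (simp only: complex_scaleR_eq[symmetric] vector_smult_assoc)
      ultimately show False using G_less_iff[of x ?G "\<zeta> *s a"] Gpos x by simp
    qed
    moreover have "\<bar>g x \<zeta>\<bar> \<le> ?G" using x nn by (simp add: g_def abs_mult mult_left_le_one_le)
    then have "\<bar>g x \<zeta>\<bar> ^ m * x \<le> ?G ^ m * x" using x by (intro mult_right_mono power_mono) auto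
    ultimately show ?thesis by linarith
  qed
  then show "\<exists>C e. 0 < e \<and> (\<forall>x. 0 < x \<and> x < e \<longrightarrow> \<bar>g x \<zeta>\<bar> ^ m * x \<le> C)"
    using c(2) by (intro exI[of _ "cmod \<zeta> ^ m / c"] exI[of _ "min e0 1"]) auto
qed

text \<open>Slow variation is applied to the sum of \<open>M\<close> and finitely many
  \<open>g\<close>. All summands are antimonotone, so a small variation of the sum over the window
  bounds that of each summand.\<close>

lemma exists_slow_scale:
  assumes "finite J" "1 < K" "0 < \<delta>" "0 < e"
  obtains x where "0 < x" "x < e" "K * x \<le> 1/2" "M (x / K) \<le> (1 + \<delta>) * M x"
    "\<And>\<zeta>. \<zeta> \<in> J \<Longrightarrow> g (x / K) \<zeta> - g (K * x) \<zeta> \<le> \<delta> * M x"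
proof -
  define \<phi> where "\<phi> e = M e + (\<Sum>\<zeta>\<in>J. g e \<zeta>)" for e
  \<comment> \<open>\<open>c\<close> bounds the sum by a multiple of \<open>M\<close>, so that the
    relative error \<open>\<delta> / c\<close> of the sum becomes the error \<open>\<delta>\<close>
    relative to \<open>M\<close>.\<close>
  define c where "c = 1 + (\<Sum>\<zeta>\<in>J. 2 * cmod \<zeta>)"
  have c: "1 \<le> c" by (simp add: c_def sum_nonneg)
  have pos: "0 < \<phi> x" if "0 < x" "x \<le> 1/2" for x
    using M_pos[of x] sum_nonneg[of J "g x"] g_nonneg[of x] that by (simp add: \<phi>_def add_pos_nonneg)
  have sub: "subpolynomial_at_0 \<phi>"
    unfolding \<phi>_def M_eq by (intro subpolynomial_at_0_add subpolynomial_at_0_sum g_subpolynomial)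
  obtain x where x: "0 < x" "x < e" "K * x \<le> 1/2" "\<phi> (x / K) \<le> (1 + \<delta> / c) * \<phi> (K * x)"
    using slow_variation[OF pos sub assms(2) _ assms(4), of "\<delta> / c"] c assms(3) by auto
  have le: "x / K \<le> x" "x \<le> K * x" "0 < x / K" "x / K \<le> K * x"
  proof -
    show 1: "x \<le> K * x" using x(1) assms(2) by simp
    show 2: "x / K \<le> x" using x(1) assms(2) by (simp add: divide_le_eq)
    show "0 < x / K" using x(1) assms(2) by simp
    show "x / K \<le> K * x" using 1 2 by linarith
  qed
  have Kx: "0 < K * x" "K * x < 1" using x le by linarith+
  have "\<phi> (K * x) \<le> c * M (K * x)"
  proof -
    have "(\<Sum>\<zeta>\<in>J. g (K * x) \<zeta>) \<le> (\<Sum>\<zeta>\<in>J. 2 * cmod \<zeta> * M (K * x))"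
      by (intro sum_mono g_le Kx)
    then show ?thesis by (simp add: \<phi>_def c_def distrib_right sum_distrib_right)
  qed
  then have "\<delta> / c * \<phi> (K * x) \<le> \<delta> / c * (c * M (K * x))"
    using assms(3) c by (intro mult_left_mono) auto
  also have "\<dots> = \<delta> * M (K * x)" using c by simp
  also have "\<dots> \<le> \<delta> * M x" using assms(3) M_antimono[of x "K * x"] x(1) le Kx by simp
  finally have d: "\<phi> (x / K) - \<phi> (K * x) \<le> \<delta> * M x" using x(4) by (simp add: algebra_simps)
  have gd: "0 \<le> g (x / K) \<zeta> - g (K * x) \<zeta>" for \<zeta> using g_antimono[of "x / K" "K * x" \<zeta>] le Kx by simp
  have Md: "0 \<le> M (x / K) - M (K * x)" using M_antimono[of "x / K" "K * x"] le Kx by simp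
  have \<phi>d: "\<phi> (x / K) - \<phi> (K * x) = (M (x / K) - M (K * x)) + (\<Sum>\<zeta>\<in>J. g (x / K) \<zeta> - g (K * x) \<zeta>)"
    by (simp add: \<phi>_def sum_subtractf)
  show ?thesis
  proof (rule that[OF x(1-3)])
    have "0 \<le> (\<Sum>\<zeta>\<in>J. g (x / K) \<zeta> - g (K * x) \<zeta>)" by (intro sum_nonneg gd)
    then have "M (x / K) \<le> M (K * x) + \<delta> * M x" using d \<phi>d by linarith
    also have "\<dots> \<le> M x + \<delta> * M x" using M_antimono[of x "K * x"] x(1) le Kx by simp
    finally show "M (x / K) \<le> (1 + \<delta>) * M x" by (simp add: algebra_simps)
    fix \<zeta> assume "\<zeta> \<in> J"
    then have "g (x / K) \<zeta> - g (K * x) \<zeta> \<le> (\<Sum>\<zeta>\<in>J. g (x / K) \<zeta> - g (K * x) \<zeta>)"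
      using gd assms(1) by (intro member_le_sum) auto
    then show "g (x / K) \<zeta> - g (K * x) \<zeta> \<le> \<delta> * M x" using d \<phi>d Md by linarith
  qed
qed

text \<open>A diagonal choice: stage \<open>n\<close> controls the first \<open>n\<close> points of
  a dense sequence over a window of ratio growing with \<open>n\<close>. Every fixed
  \<open>s\<close> eventually falls into the window, and Lipschitz bounds pass from the dense
  sequence to all \<zeta>.\<close>

lemma exists_slow_sequence:
  obtains \<epsilon> where "\<And>n. 0 < \<epsilon> n" "\<And>n. \<epsilon> n \<le> 1/2" "\<epsilon> \<longlonglongrightarrow> 0"
    "\<And>s \<zeta>. 0 < s \<Longrightarrow> (\<lambda>n. (g (s * \<epsilon> n) \<zeta> - g (\<epsilon> n) \<zeta>) / M (\<epsilon> n)) \<longlonglongrightarrow> 0"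
proof -
  obtain D :: "complex set" where D: "countable D" "\<And>X. open X \<Longrightarrow> X \<noteq> {} \<Longrightarrow> \<exists>d\<in>D. d \<in> X"
    using countable_dense_setE by blast
  have "D \<noteq> {}" using D(2)[of UNIV] by auto
  then obtain u :: "nat \<Rightarrow> complex" where u: "D = range u"
    using D(1) by (metis range_from_nat_into)
  define K where "K n = real n + 2" for n
  have "\<forall>n. \<exists>x. 0 < x \<and> x < 1 / K n \<and> K n * x \<le> 1/2 \<and> M (x / K n) \<le> 2 * M x \<and>
     (\<forall>j<n. g (x / K n) (u j) - g (K n * x) (u j) \<le> 1 / K n * M x)"
  proof
    fix n
    have K: "1 < K n" "0 < 1 / K n" "1 / K n \<le> 1" by (auto simp: K_def)
    obtain x where x: "0 < x" "x < 1 / K n" "K n * x \<le> 1/2" "M (x / K n) \<le> (1 + 1 / K n) * M x"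
      "\<And>\<zeta>. \<zeta> \<in> u ` {..<n} \<Longrightarrow> g (x / K n) \<zeta> - g (K n * x) \<zeta> \<le> 1 / K n * M x"
      using exists_slow_scale[of "u ` {..<n}" "K n" "1 / K n" "1 / K n"] K by auto
    have "x < 1" using x(2) K(3) by linarith
    then have "(1 + 1 / K n) * M x \<le> 2 * M x" using M_pos[of x] x(1) K by (intro mult_right_mono) auto
    then show "\<exists>x. 0 < x \<and> x < 1 / K n \<and> K n * x \<le> 1/2 \<and> M (x / K n) \<le> 2 * M x \<and>
     (\<forall>j<n. g (x / K n) (u j) - g (K n * x) (u j) \<le> 1 / K n * M x)"
      using x by (intro exI[of _ x]) force
  qed
  then obtain \<epsilon> where \<epsilon>: "\<And>n. 0 < \<epsilon> n" "\<And>n. \<epsilon> n < 1 / K n" "\<And>n. K n * \<epsilon> n \<le> 1/2"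
    "\<And>n. M (\<epsilon> n / K n) \<le> 2 * M (\<epsilon> n)"
    "\<And>n j. j < n \<Longrightarrow> g (\<epsilon> n / K n) (u j) - g (K n * \<epsilon> n) (u j) \<le> 1 / K n * M (\<epsilon> n)"
    by (auto dest!: choice)
  have Klim: "(\<lambda>n. 1 / K n) \<longlonglongrightarrow> 0" unfolding K_def by real_asymp
  have half: "\<epsilon> n \<le> 1/2" for n
  proof -
    have "1 * \<epsilon> n \<le> K n * \<epsilon> n" using \<epsilon>(1)[of n] by (intro mult_right_mono) (auto simp: K_def)
    then show ?thesis using \<epsilon>(3)[of n] by linarith
  qed
  show ?thesis
  proof (rule that[OF \<epsilon>(1) half])
    show "\<epsilon> \<longlonglongrightarrow> 0"
      by (rule tendsto_sandwich[OF _ _ tendsto_const Klim]) (auto intro!: always_eventually less_imp_le \<epsilon>(1,2))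
    fix s :: real and \<zeta> :: complex assume s: "0 < s"
    show "(\<lambda>n. (g (s * \<epsilon> n) \<zeta> - g (\<epsilon> n) \<zeta>) / M (\<epsilon> n)) \<longlonglongrightarrow> 0"
    proof (rule LIMSEQ_I)
      fix r :: real assume r: "0 < r"
      \<comment> \<open>Each of the two approximation errors is at most \<open>r / 6\<close>
        relative to \<open>M\<close>, together \<open>r / 3\<close>; the variation at
        \<open>u j\<close> adds less than \<open>r / 2\<close>.\<close>
      obtain j where j: "cmod (\<zeta> - u j) < r / 24"
        using D(2)[of "ball \<zeta> (r / 24)"] r u by (auto simp: dist_norm)
      have "\<forall>\<^sub>F n in sequentially. 1 / K n < r / 2" using order_tendstoD(2)[OF Klim, of "r/2"] r by simp
      moreover have "\<forall>\<^sub>F n in sequentially. s \<le> K n" unfolding K_def by real_asymp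
      moreover have "\<forall>\<^sub>F n in sequentially. 1 / s \<le> K n" unfolding K_def by real_asymp
      moreover have "\<forall>\<^sub>F n in sequentially. j < n" by (rule eventually_gt_at_top)
      ultimately have "\<forall>\<^sub>F n in sequentially. norm ((g (s * \<epsilon> n) \<zeta> - g (\<epsilon> n) \<zeta>) / M (\<epsilon> n) - 0) < r"
      proof eventually_elim
        case (elim n)
        let ?e = "\<epsilon> n" and ?K = "K n"
        have K2: "2 \<le> ?K" by (simp add: K_def)
        have lo: "0 < ?e / ?K" using \<epsilon>(1) K2 by simp
        have hi: "?K * ?e < 1" using \<epsilon>(3)[of n] by linarith
        have e1: "?e / ?K \<le> ?e" "?e \<le> ?K * ?e"
          using \<epsilon>(1)[of n] K2 by (auto simp: divide_le_eq)
        have s1: "?e / ?K \<le> s * ?e" "s * ?e \<le> ?K * ?e"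
        proof -
          have "1 \<le> s * ?K" using elim(3) s by (simp add: field_simps)
          then have "1 * ?e \<le> (s * ?K) * ?e" using \<epsilon>(1)[of n] by (intro mult_right_mono) auto
          then show "?e / ?K \<le> s * ?e" using K2 by (simp add: field_simps)
          show "s * ?e \<le> ?K * ?e" using elim(2) \<epsilon>(1)[of n] by (intro mult_right_mono) auto
        qed
        have Me: "0 < M ?e" using M_pos[of ?e] \<epsilon>(1)[of n] half[of n] by simp
        have "g x (u j) \<le> g (?e / ?K) (u j) \<and> g (?K * ?e) (u j) \<le> g x (u j)"
          if "?e / ?K \<le> x" "x \<le> ?K * ?e" for x
          using that lo hi by (auto intro!: g_antimono)
        from this[OF e1] this[OF s1] have 1: "\<bar>g (s * ?e) (u j) - g ?e (u j)\<bar> \<le> 1 / ?K * M ?e"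
          using \<epsilon>(5)[OF elim(4)] by linarith
        have lip: "\<bar>g x \<zeta> - g x (u j)\<bar> \<le> 2 * (2 * M ?e) * (r / 24)" if x: "?e / ?K \<le> x" "x \<le> ?K * ?e" for x
        proof -
          have x01: "0 < x" "x < 1" using x lo hi by linarith+
          \<comment> \<open>As \<open>M\<close> at most doubles towards the lower end of the window,
            all Lipschitz constants in the window are comparable to the one at
            \<open>\<epsilon> n\<close>.\<close>
          have Mx: "M x \<le> 2 * M ?e" using M_antimono[OF lo x(1) x01(2)] \<epsilon>(4)[of n] by linarith
          have "\<bar>g x \<zeta> - g x (u j)\<bar> \<le> 2 * M x * cmod (\<zeta> - u j)" by (rule g_lipschitz[OF x01])
          also have "\<dots> \<le> 2 * (2 * M ?e) * (r / 24)"
            using Mx j M_pos[OF x01] Me by (intro mult_mono) auto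
          finally show ?thesis .
        qed
        have "\<bar>g (s * ?e) \<zeta> - g ?e \<zeta>\<bar> \<le> 1 / ?K * M ?e + 2 * (2 * (2 * M ?e) * (r / 24))"
          using lip[OF e1] lip[OF s1] 1 by linarith
        also have "\<dots> = (1 / ?K + r / 3) * M ?e" by (simp add: algebra_simps)
        also have "\<dots> < r * M ?e" using Me elim(1) r by (intro mult_strict_right_mono) auto
        finally have "\<bar>g (s * ?e) \<zeta> - g ?e \<zeta>\<bar> / M ?e < r" using Me by (simp add: pos_divide_less_eq)
        then show ?case using Me by (simp add: abs_divide)
      qed
      then show "\<exists>no. \<forall>n\<ge>no. norm ((g (s * \<epsilon> n) \<zeta> - g (\<epsilon> n) \<zeta>) / M (\<epsilon> n) - 0) < r"
        by (simp add: eventually_sequentially)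
    qed
  qed
qed

end

section \<open>Product slices\<close>

lemma convexD_pair:
  assumes "convex U" "(x, y) \<in> U" "(x', y') \<in> U" "0 \<le> t" "t \<le> 1"
  shows "((1 - t) *\<^sub>R x + t *\<^sub>R x', (1 - t) *\<^sub>R y + t *\<^sub>R y') \<in> U"
  using convexD[OF assms(1,2,3), of "1 - t" t] assms(4,5) by simp

lemma open_pair_small:
  fixes x y a b :: complex
  assumes "open U" "(x, y) \<in> U"
  obtains e where "0 < e" "\<And>s t. \<bar>s\<bar> < e \<Longrightarrow> \<bar>t\<bar> < e \<Longrightarrow> (x + s *\<^sub>R a, y + t *\<^sub>R b) \<in> U"
proof -
  have "open ((\<lambda>q. (x + fst q *\<^sub>R a, y + snd q *\<^sub>R b)) -` U)"
    by (intro open_vimage continuous_intros assms)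
  moreover have "(0::real, 0::real) \<in> (\<lambda>q. (x + fst q *\<^sub>R a, y + snd q *\<^sub>R b)) -` U" using assms by simp
  ultimately obtain A B where AB: "open A" "open B" "(0::real, 0::real) \<in> A \<times> B"
      "A \<times> B \<subseteq> (\<lambda>q. (x + fst q *\<^sub>R a, y + snd q *\<^sub>R b)) -` U"
    by (rule open_prod_elim)
  obtain e1 where e1: "0 < e1" "ball 0 e1 \<subseteq> A" using AB(1,3) open_contains_ball by (metis mem_Sigma_iff)
  obtain e2 where e2: "0 < e2" "ball 0 e2 \<subseteq> B" using AB(2,3) open_contains_ball by (metis mem_Sigma_iff)
  show ?thesis
  proof (rule that[of "min e1 e2"])
    fix s t :: real assume "\<bar>s\<bar> < min e1 e2" "\<bar>t\<bar> < min e1 e2"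
    then have "s \<in> A" "t \<in> B" using e1 e2 by (auto simp: subset_iff dist_norm)
    then show "(x + s *\<^sub>R a, y + t *\<^sub>R b) \<in> U" using AB(4) by auto
  qed (use e1 e2 in simp)
qed

text \<open>Equality of the slices is assumed over positive reals only. A convex combination with a
  point of the cone moves a point over \<open>w\<close> to a positive real height, or conversely;
  openness provides the small enlargements that compensate for the convex weights.\<close>

lemma product_of_cone_and_slices:
  fixes U :: "(complex \<times> complex) set"
  assumes U: "open U" "convex U" "(1, 0) \<in> U"
    and cone: "\<And>w s. (w, 0) \<in> U \<Longrightarrow> 0 < s \<Longrightarrow> (s *\<^sub>R w, 0) \<in> U"
    and slice: "\<And>s \<zeta>. 0 < s \<Longrightarrow> (of_real s, \<zeta>) \<in> U \<longleftrightarrow> (1, \<zeta>) \<in> U"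
  shows "(w, \<zeta>) \<in> U \<longleftrightarrow> (w, 0) \<in> U \<and> (1, \<zeta>) \<in> U"
proof (intro iffI conjI)
  assume w\<zeta>: "(w, \<zeta>) \<in> U"
  obtain e where e: "0 < e" "\<And>s t. \<bar>s\<bar> < e \<Longrightarrow> \<bar>t\<bar> < e \<Longrightarrow> (1 + s *\<^sub>R \<i>, 0 + t *\<^sub>R \<zeta>) \<in> U"
    using open_pair_small[OF U(1,3)] by metis
  obtain d0 where d0: "0 < d0" "\<And>s t. \<bar>s\<bar> < d0 \<Longrightarrow> \<bar>t\<bar> < d0 \<Longrightarrow> (w + s *\<^sub>R 1, \<zeta> + t *\<^sub>R \<zeta>) \<in> U"
    using open_pair_small[OF U(1) w\<zeta>] by metis
  define d where "d = d0 / 2"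
  have d: "0 < d" "\<bar>d\<bar> < d0" using d0(1) by (auto simp: d_def)
  show "(1, \<zeta>) \<in> U"
  proof -
    \<comment> \<open>Large enough for the direction \<open>1 - (Im w / s) * \<i>\<close> to be
      within \<open>e\<close> of 1, hence in the cone, and for \<open>Re w + s\<close> to be
      positive. Adding \<open>s\<close> times this direction to \<open>w\<close> cancels the
      imaginary part.\<close>
    define s where "s = 1 + \<bar>Re w\<bar> + 2 * \<bar>Im w\<bar> / e"
    have "0 \<le> 2 * \<bar>Im w\<bar> / e" using e(1) by simp
    then have s: "0 < s" "0 < Re w + s" unfolding s_def by linarith+
    have "e * \<bar>Im w\<bar> < e * (e * s) \<or> Im w = 0"
    proof -
      have "e * s = e * (1 + \<bar>Re w\<bar>) + 2 * \<bar>Im w\<bar>" using e(1) by (simp add: s_def field_simps)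
      moreover have "0 < e * (1 + \<bar>Re w\<bar>)" using e(1) by simp
      ultimately have "\<bar>Im w\<bar> < e * s" by linarith
      then show ?thesis using e(1) by simp
    qed
    then have "\<bar>- (Im w / s)\<bar> < e" using s(1) e(1) by (auto simp: abs_divide field_simps)
    then have k: "(1 + (- (Im w / s)) *\<^sub>R \<i>, 0) \<in> U" using e(1) e(2)[of "- (Im w / s)" 0] by simp
    \<comment> \<open>The combination shrinks the second coordinate by \<open>1 - t\<close>;
      enlarging it beforehand by \<open>1 + d\<close> undoes this.\<close>
    define t where "t = d / (1 + d)"
    have t: "0 < t" "t < 1" "(1 - t) * (1 + d) = 1" using d(1) by (auto simp: t_def field_simps)
    have "(((1 - t) * s / t) *\<^sub>R (1 + (- (Im w / s)) *\<^sub>R \<i>), 0) \<in> U"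
      using t s(1) by (intro cone k) simp
    moreover have "(w, \<zeta> + d *\<^sub>R \<zeta>) \<in> U" using d0 d(2) d0(2)[of 0 d] by simp
    ultimately have "((1 - t) *\<^sub>R w + t *\<^sub>R (((1 - t) * s / t) *\<^sub>R (1 + (- (Im w / s)) *\<^sub>R \<i>)),
        (1 - t) *\<^sub>R (\<zeta> + d *\<^sub>R \<zeta>) + t *\<^sub>R 0) \<in> U"
      using t by (intro convexD_pair[OF U(2)]) auto
    moreover have "(1 - t) *\<^sub>R (\<zeta> + d *\<^sub>R \<zeta>) + t *\<^sub>R 0 = ((1 - t) * (1 + d)) *\<^sub>R \<zeta>"
      by (simp add: algebra_simps)
    moreover have "(1 - t) *\<^sub>R w + t *\<^sub>R (((1 - t) * s / t) *\<^sub>R (1 + (- (Im w / s)) *\<^sub>R \<i>)) = of_real ((1 - t) * (Re w + s))"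
      using t(1) s(1) by (simp add: complex_eq_iff field_simps)
    ultimately have "(of_real ((1 - t) * (Re w + s)), \<zeta>) \<in> U" using t(3) by simp
    then show ?thesis using slice[of "(1 - t) * (Re w + s)" \<zeta>] t(2) s(2) by simp
  qed
  show "(w, 0) \<in> U"
  proof -
    \<comment> \<open>Now \<open>t / (1 - t)\<close> is \<open>e / 2\<close>, so that multiple of
      \<open>- \<zeta>\<close> lies in the slice over 1, hence over every positive real, and cancels
      \<zeta> in the combination. The shift of \<open>w\<close> by \<open>- d\<close> absorbs the
      positive height used.\<close>
    define t where "t = e / (2 + e)"
    have "1 - t = 2 / (2 + e)" using e(1) by (simp add: t_def field_simps)
    then have "t / (1 - t) = e / 2" using e(1) by (simp add: t_def)
    then have t: "0 < t" "t < 1" "t / (1 - t) < e" using e(1) by (auto simp: t_def)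
    have "(1, - (t / (1 - t)) *\<^sub>R \<zeta>) \<in> U" using e(1) e(2)[of 0 "- (t / (1 - t))"] t by simp
    then have "(of_real (t * d / (1 - t)), - (t / (1 - t)) *\<^sub>R \<zeta>) \<in> U"
      using slice[of "t * d / (1 - t)"] t d(1) by simp
    moreover have "(w + - d *\<^sub>R 1, \<zeta>) \<in> U" using d0 d d0(2)[of "-d" 0] by simp
    ultimately have "((1 - t) *\<^sub>R of_real (t * d / (1 - t)) + t *\<^sub>R (w + - d *\<^sub>R 1),
        (1 - t) *\<^sub>R (- (t / (1 - t)) *\<^sub>R \<zeta>) + t *\<^sub>R \<zeta>) \<in> U"
      using t by (intro convexD_pair[OF U(2)]) auto
    moreover have "(1 - t) *\<^sub>R (- (t / (1 - t)) *\<^sub>R \<zeta>) + t *\<^sub>R \<zeta> = 0" using t(2) by simp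
    moreover have "(1 - t) *\<^sub>R complex_of_real (t * d / (1 - t)) + t *\<^sub>R (w + - d *\<^sub>R 1) = t *\<^sub>R w"
    proof -
      have eq: "(1 - t) *\<^sub>R complex_of_real (t * d / (1 - t)) = of_real (t * d)"
        using t(2) by (simp only: scaleR_conv_of_real of_real_mult[symmetric]) simp
      show ?thesis unfolding eq by (simp add: complex_eq_iff algebra_simps)
    qed
    ultimately have "(t *\<^sub>R w, 0) \<in> U" by (simp only:)
    from cone[OF this, of "inverse t"] show ?thesis using t(1) by simp
  qed
next
  assume *: "(w, 0) \<in> U \<and> (1, \<zeta>) \<in> U"
  obtain d0 where d0: "0 < d0" "\<And>s t. \<bar>s\<bar> < d0 \<Longrightarrow> \<bar>t\<bar> < d0 \<Longrightarrow> (1 + s *\<^sub>R 1, \<zeta> + t *\<^sub>R \<zeta>) \<in> U"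
    using open_pair_small[OF U(1)] * by metis
  define d where "d = d0 / 2"
  have d: "0 < d" "\<bar>d\<bar> < d0" using d0(1) by (auto simp: d_def)
  obtain c0 where c0: "0 < c0" "\<And>s t. \<bar>s\<bar> < c0 \<Longrightarrow> \<bar>t\<bar> < c0 \<Longrightarrow> (w + s *\<^sub>R 1, 0 + t *\<^sub>R 0) \<in> U"
    using open_pair_small[OF U(1)] * by metis
  \<comment> \<open>Moving \<open>w\<close> to the left by \<open>c\<close> leaves room for the
    positive height \<open>c / (1 - t)\<close> of the other point, so that the combination lies
    exactly over \<open>w\<close>.\<close>
  define c where "c = c0 / 2"
  have c: "0 < c" "\<bar>- c\<bar> < c0" using c0(1) by (auto simp: c_def)
  define t where "t = d / (1 + d)"
  have t: "0 < t" "t < 1" "(1 - t) * (1 + d) = 1" using d(1) by (auto simp: t_def field_simps)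
  have "(1, \<zeta> + d *\<^sub>R \<zeta>) \<in> U" using d0 d(2) d0(2)[of 0 d] by simp
  then have "(of_real (c / (1 - t)), \<zeta> + d *\<^sub>R \<zeta>) \<in> U" using slice[of "c / (1 - t)"] c(1) t(2) by simp
  moreover have "(inverse t *\<^sub>R (w + - c *\<^sub>R 1), 0) \<in> U"
    using cone[of "w + - c *\<^sub>R 1" "inverse t"] c0(2)[of "-c" 0] c(2) c0(1) t(1) by simp
  ultimately have "((1 - t) *\<^sub>R of_real (c / (1 - t)) + t *\<^sub>R (inverse t *\<^sub>R (w + - c *\<^sub>R 1)),
      (1 - t) *\<^sub>R (\<zeta> + d *\<^sub>R \<zeta>) + t *\<^sub>R 0) \<in> U"
    using t by (intro convexD_pair[OF U(2)]) auto
  moreover have "(1 - t) *\<^sub>R (\<zeta> + d *\<^sub>R \<zeta>) + t *\<^sub>R 0 = ((1 - t) * (1 + d)) *\<^sub>R \<zeta>"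
    by (simp add: algebra_simps)
  moreover have "(1 - t) *\<^sub>R complex_of_real (c / (1 - t)) + t *\<^sub>R (inverse t *\<^sub>R (w + - c *\<^sub>R 1)) = w"
  proof -
    have eq: "(1 - t) *\<^sub>R complex_of_real (c / (1 - t)) = of_real c"
      using t(2) by (simp only: scaleR_conv_of_real of_real_mult[symmetric]) simp
    show ?thesis unfolding eq using t(1) by (simp add: complex_eq_iff)
  qed
  ultimately show "(w, \<zeta>) \<in> U" using t(3) by simp
qed

section \<open>Products of planar domains and the bidisk\<close>

lemma bounded_linear_axis: "bounded_linear (axis j :: complex \<Rightarrow> complex^'n)"
proof -
  have "linear (axis j :: complex \<Rightarrow> complex^'n)"
    by (rule linearI) (simp_all add: vec_eq_iff axis_def)
  then show ?thesis by (simp add: linear_conv_bounded_linear)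
qed

text \<open>The index pairs of source and target are independent, so the map to the bidisk and its
  inverse are both instances.\<close>

lemma holomorphic_map_on_axes:
  fixes j1 j2 :: "'n::finite" and k1 k2 :: "'m::finite"
  assumes "p holomorphic_on P" "open P" "q holomorphic_on Q" "open Q"
    and S: "\<And>x. x \<in> S \<Longrightarrow> x $ k1 \<in> P \<and> x $ k2 \<in> Q"
  shows "holomorphic_map_on (\<lambda>x :: complex^'m. axis j1 (p (x $ k1)) + axis j2 (q (x $ k2)) :: complex^'n) S"
  unfolding holomorphic_map_on_def
proof (intro ballI exI conjI)
  fix x assume x: "x \<in> S"
  have nth: "((\<lambda>x. x $ k) has_derivative (\<lambda>h. h $ k)) (at x within S)" for k
    by (rule bounded_linear_imp_has_derivative) (rule bounded_linear_vec_nth)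
  have p: "(p has_field_derivative deriv p (x $ k1)) (at (x $ k1))"
    and q: "(q has_field_derivative deriv q (x $ k2)) (at (x $ k2))"
    using S[OF x] assms(1-4) holomorphic_derivI by blast+
  have "((\<lambda>x. p (x $ k1)) has_derivative (\<lambda>h. deriv p (x $ k1) * h $ k1)) (at x within S)"
    using has_derivative_compose[OF nth p[unfolded has_field_derivative_def]] by simp
  moreover have "((\<lambda>x. q (x $ k2)) has_derivative (\<lambda>h. deriv q (x $ k2) * h $ k2)) (at x within S)"
    using has_derivative_compose[OF nth q[unfolded has_field_derivative_def]] by simp
  ultimately show "((\<lambda>x. axis j1 (p (x $ k1)) + axis j2 (q (x $ k2)) :: complex^'n) has_derivative
      (\<lambda>h. axis j1 (deriv p (x $ k1) * h $ k1) + axis j2 (deriv q (x $ k2) * h $ k2))) (at x within S)"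
    by (intro has_derivative_add bounded_linear.has_derivative[OF bounded_linear_axis])
  show "Vector_Spaces.linear (*s) (*s)
      (\<lambda>h. axis j1 (deriv p (x $ k1) * h $ k1) + axis j2 (deriv q (x $ k2) * h $ k2) :: complex^'n)"
    by (simp add: Vector_Spaces.linear_iff vec.vector_space_axioms) (simp add: vec_eq_iff axis_def distrib_left)
qed

text \<open>Convex planar domains are simply connected, so the Riemann mapping theorem applies to
  each factor; the remaining coordinates vanish on the product and are ignored by the map.\<close>

lemma biholomorphic_product_bidisk:
  fixes i1 i2 :: "'d::finite"
  assumes "i1 \<noteq> i2"
    and K: "open K" "convex K" "K \<noteq> {}" "K \<noteq> UNIV" and W: "open W" "convex W" "W \<noteq> {}" "W \<noteq> UNIV"
  shows "biholomorphic {axis i1 s + axis i2 t :: complex^'d | s t. s \<in> K \<and> t \<in> W} bidisk"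
proof -
  obtain f1 g1 where 1: "f1 holomorphic_on K" "g1 holomorphic_on ball 0 1"
    "\<And>z. z \<in> K \<Longrightarrow> f1 z \<in> ball 0 1 \<and> g1 (f1 z) = z" "\<And>z. z \<in> ball 0 1 \<Longrightarrow> g1 z \<in> K \<and> f1 (g1 z) = z"
    using Riemann_mapping_theorem[of K] K convex_imp_simply_connected[OF K(2)] by blast
  obtain f2 g2 where 2: "f2 holomorphic_on W" "g2 holomorphic_on ball 0 1"
    "\<And>z. z \<in> W \<Longrightarrow> f2 z \<in> ball 0 1 \<and> g2 (f2 z) = z" "\<And>z. z \<in> ball 0 1 \<Longrightarrow> g2 z \<in> W \<and> f2 (g2 z) = z"
    using Riemann_mapping_theorem[of W] W convex_imp_simply_connected[OF W(2)] by blast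
  define S where "S = {axis i1 s + axis i2 t :: complex^'d | s t. s \<in> K \<and> t \<in> W}"
  define F where "F x = (axis 1 (f1 (x $ i1)) + axis 2 (f2 (x $ i2)) :: complex^2)" for x :: "complex^'d"
  define G where "G y = (axis i1 (g1 (y $ 1)) + axis i2 (g2 (y $ 2)) :: complex^'d)" for y :: "complex^2"
  have nth: "(axis i1 s + axis i2 t :: complex^'d) $ i1 = s" "(axis i1 s + axis i2 t :: complex^'d) $ i2 = t" for s t
    using assms(1) by (simp_all add: axis_def)
  have nth2: "(axis 1 s + axis 2 t :: complex^2) $ 1 = s" "(axis 1 s + axis 2 t :: complex^2) $ 2 = t" for s t
    by (simp_all add: axis_def)
  have S: "x $ i1 \<in> K \<and> x $ i2 \<in> W \<and> axis i1 (x $ i1) + axis i2 (x $ i2) = x" if x: "x \<in> S" for x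
  proof -
    obtain s t where "x = axis i1 s + axis i2 t" "s \<in> K" "t \<in> W" using x unfolding S_def by blast
    then show ?thesis by (simp only: nth simp_thms)
  qed
  have bid: "axis 1 (y $ 1) + axis 2 (y $ 2) = y" for y :: "complex^2"
    by (simp add: vec_eq_iff forall_2 axis_def)
  have FS: "F x \<in> bidisk \<and> G (F x) = x" if "x \<in> S" for x
    using S[OF that] 1(3)[of "x $ i1"] 2(3)[of "x $ i2"]
    unfolding F_def G_def bidisk_def mem_Collect_eq nth2 by simp
  have GS: "G y \<in> S \<and> F (G y) = y" if "y \<in> bidisk" for y
  proof -
    have y: "g1 (y $ 1) \<in> K" "f1 (g1 (y $ 1)) = y $ 1" "g2 (y $ 2) \<in> W" "f2 (g2 (y $ 2)) = y $ 2"
      using that 1(4)[of "y $ 1"] 2(4)[of "y $ 2"] unfolding bidisk_def by blast+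
    then have "F (G y) = y" unfolding F_def G_def nth using bid[of y] by simp
    moreover have "G y \<in> S" unfolding G_def S_def using y by blast
    ultimately show ?thesis by blast
  qed
  have "holomorphic_map_on F S"
    unfolding F_def[abs_def] using S by (intro holomorphic_map_on_axes[OF 1(1) K(1) 2(1) W(1)]) blast
  moreover have "holomorphic_map_on G bidisk"
    unfolding G_def[abs_def]
    by (intro holomorphic_map_on_axes[OF 1(2) open_ball 2(2) open_ball]) (simp add: bidisk_def)
  moreover have "F ` S = bidisk"
  proof (intro equalityI subsetI)
    fix y assume "y \<in> F ` S"
    then show "y \<in> bidisk" using FS by blast
  next
    fix y assume "y \<in> bidisk"
    from GS[OF this] show "y \<in> F ` S" by (metis (no_types, lifting) imageI)
  qed
  moreover have "G ` bidisk = S"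
  proof (intro equalityI subsetI)
    fix x assume "x \<in> G ` bidisk"
    then show "x \<in> S" using GS by blast
  next
    fix x assume "x \<in> S"
    from FS[OF this] show "x \<in> G ` bidisk" by (metis (no_types, lifting) imageI)
  qed
  ultimately show ?thesis unfolding biholomorphic_def S_def[symmetric]
    by (intro exI[of _ F] exI[of _ G] conjI ballI) (simp_all only: FS GS)
qed

section \<open>Smoothness and orders of vanishing\<close>

text \<open>Counting derivatives by a number instead of a list of directions lets the product and
  chain rules go through by induction.\<close>

primrec differentiable_of_order :: "nat \<Rightarrow> 'a::real_normed_vector set \<Rightarrow> ('a \<Rightarrow> 'b::real_normed_vector) \<Rightarrow> bool" where
  "differentiable_of_order 0 U f \<longleftrightarrow> True"
| "differentiable_of_order (Suc k) U f \<longleftrightarrow> (\<forall>x\<in>U. f differentiable (at x)) \<and>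
     (\<forall>v. differentiable_of_order k U (\<lambda>x. frechet_derivative f (at x) v))"

lemma smooth_on_imp_differentiable_of_order:
  assumes "smooth_on U f"
  shows "differentiable_of_order k U f"
  using assms
proof (induction k arbitrary: f)
  case (Suc k)
  have "smooth_on U (\<lambda>x. frechet_derivative f (at x) v)" for v
    unfolding smooth_on_def
  proof (intro allI ballI)
    fix vs x assume "x \<in> U"
    then show "iterated_derivative vs (\<lambda>x. frechet_derivative f (at x) v) differentiable (at x)"
      using Suc.prems[unfolded smooth_on_def, rule_format, of x "v # vs"] by simp
  qed
  moreover have "f differentiable (at x)" if "x \<in> U" for x
    using Suc.prems[unfolded smooth_on_def, rule_format, of x "[]"] that by simp
  ultimately show ?case using Suc.IH by simp
qed simp

lemma frechet_derivative_eqI: "(f has_derivative f') (at x) \<Longrightarrow> frechet_derivative f (at x) = f'"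
  using frechet_derivative_at by metis

lemma differentiable_of_order_cong:
  assumes "open U" "\<And>x. x \<in> U \<Longrightarrow> f x = g x" "differentiable_of_order k U f"
  shows "differentiable_of_order k U g"
  using assms(2,3)
proof (induction k arbitrary: f g)
  case (Suc k)
  have D: "(g has_derivative frechet_derivative f (at x)) (at x)" if "x \<in> U" for x
    using has_derivative_transform_within_open[OF _ assms(1) that Suc.prems(1)] Suc.prems(2) that
    by (simp add: frechet_derivative_works)
  have "differentiable_of_order k U (\<lambda>x. frechet_derivative g (at x) v)" for v
  proof (rule Suc.IH)
    show "frechet_derivative f (at x) v = frechet_derivative g (at x) v" if "x \<in> U" for x
      using frechet_derivative_eqI[OF D[OF that]] by simp
    show "differentiable_of_order k U (\<lambda>x. frechet_derivative f (at x) v)" using Suc.prems(2) by simp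
  qed
  then show ?case using D by (auto simp: differentiable_def)
qed simp

text \<open>An explicit derivative known on \<open>U\<close> replaces
  \<open>frechet_derivative\<close>; as \<open>U\<close> is open, the higher derivatives on
  \<open>U\<close> do not see the difference.\<close>

lemma differentiable_of_order_SucI:
  assumes "open U" "\<And>x. x \<in> U \<Longrightarrow> (f has_derivative f' x) (at x)"
    and "\<And>v. differentiable_of_order k U (\<lambda>x. f' x v)"
  shows "differentiable_of_order (Suc k) U f"
proof -
  have "differentiable_of_order k U (\<lambda>x. frechet_derivative f (at x) v)" for v
    by (rule differentiable_of_order_cong[OF assms(1) _ assms(3)[of v]])
      (simp add: frechet_derivative_eqI[OF assms(2)])
  then show ?thesis using assms(2) by (auto simp: differentiable_def)
qed

lemma differentiable_of_order_Suc_has_derivative: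
  "differentiable_of_order (Suc k) U f \<Longrightarrow> x \<in> U \<Longrightarrow> (f has_derivative frechet_derivative f (at x)) (at x)"
  by (simp add: frechet_derivative_works)

lemma differentiable_of_order_Suc: "differentiable_of_order (Suc k) U f \<Longrightarrow> differentiable_of_order k U f"
  by (induction k arbitrary: f) auto

lemma differentiable_of_order_add:
  assumes "open U" "differentiable_of_order k U f" "differentiable_of_order k U g"
  shows "differentiable_of_order k U (\<lambda>x. f x + g x)"
  using assms(2,3)
proof (induction k arbitrary: f g)
  case (Suc k)
  show ?case
    by (rule differentiable_of_order_SucI[OF assms(1) has_derivative_add])
      (use Suc differentiable_of_order_Suc_has_derivative in \<open>blast, blast, simp\<close>)
qed simp

lemma differentiable_of_order_const: "open U \<Longrightarrow> differentiable_of_order k U (\<lambda>x. c)"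
proof (induction k arbitrary: c)
  case (Suc k)
  show ?case by (rule differentiable_of_order_SucI[OF Suc.prems has_derivative_const]) (simp add: Suc)
qed simp

lemma differentiable_of_order_sum:
  assumes "open U" "\<And>i. i \<in> I \<Longrightarrow> differentiable_of_order k U (f i)"
  shows "differentiable_of_order k U (\<lambda>x. \<Sum>i\<in>I. f i x)"
  using assms(2)
  by (induction I rule: infinite_finite_induct)
    (auto simp: differentiable_of_order_const differentiable_of_order_add assms(1))

lemma differentiable_of_order_mult:
  fixes f g :: "'a::real_normed_vector \<Rightarrow> real"
  assumes "open U" "differentiable_of_order k U f" "differentiable_of_order k U g"
  shows "differentiable_of_order k U (\<lambda>x. f x * g x)"
  using assms(2,3)
proof (induction k arbitrary: f g)
  case (Suc k)
  show ?case
  proof (rule differentiable_of_order_SucI[OF assms(1) has_derivative_mult])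
    fix x assume "x \<in> U"
    then show "(f has_derivative frechet_derivative f (at x)) (at x)"
      "(g has_derivative frechet_derivative g (at x)) (at x)"
      using Suc.prems differentiable_of_order_Suc_has_derivative by blast+
  next
    fix v
    show "differentiable_of_order k U (\<lambda>x. f x * frechet_derivative g (at x) v + frechet_derivative f (at x) v * g x)"
      using Suc.prems differentiable_of_order_Suc[OF Suc.prems(1)] differentiable_of_order_Suc[OF Suc.prems(2)]
      by (intro differentiable_of_order_add assms(1) Suc.IH) auto
  qed
qed simp

lemma differentiable_of_order_bounded_linear:
  assumes "open U" "bounded_linear h" "differentiable_of_order k U f"
  shows "differentiable_of_order k U (\<lambda>x. h (f x))"
  using assms(3)
proof (induction k arbitrary: f)
  case (Suc k)
  show ?case
    by (rule differentiable_of_order_SucI[OF assms(1) bounded_linear.has_derivative[OF assms(2)]])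
      (use Suc differentiable_of_order_Suc_has_derivative in \<open>blast, simp\<close>)
qed simp

text \<open>The chain rule evaluates the derivative of \<open>r\<close> in a direction that moves
  with \<open>x\<close>, whereas the induction knows it only in fixed directions. Expanding in the
  basis turns it into a sum of products of known functions.\<close>

lemma differentiable_of_order_compose:
  fixes r :: "'b::euclidean_space \<Rightarrow> real"
  assumes "open S" "\<And>x. x \<in> S \<Longrightarrow> z x \<in> U"
    and "differentiable_of_order k U r" "differentiable_of_order k S z"
  shows "differentiable_of_order k S (\<lambda>x. r (z x))"
  using assms(3,4)
proof (induction k arbitrary: r)
  case (Suc k)
  have Dr: "(r has_derivative frechet_derivative r (at y)) (at y)" if "y \<in> U" for y
    using differentiable_of_order_Suc_has_derivative[OF Suc.prems(1) that] .
  have Dz: "(z has_derivative frechet_derivative z (at x)) (at x)" if "x \<in> S" for x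
    using differentiable_of_order_Suc_has_derivative[OF Suc.prems(2) that] .
  show ?case
  proof (rule differentiable_of_order_SucI[OF assms(1)])
    fix x assume x: "x \<in> S"
    have "((\<lambda>x. r (z x)) has_derivative (\<lambda>v. frechet_derivative r (at (z x)) (frechet_derivative z (at x) v))) (at x)"
      using has_derivative_compose[OF Dz[OF x] Dr[OF assms(2)[OF x]]] .
    moreover have expand: "frechet_derivative r (at (z x)) w = (\<Sum>b\<in>Basis. (w \<bullet> b) * frechet_derivative r (at (z x)) b)" for w
    proof -
      have lin: "linear (frechet_derivative r (at (z x)))"
        using Dr[OF assms(2)[OF x]] has_derivative_linear by blast
      have "frechet_derivative r (at (z x)) (\<Sum>b\<in>Basis. (w \<bullet> b) *\<^sub>R b) = (\<Sum>b\<in>Basis. (w \<bullet> b) * frechet_derivative r (at (z x)) b)"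
        by (simp add: linear_sum[OF lin] linear_scale[OF lin])
      then show ?thesis by (simp add: euclidean_representation)
    qed
    ultimately show "((\<lambda>x. r (z x)) has_derivative (\<lambda>v. \<Sum>b\<in>Basis. (frechet_derivative z (at x) v \<bullet> b) *
        frechet_derivative r (at (z x)) b)) (at x)"
      by (subst expand[symmetric])
  next
    fix v
    show "differentiable_of_order k S (\<lambda>x. \<Sum>b\<in>Basis. (frechet_derivative z (at x) v \<bullet> b) * frechet_derivative r (at (z x)) b)"
    proof (intro differentiable_of_order_sum differentiable_of_order_mult assms(1))
      fix b :: 'b
      show "differentiable_of_order k S (\<lambda>x. frechet_derivative z (at x) v \<bullet> b)"
        using Suc.prems(2)
        by (intro differentiable_of_order_bounded_linear[OF assms(1) bounded_linear_inner_left]) simp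
      show "differentiable_of_order k S (\<lambda>x. frechet_derivative r (at (z x)) b)"
        using Suc.prems(1) differentiable_of_order_Suc[OF Suc.prems(2)] by (intro Suc.IH) auto
    qed
  qed
qed simp

section \<open>Holomorphic curves and Taylor-type bounds\<close>

lemma holomorphic_curve_has_derivative:
  fixes z :: "complex \<Rightarrow> complex^'d"
  assumes "holomorphic_curve_on z S" "open S" "t \<in> S"
  shows "(z has_derivative (\<lambda>v. v *s (\<chi> i. deriv (\<lambda>t. z t $ i) t))) (at t)"
proof -
  have "((\<lambda>t. z t $ i) has_derivative (\<lambda>v. deriv (\<lambda>t. z t $ i) t * v)) (at t)" for i
    using assms holomorphic_derivI[of "\<lambda>t. z t $ i" S t] unfolding holomorphic_curve_on_def has_field_derivative_def
    by blast
  then have "((\<lambda>t. \<Sum>i\<in>UNIV. axis i (z t $ i) :: complex^'d) has_derivative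
      (\<lambda>v. \<Sum>i\<in>UNIV. axis i (deriv (\<lambda>t. z t $ i) t * v))) (at t)"
    by (intro has_derivative_sum bounded_linear.has_derivative[OF bounded_linear_axis])
  moreover have ax: "(\<Sum>i\<in>UNIV. axis i (f i)) = (\<chi> i. f i)" for f :: "'d \<Rightarrow> complex"
    by (simp add: vec_eq_iff axis_def if_distrib cong: if_cong)
  have "(\<lambda>t. \<Sum>i\<in>UNIV. axis i (z t $ i)) = z"
    unfolding ax by (simp add: fun_eq_iff vec_eq_iff)
  moreover have "(\<lambda>v. \<Sum>i\<in>UNIV. axis i (deriv (\<lambda>t. z t $ i) t * v)) = (\<lambda>v. v *s (\<chi> i. deriv (\<lambda>t. z t $ i) t))"
    unfolding ax by (simp add: fun_eq_iff vec_eq_iff)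
  ultimately show ?thesis by (simp only:)
qed

text \<open>Each directional derivative of a holomorphic curve is again a holomorphic curve, so the
  induction closes.\<close>

lemma holomorphic_curve_smooth:
  fixes z :: "complex \<Rightarrow> complex^'d"
  assumes "open S" "holomorphic_curve_on z S"
  shows "differentiable_of_order k S z"
  using assms(2)
proof (induction k arbitrary: z)
  case (Suc k)
  show ?case
  proof (rule differentiable_of_order_SucI[OF assms(1)])
    fix t assume "t \<in> S"
    then show "(z has_derivative (\<lambda>v. v *s (\<chi> i. deriv (\<lambda>t. z t $ i) t))) (at t)"
      by (rule holomorphic_curve_has_derivative[OF Suc.prems assms(1)])
  next
    fix v
    show "differentiable_of_order k S (\<lambda>t. v *s (\<chi> i. deriv (\<lambda>t. z t $ i) t))"
      using Suc.prems assms(1)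
      by (intro Suc.IH) (auto simp: holomorphic_curve_on_def intro!: holomorphic_intros)
  qed
qed simp

text \<open>Induction on \<open>N\<close>: the first derivatives satisfy the bound with one power
  less, and the mean value inequality on the disc of radius \<open>cmod t\<close> supplies the
  missing power. The empty list is included, so \<open>h 0 = 0\<close> for \<open>N > 0\<close>; the
  extra order of differentiability gives continuity at the bottom of the induction.\<close>

lemma vanishing_derivatives_bound:
  fixes h :: "complex \<Rightarrow> real"
  assumes "open S" "0 \<in> S" "differentiable_of_order (Suc N) S h"
    and "\<And>vs. length vs < N \<Longrightarrow> iterated_derivative vs h 0 = 0"
  shows "\<exists>C \<delta>. 0 < \<delta> \<and> ball 0 \<delta> \<subseteq> S \<and> (\<forall>t\<in>ball 0 \<delta>. \<bar>h t\<bar> \<le> C * cmod t ^ N)"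
  using assms(3,4)
proof (induction N arbitrary: h)
  case 0
  obtain e where e: "0 < e" "ball 0 e \<subseteq> S" using assms(1,2) open_contains_ball by blast
  have "isCont h 0"
    using differentiable_imp_continuous_within[of h 0 UNIV] 0(1) assms(2) by simp
  then obtain d where d: "0 < d" "\<And>t. cmod t < d \<Longrightarrow> \<bar>h t - h 0\<bar> < 1"
    unfolding continuous_at_eps_delta dist_norm by (metis diff_zero zero_less_one real_norm_def)
  have "\<bar>h t\<bar> \<le> (\<bar>h 0\<bar> + 1) * cmod t ^ 0" if "cmod t < d" for t
    using d(2)[OF that] by simp
  then show ?case using e d(1)
    by (intro exI[of _ "\<bar>h 0\<bar> + 1"] exI[of _ "min e d"]) auto
next
  case (Suc N)
  define D where "D v t = frechet_derivative h (at t) v" for v t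
  have "\<exists>C \<delta>. 0 < \<delta> \<and> ball 0 \<delta> \<subseteq> S \<and> (\<forall>t\<in>ball 0 \<delta>. \<bar>D v t\<bar> \<le> C * cmod t ^ N)" for v
  proof (rule Suc.IH)
    show "differentiable_of_order (Suc N) S (D v)" using Suc.prems(1) unfolding D_def[abs_def] by simp
    show "iterated_derivative vs (D v) 0 = 0" if "length vs < N" for vs
      using Suc.prems(2)[of "v # vs"] that unfolding D_def[abs_def] by simp
  qed
  then obtain C \<delta> where C: "\<And>v. 0 < \<delta> v" "\<And>v. ball 0 (\<delta> v) \<subseteq> S" "\<And>v t. t \<in> ball 0 (\<delta> v) \<Longrightarrow> \<bar>D v t\<bar> \<le> C v * cmod t ^ N"
    by metis
  \<comment> \<open>The directions 1 and \<i> span the plane over the reals, so their bounds control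
    the whole derivative.\<close>
  define d where "d = min (\<delta> 1) (\<delta> \<i>)"
  define B where "B = C 1 + C \<i>"
  have hd: "(h has_derivative (\<lambda>v. D v t)) (at t)" if "t \<in> S" for t
    using differentiable_of_order_Suc_has_derivative[OF Suc.prems(1) that] by (simp add: D_def)
  have bound: "\<bar>D v t\<bar> \<le> B * cmod t ^ N * cmod v" if "t \<in> ball 0 d" for v t
  proof -
    have tS: "t \<in> S" using that C(2)[of 1] by (auto simp: d_def)
    have lin: "linear (\<lambda>v. D v t)" using hd[OF tS] has_derivative_linear by blast
    have "v = Re v *\<^sub>R 1 + Im v *\<^sub>R \<i>" by (simp add: complex_eq_iff)
    then have "D v t = Re v * D 1 t + Im v * D \<i> t"
      using linear_add[OF lin, of "Re v *\<^sub>R 1" "Im v *\<^sub>R \<i>"] linear_scale[OF lin, of "Re v" 1] linear_scale[OF lin, of "Im v" "\<i>"]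
      by simp
    then have "\<bar>D v t\<bar> \<le> \<bar>Re v\<bar> * \<bar>D 1 t\<bar> + \<bar>Im v\<bar> * \<bar>D \<i> t\<bar>"
      by (metis abs_mult abs_triangle_ineq)
    also have "\<dots> \<le> cmod v * (C 1 * cmod t ^ N) + cmod v * (C \<i> * cmod t ^ N)"
      using that by (intro add_mono mult_mono C abs_Re_le_cmod abs_Im_le_cmod) (auto simp: d_def)
    finally show ?thesis by (simp add: B_def algebra_simps)
  qed
  have h0: "h 0 = 0" using Suc.prems(2)[of "[]"] by simp
  have "\<bar>h t\<bar> \<le> B * cmod t ^ Suc N" if t: "t \<in> ball 0 d" for t
  proof -
    have sub: "cball 0 (cmod t) \<subseteq> ball 0 d" using t by auto
    have B0: "0 \<le> B * cmod x ^ N" if "x \<in> ball 0 d" for x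
      using bound[OF that, of 1] by simp
    have "norm (h t - h 0) \<le> B * cmod t ^ N * norm (t - 0)"
    proof (rule differentiable_bound[of "cball 0 (cmod t)"])
      fix x :: complex assume x: "x \<in> cball 0 (cmod t)"
      then have xd: "x \<in> ball 0 d" using sub by blast
      then have xS: "x \<in> S" using C(2)[of 1] by (auto simp: d_def)
      show "(h has_derivative (\<lambda>v. D v x)) (at x within cball 0 (cmod t))"
        using hd[OF xS] has_derivative_at_withinI by blast
      \<comment> \<open>Monotonicity in \<open>cmod x\<close> needs \<open>B \<ge> 0\<close>; a
        negative \<open>B\<close> is compatible with the bound at \<open>t\<close> only if
        \<open>t = 0\<close>.\<close>
      have "B * cmod x ^ N \<le> B * cmod t ^ N"
      proof (cases "0 \<le> B")
        case True
        then show ?thesis using x by (intro mult_left_mono power_mono) auto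
      next
        case False
        then have "cmod t ^ N = 0" using B0[OF t] by (metis linorder_not_le mult_nonneg_nonneg norm_ge_zero zero_le_power antisym_conv2 mult_neg_pos less_eq_real_def not_less_iff_gr_or_eq)
        then have "t = 0" "N \<noteq> 0" by (auto split: if_splits)
        then have "x = 0" using x by simp
        then show ?thesis using \<open>t = 0\<close> by simp
      qed
      moreover have "onorm (\<lambda>v. D v x) \<le> B * cmod x ^ N"
        by (rule onorm_le) (use bound[OF xd] in simp)
      ultimately show "onorm (\<lambda>v. D v x) \<le> B * cmod t ^ N" by linarith
    qed auto
    then show ?thesis by (simp add: h0 mult_ac)
  qed
  moreover have "0 < d" "ball 0 d \<subseteq> S" using C(1,2)[of 1] C(1)[of "\<i>"] by (auto simp: d_def)
  ultimately show ?case by blast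
qed

text \<open>Differentiating removes the constant and lowers the power of \<open>t\<close> by one,
  leaving the same form. After fewer than \<open>k\<close> derivatives a factor \<open>t\<close>
  remains at 0.\<close>

lemma iterated_derivative_power_factor:
  fixes f :: "complex \<Rightarrow> complex^'d"
  assumes "0 < R" "holomorphic_curve_on g (ball 0 R)"
    and "\<And>t. t \<in> ball 0 R \<Longrightarrow> f t = c + t ^ k *s g t" "vs \<noteq> []" "length vs < k"
  shows "iterated_derivative vs f 0 = 0"
  using assms(2-5)
proof (induction vs arbitrary: f g c k)
  case (Cons v vs)
  define g' where "g' t = v *s (of_nat k *s g t + t *s (\<chi> i. deriv (\<lambda>t. g t $ i) t))" for t
  have gi: "(\<lambda>t. g t $ i) holomorphic_on ball 0 R" for i
    using Cons.prems(1) by (simp add: holomorphic_curve_on_def)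
  have fhol: "holomorphic_curve_on f (ball 0 R)"
    unfolding holomorphic_curve_on_def
  proof
    fix i
    have "(\<lambda>t. c $ i + t ^ k * g t $ i) holomorphic_on ball 0 R" by (intro holomorphic_intros gi)
    then show "(\<lambda>t. f t $ i) holomorphic_on ball 0 R"
      by (rule holomorphic_transform) (simp add: Cons.prems(2))
  qed
  obtain k' where k': "k = Suc k'" using Cons.prems(4) by (cases k) auto
  have D: "frechet_derivative f (at t) v = 0 + t ^ k' *s g' t" if t: "t \<in> ball 0 R" for t
  proof -
    have "deriv (\<lambda>t. f t $ i) t = t ^ k' * (of_nat k * g t $ i + t * deriv (\<lambda>t. g t $ i) t)" for i
    proof (rule DERIV_imp_deriv)
      have "((\<lambda>t. g t $ i) has_field_derivative deriv (\<lambda>t. g t $ i) t) (at t)"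
        using gi t holomorphic_derivI by blast
      note DERIV_add[OF DERIV_const DERIV_mult[OF DERIV_power_Suc[OF DERIV_ident, of k'] this], of "c $ i"]
      then have "((\<lambda>t. c $ i + t ^ k * g t $ i) has_field_derivative
          t ^ k' * (of_nat k * g t $ i + t * deriv (\<lambda>t. g t $ i) t)) (at t)"
        unfolding k' by (rule DERIV_cong) (simp add: algebra_simps)
      then show "((\<lambda>t. f t $ i) has_field_derivative
          t ^ k' * (of_nat k * g t $ i + t * deriv (\<lambda>t. g t $ i) t)) (at t)"
        by (rule has_field_derivative_transform_within_open[OF _ open_ball t]) (simp add: Cons.prems(2))
    qed
    then show ?thesis
      using frechet_derivative_eqI[OF holomorphic_curve_has_derivative[OF fhol open_ball t]]
      by (simp add: g'_def vec_eq_iff algebra_simps)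
  qed
  have g'hol: "holomorphic_curve_on g' (ball 0 R)"
    unfolding holomorphic_curve_on_def g'_def using gi by (auto intro!: holomorphic_intros)
  show ?case
  proof (cases "vs = []")
    case True
    then show ?thesis using D[of 0] assms(1) Cons.prems(4) by (simp add: k' power_0_left)
  next
    case False
    then show ?thesis using Cons.IH[OF g'hol D False] Cons.prems(4) by (simp add: k')
  qed
qed simp

section \<open>From infinite type to curves of high contact\<close>

lemma le_vanishing_orderI:
  assumes "\<And>vs. vs \<noteq> [] \<Longrightarrow> length vs < k \<Longrightarrow> iterated_derivative vs h 0 = 0"
  shows "enat k \<le> vanishing_order h"
  unfolding vanishing_order_def
proof (rule INF_greatest)
  fix vs assume "vs \<in> {vs. vs \<noteq> [] \<and> iterated_derivative vs h 0 \<noteq> 0}"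
  then show "enat k \<le> enat (length vs)" using assms[of vs] by fastforce
qed

lemma le_vanishing_orderD:
  assumes "enat N \<le> vanishing_order h" "vs \<noteq> []" "length vs < N"
  shows "iterated_derivative vs h 0 = 0"
proof (rule ccontr)
  assume "\<not> ?thesis"
  then have "vanishing_order h \<le> enat (length vs)"
    unfolding vanishing_order_def using assms(2) by (intro INF_lower) simp
  then show False using assms(1,3) by (metis enat_ord_simps(1) order_trans not_le)
qed

text \<open>A lower bound for the denominator turns the quotient bound into a lower bound for the
  numerator. An infinite \<open>B\<close> makes the quotient 0, against the strict
  inequality.\<close>

lemma less_ereal_of_enat_divide:
  assumes "ereal (real m) < ereal_of_enat A / ereal_of_enat B" "enat k \<le> B" "1 \<le> k"
  shows "enat (m * k) \<le> A"
proof (cases B)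
  case (enat b)
  show ?thesis
  proof (cases A)
    case (enat a)
    have b: "1 \<le> b" "k \<le> b" using \<open>B = enat b\<close> assms(2,3) by auto
    have "real m < real a / real b" using assms(1) \<open>B = enat b\<close> enat b by simp
    then have "real m * real b < real a" using b by (simp add: field_simps)
    then have "m * b < a" by (metis of_nat_less_iff of_nat_mult)
    moreover have "m * k \<le> m * b" using b by simp
    ultimately have "m * k \<le> a" by linarith
    then show ?thesis using enat by simp
  qed simp
next
  case infinity
  then show ?thesis using assms(1) by simp
qed

text \<open>An infinite supremum yields, for the given \<open>m\<close>, a germ with quotient above
  \<open>m\<close>. After factoring out \<open>t ^ k\<close> the inequality
  \<open>k \<le> vanishing_order z\<close> gives the order \<open>m * k\<close> for
  \<open>r \<circ> z\<close>.\<close>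

lemma infinite_type_curve:
  fixes p :: "complex^'d"
  assumes "local_defining_function \<Gamma> p r" "p \<in> \<Gamma>" "dangelo_type r p = \<infinity>"
  obtains z g k R C where "1 \<le> k" "0 < R" "holomorphic_curve_on g (ball 0 R)" "g 0 \<noteq> 0"
    "\<And>t. t \<in> ball 0 R \<Longrightarrow> z t = p + t ^ k *s g t"
    "\<And>t. t \<in> ball 0 R \<Longrightarrow> \<bar>r (z t)\<bar> \<le> C * cmod t ^ (m * k)"
proof -
  have "ereal (real m) < (SUP z\<in>nonconstant_germs p.
     ereal_of_enat (vanishing_order (r \<circ> z)) / ereal_of_enat (vanishing_order z))"
    using assms(3) unfolding dangelo_type_def by simp
  then obtain z where z: "z \<in> nonconstant_germs p"
    "ereal (real m) < ereal_of_enat (vanishing_order (r \<circ> z)) / ereal_of_enat (vanishing_order z)"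
    unfolding less_SUP_iff by blast
  obtain S where S: "open S" "0 \<in> S" "holomorphic_curve_on z S" "z 0 = p" "\<not> (\<forall>\<^sub>F t in nhds 0. z t = p)"
    using z(1) unfolding nonconstant_germs_def by blast
  obtain R0 where R0: "0 < R0" "ball 0 R0 \<subseteq> S" using S(1,2) open_contains_ball by blast
  have nc: "\<not> z constant_on ball 0 R0"
  proof
    assume "z constant_on ball 0 R0"
    then have "z t = p" if "t \<in> ball 0 R0" for t
      using that R0(1) S(4) unfolding constant_on_def by (metis centre_in_ball)
    then have "\<forall>\<^sub>F t in nhds 0. z t = p"
      unfolding eventually_nhds using R0(1) by (intro exI[of _ "ball 0 R0"]) auto
    then show False using S(5) by blast
  qed
  have zhol: "holomorphic_curve_on z (ball 0 R0)"
    using S(3) R0(2) unfolding holomorphic_curve_on_def using holomorphic_on_subset by blast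
  obtain R k g where R: "0 < R" "R \<le> R0" "1 \<le> k" "holomorphic_curve_on g (ball 0 R)" "g 0 \<noteq> 0"
    "\<And>t. t \<in> ball 0 R \<Longrightarrow> z t = z 0 + t ^ k *s g t"
    using holomorphic_curve_factor[OF zhol R0(1) nc] by metis
  have "enat k \<le> vanishing_order z"
    by (rule le_vanishing_orderI) (rule iterated_derivative_power_factor[OF R(1,4,6)])
  then have N: "enat (m * k) \<le> vanishing_order (r \<circ> z)"
    using less_ereal_of_enat_divide[OF z(2) _ R(3)] by blast
  obtain U where U: "open U" "p \<in> U" "smooth_on U r" "\<Gamma> \<inter> U = {x\<in>U. r x = 0}"
    using assms(1) unfolding local_defining_function_def by blast
  have rp: "r p = 0" using U(2,4) assms(2) by blast
  have zR: "differentiable_of_order j (ball 0 R0) z" for j by (rule holomorphic_curve_smooth[OF open_ball zhol])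
  have "continuous_on (ball 0 R0) z"
    using zR[of 1] by (auto intro!: differentiable_imp_continuous_on differentiable_at_imp_differentiable_on)
  then have oT: "open (ball 0 R0 \<inter> z -` U)" using U(1) open_ball by (metis continuous_on_open_vimage inf_commute)
  \<comment> \<open>Here the curve stays inside \<open>U\<close>, where \<open>r\<close> is
    smooth.\<close>
  define T where "T = ball 0 R0 \<inter> z -` U"
  have zT: "differentiable_of_order j T z" for j
    by (rule holomorphic_curve_smooth)
      (use oT zhol in \<open>auto simp: T_def holomorphic_curve_on_def intro: holomorphic_on_subset\<close>)
  have "\<exists>C \<delta>. 0 < \<delta> \<and> ball 0 \<delta> \<subseteq> T \<and> (\<forall>t\<in>ball 0 \<delta>. \<bar>(r \<circ> z) t\<bar> \<le> C * cmod t ^ (m * k))"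
  proof (rule vanishing_derivatives_bound)
    show "open T" using oT by (simp add: T_def)
    show "0 \<in> T" using R0(1) S(4) U(2) by (simp add: T_def)
    show "differentiable_of_order (Suc (m * k)) T (r \<circ> z)"
      unfolding o_def
      by (rule differentiable_of_order_compose[OF \<open>open T\<close> _ smooth_on_imp_differentiable_of_order[OF U(3)] zT])
        (simp add: T_def)
    \<comment> \<open>\<open>vanishing_order\<close> speaks of derivatives of order at least 1;
      order 0 is the value \<open>r p = 0\<close>.\<close>
    show "iterated_derivative vs (r \<circ> z) 0 = 0" if "length vs < m * k" for vs
      using le_vanishing_orderD[OF N _ that] rp S(4) by (cases "vs = []") auto
  qed
  then obtain C \<delta> where C: "0 < \<delta>" "\<forall>t\<in>ball 0 \<delta>. \<bar>(r \<circ> z) t\<bar> \<le> C * cmod t ^ (m * k)" by blast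
  show ?thesis
  proof (rule that[of k "min R \<delta>" g z C])
    show "holomorphic_curve_on g (ball 0 (min R \<delta>))"
      using R(4) unfolding holomorphic_curve_on_def by (metis holomorphic_on_subset min.cobounded1 subset_ball)
    show "z t = p + t ^ k *s g t" if "t \<in> ball 0 (min R \<delta>)" for t using R(6)[of t] S(4) that by simp
    show "\<bar>r (z t)\<bar> \<le> C * cmod t ^ (m * k)" if "t \<in> ball 0 (min R \<delta>)" for t
      using C(2)[THEN bspec, of t] that by simp
  qed (use R C(1) in auto)
qed

section \<open>Contact of complex lines with the boundary\<close>

lemma closure_shift_in:
  fixes \<Omega> :: "'a::euclidean_space set"
  assumes "open \<Omega>" "convex \<Omega>" "y \<in> closure \<Omega>" "y + \<nu> \<in> \<Omega>" "0 < s" "s \<le> 1"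
  shows "y + s *\<^sub>R \<nu> \<in> \<Omega>"
  using mem_interior_closure_convex_shrink[OF assms(2), of "y + \<nu>" y s] assms
  by (simp add: interior_open)

lemma sign_change_zero:
  fixes f :: "real \<Rightarrow> real"
  assumes "continuous_on {a..b} f" "a \<le> b" "f a * f b < 0"
  obtains x where "a < x" "x < b" "f x = 0"
proof -
  have "(f a < 0 \<and> 0 < f b) \<or> (0 < f a \<and> f b < 0)" using assms(3) by (auto simp: mult_less_0_iff)
  then obtain x where x: "a \<le> x" "x \<le> b" "f x = 0"
    using IVT'[of f a 0 b] IVT2'[of f b 0 a] assms(1,2) by fastforce
  have "x \<noteq> a" "x \<noteq> b" using x(3) assms(3) by auto
  then have "a < x" "x < b" using x(1,2) by simp_all
  then show ?thesis using that x(3) by blast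
qed

lemma has_field_derivative_along_line:
  fixes r :: "'a::real_normed_vector \<Rightarrow> real"
  assumes "(r has_derivative D) (at (x + s *\<^sub>R v))"
  shows "((\<lambda>s. r (x + s *\<^sub>R v)) has_field_derivative D v) (at s)"
proof -
  have "((\<lambda>s. x + s *\<^sub>R v) has_derivative (\<lambda>h. h *\<^sub>R v)) (at s)"
    by (auto intro!: derivative_eq_intros)
  from has_derivative_compose[OF this assms]
  have "((\<lambda>s. r (x + s *\<^sub>R v)) has_derivative (\<lambda>h. D (h *\<^sub>R v))) (at s)" .
  moreover have "D (h *\<^sub>R v) = D v * h" for h
    using linear_scale[OF has_derivative_linear[OF assms], of h v] by simp
  ultimately show ?thesis by (simp add: has_field_derivative_def)
qed

text \<open>If the derivative along \<nu> vanished, a small \<open>w\<close> with non-zero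
  derivative would give \<open>r\<close> opposite signs at
  \<open>p + e *\<^sub>R (\<nu> + w)\<close> and \<open>p + e *\<^sub>R (\<nu> - w)\<close>. The
  whole segment between them lies in \<open>\<Omega>\<close>, so \<open>r\<close> would vanish at a
  point of \<open>\<Omega>\<close>, which would then be a boundary point.\<close>

lemma defining_function_transversal:
  fixes \<Omega> :: "(complex^'d) set"
  assumes \<Omega>: "open \<Omega>" "convex \<Omega>" and p: "p \<in> frontier \<Omega>" and \<nu>: "p + \<nu> \<in> \<Omega>"
    and U: "open U" "p \<in> U" "frontier \<Omega> \<inter> U = {x\<in>U. r x = 0}"
    and r: "\<And>x. x \<in> U \<Longrightarrow> (r has_derivative D x) (at x)" and D: "D p \<noteq> (\<lambda>v. 0)"
  shows "D p \<nu> \<noteq> (0::real)"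
proof
  assume D0: "D p \<nu> = 0"
  have lin: "linear (D p)" using has_derivative_linear[OF r[OF U(2)]] .
  obtain u where u: "D p u \<noteq> 0" using D by blast
  obtain d where d: "0 < d" "\<And>s. \<bar>s\<bar> < d \<Longrightarrow> (p + \<nu>) + s *\<^sub>R u \<in> \<Omega>"
    using open_contains_small_multiple[OF \<Omega>(1) \<nu>] by metis
  define w where "w = (d / 2) *\<^sub>R u"
  have w: "p + \<nu> + t *\<^sub>R w \<in> \<Omega>" if "\<bar>t\<bar> \<le> 1" for t
  proof -
    have "\<bar>t\<bar> * (d / 2) \<le> 1 * (d / 2)" using that d(1) by (intro mult_right_mono) auto
    then have "\<bar>t * (d / 2)\<bar> < d" using d(1) by (simp add: abs_mult)
    from d(2)[OF this] show ?thesis by (simp add: w_def)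
  qed
  have pc: "p \<in> closure \<Omega>" using p by (simp add: frontier_def)
  have inside: "p + e *\<^sub>R (\<nu> + t *\<^sub>R w) \<in> \<Omega>" if "\<bar>t\<bar> \<le> 1" "0 < e" "e \<le> 1" for t e
    by (rule closure_shift_in[OF \<Omega> pc]) (use w[OF that(1)] that in \<open>auto simp: add.assoc\<close>)
  define f where "f t e = r (p + e *\<^sub>R (\<nu> + t *\<^sub>R w))" for t e
  have f0: "f t 0 = 0" for t using U(2,3) p by (auto simp: f_def)
  have fd: "(f t has_field_derivative t * (d / 2) * D p u) (at 0)" for t
  proof -
    have eq: "D p (\<nu> + t *\<^sub>R w) = t * (d / 2) * D p u"
      by (simp add: linear_add[OF lin] linear_scale[OF lin] D0 w_def)
    show ?thesis
      unfolding f_def[abs_def] eq[symmetric]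
      by (rule has_field_derivative_along_line) (simp add: r[OF U(2)])
  qed
  obtain d1 where d1: "0 < d1" "\<And>h. 0 < h \<Longrightarrow> h < d1 \<Longrightarrow> f 1 h * f (-1) h < 0"
  proof (cases "0 < D p u")
    case True
    have "\<exists>d1>0. \<forall>h>0. h < d1 \<longrightarrow> f 1 0 < f 1 (0 + h)"
      by (rule DERIV_pos_inc_right[OF fd]) (use True d(1) in simp)
    moreover have "\<exists>d1>0. \<forall>h>0. h < d1 \<longrightarrow> f (-1) (0 + h) < f (-1) 0"
      by (rule DERIV_neg_dec_right[OF fd]) (use True d(1) in simp)
    ultimately obtain a b where "0 < a" "0 < b" "\<forall>h>0. h < a \<longrightarrow> f 1 0 < f 1 (0 + h)"
      "\<forall>h>0. h < b \<longrightarrow> f (-1) (0 + h) < f (-1) 0" by blast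
    then show ?thesis by (intro that[of "min a b"]) (auto simp: f0 mult_pos_neg)
  next
    case False
    then have False': "D p u < 0" using u by simp
    have "\<exists>d1>0. \<forall>h>0. h < d1 \<longrightarrow> f 1 (0 + h) < f 1 0"
      by (rule DERIV_neg_dec_right[OF fd]) (use False' d(1) in \<open>simp add: mult_pos_neg\<close>)
    moreover have "\<exists>d1>0. \<forall>h>0. h < d1 \<longrightarrow> f (-1) 0 < f (-1) (0 + h)"
      by (rule DERIV_pos_inc_right[OF fd]) (use False' d(1) in \<open>simp add: mult_pos_neg\<close>)
    ultimately obtain a b where "0 < a" "0 < b" "\<forall>h>0. h < a \<longrightarrow> f 1 (0 + h) < f 1 0"
      "\<forall>h>0. h < b \<longrightarrow> f (-1) 0 < f (-1) (0 + h)" by blast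
    then show ?thesis by (intro that[of "min a b"]) (auto simp: f0 mult_neg_pos)
  qed
  obtain R where R: "0 < R" "ball p R \<subseteq> U" using U(1,2) open_contains_ball by blast
  \<comment> \<open>Small enough for the sign change and for the whole segment to stay in the ball
    inside \<open>U\<close>.\<close>
  define e where "e = min (d1 / 2) (min 1 (R / (2 * (1 + norm \<nu> + norm w))))"
  have pos: "0 < 1 + norm \<nu> + norm w" by (simp add: add_pos_nonneg)
  have e: "0 < e" "e < d1" "e \<le> 1" "e * (1 + norm \<nu> + norm w) < R"
  proof -
    have "0 < R / (2 * (1 + norm \<nu> + norm w))" using R(1) pos by (intro divide_pos_pos) auto
    then show "0 < e" "e < d1" "e \<le> 1" unfolding e_def using d1(1) by linarith+
    have "e \<le> R / (2 * (1 + norm \<nu> + norm w))" by (simp add: e_def)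
    then have "e * (2 * (1 + norm \<nu> + norm w)) \<le> R" using pos by (simp add: pos_le_divide_eq del: distrib_left)
    moreover have "0 < e * (1 + norm \<nu> + norm w)" using \<open>0 < e\<close> pos by simp
    ultimately show "e * (1 + norm \<nu> + norm w) < R" by (simp only: mult.left_commute[of e 2])
  qed
  have inU: "p + e *\<^sub>R (\<nu> + t *\<^sub>R w) \<in> U" if "\<bar>t\<bar> \<le> 1" for t
  proof -
    have "norm (\<nu> + t *\<^sub>R w) \<le> norm \<nu> + \<bar>t\<bar> * norm w" using norm_triangle_ineq[of \<nu> "t *\<^sub>R w"] by simp
    also have "\<dots> \<le> 1 + norm \<nu> + norm w" using mult_right_mono[OF that, of "norm w"] by simp
    finally have "e * norm (\<nu> + t *\<^sub>R w) \<le> e * (1 + norm \<nu> + norm w)" using e(1) by (intro mult_left_mono) auto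
    moreover have "norm (e *\<^sub>R (\<nu> + t *\<^sub>R w)) = e * norm (\<nu> + t *\<^sub>R w)" using e(1) by simp
    ultimately have "norm (e *\<^sub>R (\<nu> + t *\<^sub>R w)) < R" using e(4) by linarith
    then have "p + e *\<^sub>R (\<nu> + t *\<^sub>R w) \<in> ball p R" by (simp only: mem_ball dist_norm) simp
    then show ?thesis using R(2) by blast
  qed
  have cont: "continuous_on {-1..1} (\<lambda>t. f t e)"
    unfolding f_def
  proof (rule continuous_on_compose2[of U r])
    show "continuous_on U r" using r by (meson continuous_at_imp_continuous_on has_derivative_continuous)
    show "(\<lambda>t. p + e *\<^sub>R (\<nu> + t *\<^sub>R w)) ` {-1..1} \<subseteq> U" using inU by auto
  qed (intro continuous_intros)
  have neg: "f (-1) e * f 1 e < 0" using d1(2)[OF e(1,2)] by (simp add: mult.commute)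
  obtain t where t: "-1 < t" "t < 1" "f t e = 0"
    by (rule sign_change_zero[OF cont _ neg]) auto
  have "p + e *\<^sub>R (\<nu> + t *\<^sub>R w) \<in> U" using inU[of t] t by simp
  moreover have "r (p + e *\<^sub>R (\<nu> + t *\<^sub>R w)) = 0" using t(3) by (simp only: f_def)
  ultimately have "p + e *\<^sub>R (\<nu> + t *\<^sub>R w) \<in> frontier \<Omega> \<inter> U" unfolding U(3) by simp
  then have "p + e *\<^sub>R (\<nu> + t *\<^sub>R w) \<in> frontier \<Omega>" by blast
  moreover have "p + e *\<^sub>R (\<nu> + t *\<^sub>R w) \<in> \<Omega>" using inside[of t e] t e by auto
  ultimately show False using \<Omega>(1) by (simp add: frontier_def interior_open)
qed

text \<open>Along \<nu> the function \<open>r\<close> is strictly monotone with slope at least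
  \<open>c\<close>, so \<open>\<bar>r x\<bar> < c * s\<close> forces a zero at some parameter
  between \<open>-s\<close> and \<open>s\<close>. From that boundary point the remaining shift in
  direction \<nu> leads into \<open>\<Omega>\<close>. The point \<open>x\<close> may lie on either
  side of the boundary.\<close>

lemma defining_function_depth:
  fixes \<Omega> :: "(complex^'d) set"
  assumes \<Omega>: "open \<Omega>" "convex \<Omega>" and p: "p \<in> frontier \<Omega>" and \<nu>: "p + \<nu> \<in> \<Omega>"
    and ldf: "local_defining_function (frontier \<Omega>) p r"
  obtains \<kappa> \<eta> where "0 < \<kappa>" "0 < \<eta>"
    "\<And>x s. x \<in> ball p \<eta> \<Longrightarrow> \<kappa> * \<bar>r x\<bar> < s \<Longrightarrow> s < \<eta> \<Longrightarrow> x + s *\<^sub>R \<nu> \<in> \<Omega>"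
proof -
  obtain U where U: "open U" "p \<in> U" "smooth_on U r" "frontier \<Omega> \<inter> U = {x\<in>U. r x = 0}"
    "\<And>x. x \<in> U \<Longrightarrow> frechet_derivative r (at x) \<noteq> (\<lambda>v. 0)"
    using ldf unfolding local_defining_function_def by blast
  define D where "D x = frechet_derivative r (at x)" for x
  have r: "(r has_derivative D x) (at x)" if "x \<in> U" for x
    using U(3)[unfolded smooth_on_def, rule_format, of x "[]"] that
    by (simp add: D_def frechet_derivative_works)
  have Dd: "(\<lambda>x. D x \<nu>) differentiable (at p)"
    using U(3)[unfolded smooth_on_def, rule_format, of p "[\<nu>]"] U(2) by (simp add: D_def)
  have "D p \<noteq> (\<lambda>v. 0)" unfolding D_def by (rule U(5)[OF U(2)])
  then have Dp: "D p \<nu> \<noteq> 0" using defining_function_transversal[where D = D, OF \<Omega> p \<nu> U(1,2,4) r] by blast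
  \<comment> \<open>\<sigma> orients \<open>r\<close> so that it increases along \<nu>; its sign on
    the two sides of the boundary is not prescribed.\<close>
  define \<sigma> where "\<sigma> = sgn (D p \<nu>)"
  have \<sigma>: "\<sigma> * D p \<nu> = \<bar>D p \<nu>\<bar>" "\<bar>\<sigma>\<bar> = 1" using Dp by (auto simp: \<sigma>_def sgn_if)
  define c where "c = \<bar>D p \<nu>\<bar> / 2"
  have c: "0 < c" using Dp by (simp add: c_def)
  have "isCont (\<lambda>x. D x \<nu>) p" using differentiable_imp_continuous_within[OF Dd] by simp
  then obtain \<eta>1 where \<eta>1: "0 < \<eta>1" "\<And>x. dist x p < \<eta>1 \<Longrightarrow> \<bar>D x \<nu> - D p \<nu>\<bar> < c"
    unfolding continuous_at_eps_delta using c by (metis dist_real_def)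
  obtain R where R: "0 < R" "ball p R \<subseteq> U" using U(1,2) open_contains_ball by blast
  obtain R' where R': "0 < R'" "ball (p + \<nu>) R' \<subseteq> \<Omega>" using \<Omega>(1) \<nu> open_contains_ball by blast
  define m where "m = min (min \<eta>1 R) (min R' 1)"
  \<comment> \<open>The factor \<open>1 + norm \<nu>\<close> keeps the segment around
    \<open>x\<close> within \<open>m\<close> of \<open>p\<close>, and \<open>m \<le> 1\<close>
    yields \<open>2 * \<eta> \<le> 1\<close>, so the final shift \<open>s - t\<close> is at most
    1.\<close>
  define \<eta> where "\<eta> = m / (2 * (1 + norm \<nu>))"
  have m: "0 < m" "m \<le> \<eta>1" "m \<le> R" "m \<le> R'" "m \<le> 1" using \<eta>1(1) R(1) R'(1) by (auto simp: m_def)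
  have pos: "0 < 1 + norm \<nu>" by (simp add: add_pos_nonneg)
  have \<eta>: "0 < \<eta>" "\<eta> * (1 + norm \<nu>) = m / 2" using m(1) pos by (auto simp: \<eta>_def field_simps)
  have "\<eta> * 1 \<le> \<eta> * (1 + norm \<nu>)" using \<eta>(1) by (intro mult_left_mono) auto
  then have \<eta>2: "2 * \<eta> \<le> 1" using \<eta>(2) m(5) by linarith
  have near: "dist (x + s *\<^sub>R \<nu>) p < m" if "x \<in> ball p \<eta>" "\<bar>s\<bar> < \<eta>" for x s
  proof -
    have "norm (x + s *\<^sub>R \<nu> - p) \<le> norm (x - p) + \<bar>s\<bar> * norm \<nu>"
      using norm_triangle_ineq[of "x - p" "s *\<^sub>R \<nu>"] by (simp add: algebra_simps)
    also have "\<dots> \<le> \<eta> + \<eta> * norm \<nu>"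
      using that by (intro add_mono mult_right_mono) (auto simp: dist_norm norm_minus_commute)
    also have "\<dots> = \<eta> * (1 + norm \<nu>)" by (simp add: algebra_simps)
    finally show ?thesis using \<eta>(2) m(1) by (simp add: dist_norm)
  qed
  show ?thesis
  proof (rule that[of "1 / c" \<eta>])
    show "0 < 1 / c" "0 < \<eta>" using c \<eta>(1) by auto
    fix x s assume x: "x \<in> ball p \<eta>" and s: "1 / c * \<bar>r x\<bar> < s" "s < \<eta>"
    have "0 \<le> 1 / c * \<bar>r x\<bar>" using c by simp
    then have s0: "0 < s" using s(1) by linarith
    have rx: "\<bar>r x\<bar> < c * s" using s(1) c by (simp add: field_simps)
    define f where "f t = \<sigma> * r (x + t *\<^sub>R \<nu>)" for t
    have inU: "x + t *\<^sub>R \<nu> \<in> U" if "\<bar>t\<bar> \<le> s" for t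
      using near[OF x, of t] that s(2) m(3) R(2) by (auto simp: subset_iff dist_commute)
    have fd: "(f has_field_derivative \<sigma> * D (x + t *\<^sub>R \<nu>) \<nu>) (at t)" if "\<bar>t\<bar> \<le> s" for t
      unfolding f_def[abs_def]
      by (intro DERIV_cmult has_field_derivative_along_line r inU that)
    have fd_ge: "c \<le> \<sigma> * D (x + t *\<^sub>R \<nu>) \<nu>" if "\<bar>t\<bar> \<le> s" for t
    proof -
      have "dist (x + t *\<^sub>R \<nu>) p < \<eta>1" using near[OF x, of t] that s(2) m(2) by linarith
      then have *: "\<bar>D (x + t *\<^sub>R \<nu>) \<nu> - D p \<nu>\<bar> < c" by (rule \<eta>1(2))
      have "\<bar>\<sigma> * (D (x + t *\<^sub>R \<nu>) \<nu> - D p \<nu>)\<bar> < c" using * \<sigma>(2) by (simp add: abs_mult)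
      then have "\<sigma> * D p \<nu> - c < \<sigma> * D (x + t *\<^sub>R \<nu>) \<nu>" by (simp add: right_diff_distrib abs_less_iff)
      then show ?thesis using \<sigma>(1) by (simp add: c_def)
    qed
    have f0: "\<bar>f 0\<bar> = \<bar>r x\<bar>" using \<sigma>(2) by (simp add: f_def abs_mult)
    have "\<exists>z>0. z < s \<and> f s - f 0 = (s - 0) * (\<sigma> * D (x + z *\<^sub>R \<nu>) \<nu>)"
      by (rule MVT2[OF s0]) (auto intro: fd)
    then obtain z where z: "0 < z" "z < s" "f s - f 0 = s * (\<sigma> * D (x + z *\<^sub>R \<nu>) \<nu>)" by auto
    have "s * c \<le> s * (\<sigma> * D (x + z *\<^sub>R \<nu>) \<nu>)" using fd_ge[of z] z s0 by (intro mult_left_mono) auto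
    then have fs: "0 < f s" using z(3) f0 rx by (simp add: mult.commute[of s c])
    have "\<exists>z>-s. z < 0 \<and> f 0 - f (-s) = (0 - (-s)) * (\<sigma> * D (x + z *\<^sub>R \<nu>) \<nu>)"
      by (rule MVT2) (use s0 in \<open>auto intro: fd\<close>)
    then obtain z' where z': "-s < z'" "z' < 0" "f 0 - f (-s) = s * (\<sigma> * D (x + z' *\<^sub>R \<nu>) \<nu>)" by auto
    have "s * c \<le> s * (\<sigma> * D (x + z' *\<^sub>R \<nu>) \<nu>)" using fd_ge[of z'] z' s0 by (intro mult_left_mono) auto
    then have fms: "f (-s) < 0" using z'(3) f0 rx by (simp add: mult.commute[of s c])
    have cont: "continuous_on {-s..s} f"
      by (intro continuous_at_imp_continuous_on ballI DERIV_isCont[OF fd]) auto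
    have neg: "f (-s) * f s < 0" using fs fms by (simp add: mult_neg_pos)
    obtain t where t: "-s < t" "t < s" "f t = 0"
      by (rule sign_change_zero[OF cont _ neg]) (use s0 in auto)
    define y where "y = x + t *\<^sub>R \<nu>"
    have "r y = 0" using t(3) \<sigma>(2) by (auto simp: f_def y_def)
    moreover have "y \<in> U" using inU[of t] t by (simp add: y_def)
    ultimately have "y \<in> frontier \<Omega> \<inter> U" unfolding U(4) by simp
    then have yc: "y \<in> closure \<Omega>" by (simp add: frontier_def)
    have "\<bar>t\<bar> < \<eta>" using t s(2) by linarith
    then have "dist y p < R'" using near[OF x, of t] m(4) by (simp add: y_def)
    then have "y + \<nu> \<in> \<Omega>" using R'(2) by (auto simp: subset_iff dist_norm norm_minus_commute)
    then have "y + (s - t) *\<^sub>R \<nu> \<in> \<Omega>"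
      using t s(2) \<eta>2 by (intro closure_shift_in[OF \<Omega> yc]) auto
    then show "x + s *\<^sub>R \<nu> \<in> \<Omega>" by (simp add: y_def algebra_simps)
  qed
qed

section \<open>From discs to contact orders\<close>

lemma exists_shift_radius:
  fixes \<Omega> :: "(complex^'d) set"
  assumes "open \<Omega>" "convex \<Omega>" "p + \<nu> \<in> \<Omega>"
  obtains \<eta> where "0 < \<eta>"
    "\<And>y s. y \<in> closure \<Omega> \<Longrightarrow> norm (y - p) < \<eta> \<Longrightarrow> 0 < s \<Longrightarrow> s \<le> 1 \<Longrightarrow> y + s *\<^sub>R \<nu> \<in> \<Omega>"
proof -
  obtain \<eta> where \<eta>: "0 < \<eta>" "ball (p + \<nu>) \<eta> \<subseteq> \<Omega>" using assms(1,3) open_contains_ball by blast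
  show ?thesis
  proof (rule that[OF \<eta>(1)])
    fix y :: "complex^'d" and s :: real
    assume y: "y \<in> closure \<Omega>" "norm (y - p) < \<eta>" and s: "0 < s" "s \<le> 1"
    have "y + \<nu> \<in> ball (p + \<nu>) \<eta>" using y(2) by (simp add: dist_norm norm_minus_commute)
    then show "y + s *\<^sub>R \<nu> \<in> \<Omega>" using \<eta>(2) closure_shift_in[OF assms(1,2) y(1) _ s] by blast
  qed
qed

lemma norm_smult: "norm (c *s (v :: complex^'d)) = cmod c * norm v"
proof -
  have "norm (c *s v) = L2_set (\<lambda>i. cmod c * norm (v $ i)) UNIV"
    unfolding norm_vec_def by (simp add: norm_mult)
  also have "\<dots> = cmod c * norm v" unfolding norm_vec_def by (simp add: L2_set_right_distrib)
  finally show ?thesis .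
qed

text \<open>The height \<open>e\<close> is spent in two halves: one reaches a disc in the closure,
  with \<open>C * R ^ m = e / 2\<close>, the other moves that disc from the closure into
  \<open>\<Omega>\<close>.\<close>

lemma contact_order_geI_discs:
  fixes \<Omega> :: "(complex^'d) set"
  assumes \<Omega>: "open \<Omega>" "convex \<Omega>" and \<nu>: "p + \<nu> \<in> \<Omega>" and m: "1 \<le> m" and C: "0 < C" "0 < R0"
    and disc: "\<And>R \<zeta>. 0 < R \<Longrightarrow> R < R0 \<Longrightarrow> cmod \<zeta> \<le> R \<Longrightarrow> p + (C * R ^ m) *\<^sub>R \<nu> + \<zeta> *s a \<in> closure \<Omega>"
  shows "contact_order_ge \<Omega> p \<nu> m a"
proof -
  obtain \<eta> where \<eta>: "0 < \<eta>"
    "\<And>y s. y \<in> closure \<Omega> \<Longrightarrow> norm (y - p) < \<eta> \<Longrightarrow> 0 < s \<Longrightarrow> s \<le> 1 \<Longrightarrow> y + s *\<^sub>R \<nu> \<in> \<Omega>"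
    using exists_shift_radius[OF \<Omega> \<nu>] by metis
  define R1 where "R1 = min R0 (\<eta> / (2 * (1 + norm a)))"
  have na: "0 < 1 + norm a" by (simp add: add_pos_nonneg)
  have R1: "0 < R1" "R1 \<le> R0" using C(2) \<eta>(1) na by (auto simp: R1_def)
  have "R1 \<le> \<eta> / (2 * (1 + norm a))" by (simp add: R1_def)
  also have "\<dots> = (\<eta> / 2) / (1 + norm a)" by simp
  finally have R1a: "R1 * (1 + norm a) \<le> \<eta> / 2" using na by (simp only: pos_le_divide_eq)
  define e0 where "e0 = min (2 * C * R1 ^ m) (min 1 (\<eta> / (1 + norm \<nu>)))"
  have n\<nu>: "0 < 1 + norm \<nu>" by (simp add: add_pos_nonneg)
  have e0: "0 < e0" using C R1(1) \<eta>(1) n\<nu> by (simp add: e0_def)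
  have main: "p + e *\<^sub>R \<nu> + \<zeta> *s a \<in> \<Omega>" if e: "0 < e" "e < e0" and \<zeta>: "cmod \<zeta> ^ m \<le> 1 / (2 * C) * e" for e \<zeta>
  proof -
    have "0 < e / (2 * C)" using e(1) C(1) by simp
    then obtain R where R: "0 < R" "R ^ m = e / (2 * C)" using realpow_pos_nth[of m "e / (2 * C)"] m by auto
    have "R ^ m < R1 ^ m" using e(2) C(1) unfolding R(2) by (simp add: e0_def field_simps)
    then have RR1: "R < R1" using R1(1) by (meson less_imp_le power_less_imp_less_base)
    have "cmod \<zeta> ^ m \<le> R ^ m" using \<zeta> unfolding R(2) by simp
    then have \<zeta>R: "cmod \<zeta> \<le> R" using R(1) m by (simp add: power_mono_iff)
    have CR: "C * R ^ m = e / 2" using R(2) C(1) by simp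
    define y where "y = p + (e / 2) *\<^sub>R \<nu> + \<zeta> *s a"
    have "y \<in> closure \<Omega>" using disc[OF R(1) _ \<zeta>R] RR1 R1(2) unfolding CR y_def by simp
    moreover have "norm (y - p) < \<eta>"
    proof -
      have "norm (y - p) \<le> e / 2 * norm \<nu> + cmod \<zeta> * norm a"
        using norm_triangle_ineq[of "(e / 2) *\<^sub>R \<nu>" "\<zeta> *s a"] e(1) by (simp add: y_def norm_smult)
      also have "e / 2 * norm \<nu> < \<eta> / 2"
      proof -
        have "e < \<eta> / (1 + norm \<nu>)" using e(2) by (simp add: e0_def)
        then have "e * (1 + norm \<nu>) < \<eta>" using n\<nu> by (simp only: pos_less_divide_eq)
        then show ?thesis using e(1) by (simp add: algebra_simps)
      qed
      also have "cmod \<zeta> * norm a \<le> \<eta> / 2"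
      proof -
        have "cmod \<zeta> * norm a \<le> R1 * (1 + norm a)" using \<zeta>R RR1 R1(1) by (intro mult_mono) auto
        then show ?thesis using R1a by linarith
      qed
      finally show ?thesis by simp
    qed
    ultimately have "y + (e / 2) *\<^sub>R \<nu> \<in> \<Omega>"
      using e by (intro \<eta>(2)) (auto simp: e0_def)
    moreover have "y + (e / 2) *\<^sub>R \<nu> = p + (e / 2 + e / 2) *\<^sub>R \<nu> + \<zeta> *s a"
      unfolding y_def scaleR_left_distrib by (simp add: algebra_simps)
    ultimately show ?thesis by simp
  qed
  show ?thesis unfolding contact_order_ge_def
    using main e0 C(1) by (intro exI[of _ "1 / (2 * C)"] exI[of _ e0] conjI) auto
qed

text \<open>Raising the curve by a multiple of \<open>\<rho> ^ (m * k)\<close> along \<nu> puts its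
  circle of radius \<rho> into \<open>\<Omega>\<close>. The averaged disc has radius
  \<open>\<rho> ^ k / 2\<close>, so the height is its \<open>m\<close>-th power up to a constant.
  The direction found may depend on \<open>m\<close>.\<close>

lemma infinite_type_contact:
  fixes \<Omega> :: "(complex^'d) set"
  assumes \<Omega>: "open \<Omega>" "convex \<Omega>" and p: "p \<in> frontier \<Omega>" and \<nu>: "p + \<nu> \<in> \<Omega>"
    and inf: "infinite_type (frontier \<Omega>) p" and m: "1 \<le> m"
  obtains a where "a \<noteq> 0" "contact_order_ge \<Omega> p \<nu> m a"
proof -
  obtain r where r: "local_defining_function (frontier \<Omega>) p r" "dangelo_type r p = \<infinity>"
    using inf unfolding infinite_type_def by blast
  obtain z g k R C where z: "1 \<le> k" "0 < R" "holomorphic_curve_on g (ball 0 R)" "g 0 \<noteq> 0"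
    "\<And>t. t \<in> ball 0 R \<Longrightarrow> z t = p + t ^ k *s g t"
    "\<And>t. t \<in> ball 0 R \<Longrightarrow> \<bar>r (z t)\<bar> \<le> C * cmod t ^ (m * k)"
    using infinite_type_curve[OF r(1) p r(2)] by metis
  obtain \<kappa> \<eta> where \<kappa>: "0 < \<kappa>" "0 < \<eta>"
    "\<And>x s. x \<in> ball p \<eta> \<Longrightarrow> \<kappa> * \<bar>r x\<bar> < s \<Longrightarrow> s < \<eta> \<Longrightarrow> x + s *\<^sub>R \<nu> \<in> \<Omega>"
    using defining_function_depth[OF \<Omega> p \<nu> r(1)] by metis
  \<comment> \<open>The added 1 makes the height strictly larger than the depth bound, whatever the
    sign of \<open>C\<close>.\<close>
  define C' where "C' = \<kappa> * \<bar>C\<bar> + 1"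
  have C': "0 < C'" using \<kappa>(1) by (simp add: C'_def add_nonneg_pos)
  have zhol: "holomorphic_curve_on z (ball 0 R)"
    unfolding holomorphic_curve_on_def
  proof
    fix i
    have "(\<lambda>t. p $ i + t ^ k * g t $ i) holomorphic_on ball 0 R"
      using z(3) unfolding holomorphic_curve_on_def by (intro holomorphic_intros) auto
    then show "(\<lambda>t. z t $ i) holomorphic_on ball 0 R"
      by (rule holomorphic_transform) (simp add: z(5))
  qed
  have z0: "z 0 = p" using z(1,2) z(5)[of 0] by (simp add: power_0_left)
  have "isCont z 0"
    using has_derivative_continuous[OF holomorphic_curve_has_derivative[OF zhol open_ball, of 0]] z(2) by simp
  then obtain d where d: "0 < d" "\<And>t. cmod t < d \<Longrightarrow> z t \<in> ball p \<eta>"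
    unfolding continuous_at_eps_delta using \<kappa>(2) by (metis diff_zero dist_commute dist_norm mem_ball z0)
  define \<rho>0 where "\<rho>0 = min (min d R) (min 1 (\<eta> / C'))"
  have \<rho>0: "0 < \<rho>0" "\<rho>0 \<le> d" "\<rho>0 \<le> R" "\<rho>0 \<le> 1" "\<rho>0 \<le> \<eta> / C'" using d(1) z(2) \<kappa>(2) C' by (auto simp: \<rho>0_def)
  have mk: "1 \<le> m * k" using m z(1) by simp
  have disc: "p + (C' * \<rho> ^ (m * k)) *\<^sub>R \<nu> + (c * of_real (\<rho> ^ k / 2)) *s g 0 \<in> closure \<Omega>"
    if \<rho>: "0 < \<rho>" "\<rho> < \<rho>0" and c: "cmod c \<le> 1" for \<rho> c
  proof -
    let ?s = "C' * \<rho> ^ (m * k)"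
    have "\<rho> ^ (m * k) \<le> \<rho> ^ 1" using \<rho> \<rho>0(4) mk by (intro power_decreasing) auto
    then have "?s \<le> C' * \<rho>" using C' by simp
    also have "\<dots> < C' * (\<eta> / C')" using \<rho>(2) \<rho>0(5) C' by (intro mult_strict_left_mono) auto
    finally have s\<eta>: "?s < \<eta>" using C' by simp
    have circ: "z t + ?s *\<^sub>R \<nu> \<in> closure \<Omega>" if t: "cmod t = \<rho>" for t
    proof -
      have tR: "t \<in> ball 0 R" using t \<rho> \<rho>0 by simp
      have "\<kappa> * \<bar>r (z t)\<bar> \<le> \<kappa> * (\<bar>C\<bar> * \<rho> ^ (m * k))"
      proof (intro mult_left_mono)
        have "C * \<rho> ^ (m * k) \<le> \<bar>C\<bar> * \<rho> ^ (m * k)" using \<rho>(1) by (intro mult_right_mono) auto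
        then show "\<bar>r (z t)\<bar> \<le> \<bar>C\<bar> * \<rho> ^ (m * k)" using z(6)[OF tR] t by simp
      qed (use \<kappa>(1) in simp)
      also have "\<dots> < ?s" using \<rho>(1) by (simp add: C'_def algebra_simps)
      finally have "z t + ?s *\<^sub>R \<nu> \<in> \<Omega>"
        using d(2)[of t] t \<rho> \<rho>0 s\<eta> by (intro \<kappa>(3)) auto
      then show ?thesis using closure_subset by blast
    qed
    have hol': "holomorphic_curve_on (\<lambda>t. z t + ?s *\<^sub>R \<nu>) (ball 0 R)"
      using zhol unfolding holomorphic_curve_on_def by (auto intro!: holomorphic_intros)
    have "(p + ?s *\<^sub>R \<nu>) + (c * of_real (\<rho> ^ k / 2)) *s g 0 \<in> closure \<Omega>"
    proof (rule averaged_disc_in_convex[OF closed_closure convex_closure[OF \<Omega>(2)] hol' z(3) \<rho>(1) _ z(1) _ circ c])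
      show "\<rho> < R" using \<rho>(2) \<rho>0(3) by linarith
      show "z t + ?s *\<^sub>R \<nu> = (p + ?s *\<^sub>R \<nu>) + t ^ k *s g t" if "t \<in> ball 0 R" for t
        using z(5)[OF that] by simp
    qed
    then show ?thesis by simp
  qed
  have "contact_order_ge \<Omega> p \<nu> m (g 0)"
  proof (rule contact_order_geI_discs[OF \<Omega> \<nu> m, of "C' * 2 ^ m" "\<rho>0 ^ k / 2"])
    \<comment> \<open>The factor \<open>2 ^ m\<close> comes from the radius:
      \<open>S = \<rho> ^ k / 2\<close> means \<open>\<rho> ^ (m * k) = (2 * S) ^ m\<close>.\<close>
    show "0 < C' * 2 ^ m" "0 < \<rho>0 ^ k / 2" using C' \<rho>0(1) by auto
    fix S :: real and \<zeta> :: complex assume S: "0 < S" "S < \<rho>0 ^ k / 2" "cmod \<zeta> \<le> S"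
    obtain \<rho> where \<rho>: "0 < \<rho>" "\<rho> ^ k = 2 * S" using realpow_pos_nth[of k "2 * S"] z(1) S(1) by auto
    have "\<rho> ^ k < \<rho>0 ^ k" using S(2) \<rho>(2) by simp
    then have "\<rho> < \<rho>0" using \<rho>0(1) by (meson less_imp_le power_less_imp_less_base)
    moreover have "cmod (\<zeta> / of_real S) \<le> 1" using S by (simp add: norm_divide)
    ultimately have "p + (C' * \<rho> ^ (m * k)) *\<^sub>R \<nu> + (\<zeta> / of_real S * of_real (\<rho> ^ k / 2)) *s g 0 \<in> closure \<Omega>"
      using disc \<rho>(1) by blast
    moreover have "\<rho> ^ (m * k) = 2 ^ m * S ^ m"
      using \<rho>(2) by (metis mult.commute power_mult power_mult_distrib)
    moreover have "\<zeta> / of_real S * of_real (\<rho> ^ k / 2) = \<zeta>" using S(1) \<rho>(2) by simp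
    ultimately show "p + (C' * 2 ^ m * S ^ m) *\<^sub>R \<nu> + \<zeta> *s g 0 \<in> closure \<Omega>" by (simp add: mult.assoc)
  qed
  then show ?thesis using that z(4) by blast
qed

text \<open>The averaged disc already lies in the closure without being raised. Any positive height
  moves it into \<open>\<Omega>\<close>, so one and the same direction has contact of every
  order.\<close>

lemma boundary_curve_contact:
  fixes \<Omega> :: "(complex^'d) set"
  assumes \<Omega>: "open \<Omega>" "convex \<Omega>" and f: "holomorphic_curve_on f (ball 0 1)" "\<not> f constant_on ball 0 1"
    "f ` ball 0 1 \<subseteq> frontier \<Omega>" and \<nu>: "f 0 + \<nu> \<in> \<Omega>"
  obtains a where "a \<noteq> 0" "\<And>m. 1 \<le> m \<Longrightarrow> contact_order_ge \<Omega> (f 0) \<nu> m a"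
proof -
  obtain R k g where R: "0 < R" "R \<le> 1" "1 \<le> k" "holomorphic_curve_on g (ball 0 R)" "g 0 \<noteq> 0"
    "\<And>t. t \<in> ball 0 R \<Longrightarrow> f t = f 0 + t ^ k *s g t"
    using holomorphic_curve_factor[OF f(1) zero_less_one f(2)] by metis
  define \<rho> where "\<rho> = R / 2"
  have \<rho>: "0 < \<rho>" "\<rho> < R" using R(1) by (auto simp: \<rho>_def)
  have fhol: "holomorphic_curve_on f (ball 0 R)"
    using f(1) R(2) unfolding holomorphic_curve_on_def by (metis holomorphic_on_subset subset_ball)
  have circ: "f t \<in> closure \<Omega>" if "cmod t = \<rho>" for t
    using f(3) that \<rho> R(2) by (auto simp: frontier_def image_subset_iff)
  have disc: "f 0 + \<zeta> *s g 0 \<in> closure \<Omega>" if "cmod \<zeta> \<le> \<rho> ^ k / 2" for \<zeta>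
  proof -
    have le: "cmod (\<zeta> / of_real (\<rho> ^ k / 2)) \<le> 1" using that \<rho>(1) by (simp add: norm_divide norm_power)
    have "f 0 + (\<zeta> / of_real (\<rho> ^ k / 2) * of_real (\<rho> ^ k / 2)) *s g 0 \<in> closure \<Omega>"
      by (rule averaged_disc_in_convex[OF closed_closure convex_closure[OF \<Omega>(2)] fhol R(4) \<rho> R(3,6) circ le])
    then show ?thesis using \<rho>(1) by simp
  qed
  obtain \<eta> where \<eta>: "0 < \<eta>"
    "\<And>y s. y \<in> closure \<Omega> \<Longrightarrow> norm (y - f 0) < \<eta> \<Longrightarrow> 0 < s \<Longrightarrow> s \<le> 1 \<Longrightarrow> y + s *\<^sub>R \<nu> \<in> \<Omega>"
    using exists_shift_radius[OF \<Omega> \<nu>] by metis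
  have na: "0 < 1 + norm (g 0)" by (simp add: add_pos_nonneg)
  define R0 where "R0 = min 1 (min (\<rho> ^ k / 2) (\<eta> / (2 * (1 + norm (g 0)))))"
  have "0 < R0" using \<rho>(1) \<eta>(1) na by (simp add: R0_def)
  moreover have "R0 \<le> \<rho> ^ k / 2" "R0 \<le> 1" unfolding R0_def by linarith+
  ultimately have R0: "0 < R0" "R0 \<le> \<rho> ^ k / 2" "R0 \<le> 1" by blast+
  have "R0 \<le> \<eta> / (2 * (1 + norm (g 0)))" by (simp add: R0_def)
  also have "\<dots> = (\<eta> / 2) / (1 + norm (g 0))" by simp
  finally have R0a: "R0 * (1 + norm (g 0)) \<le> \<eta> / 2" using na by (simp only: pos_le_divide_eq)
  have "contact_order_ge \<Omega> (f 0) \<nu> m (g 0)" if m: "1 \<le> m" for m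
  proof (rule contact_order_geI_discs[OF \<Omega> \<nu> m zero_less_one R0(1)])
    fix S :: real and \<zeta> :: complex assume S: "0 < S" "S < R0" "cmod \<zeta> \<le> S"
    have "norm (\<zeta> *s g 0) < \<eta>"
    proof -
      have "cmod \<zeta> * norm (g 0) \<le> R0 * (1 + norm (g 0))" using S by (intro mult_mono) auto
      then show ?thesis using R0a \<eta>(1) by (simp add: norm_smult)
    qed
    moreover have "S ^ m \<le> 1" using S(1,2) R0(3) by (simp add: power_le_one)
    ultimately have "f 0 + \<zeta> *s g 0 + (S ^ m) *\<^sub>R \<nu> \<in> \<Omega>"
      using S R0 by (intro \<eta>(2) disc) auto
    moreover have "f 0 + \<zeta> *s g 0 + (S ^ m) *\<^sub>R \<nu> = f 0 + (1 * S ^ m) *\<^sub>R \<nu> + \<zeta> *s g 0" by (simp add: algebra_simps)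
    ultimately show "f 0 + (1 * S ^ m) *\<^sub>R \<nu> + \<zeta> *s g 0 \<in> closure \<Omega>" using closure_subset by fastforce
  qed
  then show ?thesis using that R(5) by blast
qed

section \<open>The linear structure of contact directions\<close>

lemma contact_order_ge_zero:
  assumes "convex \<Omega>" "open \<Omega>" "p \<in> closure \<Omega>" "p + \<nu> \<in> \<Omega>"
  shows "contact_order_ge \<Omega> p \<nu> m 0"
  unfolding contact_order_ge_def
  using closure_shift_in[OF assms(2,1,3,4)] by (intro exI[of _ 1] conjI) auto

lemma contact_order_ge_scaleR:
  assumes "contact_order_ge \<Omega> p \<nu> m a" "r \<noteq> 0"
  shows "contact_order_ge \<Omega> p \<nu> m (r *\<^sub>R a)"
proof -
  obtain c e0 where c: "0 < c" "0 < e0" "\<And>e \<zeta>. 0 < e \<Longrightarrow> e < e0 \<Longrightarrow> cmod \<zeta> ^ m \<le> c * e \<Longrightarrow> p + e *\<^sub>R \<nu> + \<zeta> *s a \<in> \<Omega>"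
    using assms(1) unfolding contact_order_ge_def by blast
  have "p + e *\<^sub>R \<nu> + \<zeta> *s (r *\<^sub>R a) \<in> \<Omega>" if e: "0 < e" "e < e0" and \<zeta>: "cmod \<zeta> ^ m \<le> (c / \<bar>r\<bar> ^ m) * e" for e \<zeta>
  proof -
    have "cmod (\<zeta> * of_real r) ^ m = cmod \<zeta> ^ m * \<bar>r\<bar> ^ m" by (simp add: norm_mult power_mult_distrib)
    also have "\<dots> \<le> ((c / \<bar>r\<bar> ^ m) * e) * \<bar>r\<bar> ^ m" by (intro mult_right_mono \<zeta>) auto
    also have "\<dots> = c * e" using assms(2) by simp
    finally have "p + e *\<^sub>R \<nu> + (\<zeta> * of_real r) *s a \<in> \<Omega>" by (rule c(3)[OF e])
    then show ?thesis by (simp add: complex_scaleR_eq[symmetric] vector_smult_assoc)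
  qed
  then show ?thesis unfolding contact_order_ge_def using c(1,2) assms(2)
    by (intro exI[of _ "c / \<bar>r\<bar> ^ m"] exI[of _ e0] conjI) auto
qed

text \<open>The point in direction \<open>a + b\<close> is the midpoint of points at
  \<open>2 * \<zeta>\<close> in the two directions; the doubling costs \<open>2 ^ m\<close> in the
  constant.\<close>

lemma contact_order_ge_add:
  assumes "convex \<Omega>" "contact_order_ge \<Omega> p \<nu> m a" "contact_order_ge \<Omega> p \<nu> m b"
  shows "contact_order_ge \<Omega> p \<nu> m (a + b)"
proof -
  obtain c e0 where c: "0 < c" "0 < e0" "\<And>e \<zeta>. 0 < e \<Longrightarrow> e < e0 \<Longrightarrow> cmod \<zeta> ^ m \<le> c * e \<Longrightarrow> p + e *\<^sub>R \<nu> + \<zeta> *s a \<in> \<Omega>"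
    using assms(2) unfolding contact_order_ge_def by blast
  obtain d e1 where d: "0 < d" "0 < e1" "\<And>e \<zeta>. 0 < e \<Longrightarrow> e < e1 \<Longrightarrow> cmod \<zeta> ^ m \<le> d * e \<Longrightarrow> p + e *\<^sub>R \<nu> + \<zeta> *s b \<in> \<Omega>"
    using assms(3) unfolding contact_order_ge_def by blast
  have "p + e *\<^sub>R \<nu> + \<zeta> *s (a + b) \<in> \<Omega>"
    if e: "0 < e" "e < min e0 e1" and \<zeta>: "cmod \<zeta> ^ m \<le> (min c d / 2 ^ m) * e" for e \<zeta>
  proof -
    have "cmod (2 * \<zeta>) ^ m = 2 ^ m * cmod \<zeta> ^ m" by (simp add: norm_mult power_mult_distrib)
    also have "\<dots> \<le> 2 ^ m * ((min c d / 2 ^ m) * e)" by (intro mult_left_mono \<zeta>) auto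
    also have "\<dots> = min c d * e" by simp
    finally have *: "cmod (2 * \<zeta>) ^ m \<le> min c d * e" .
    have "min c d * e \<le> c * e" "min c d * e \<le> d * e" using e(1) by (auto intro: mult_right_mono)
    then have "p + e *\<^sub>R \<nu> + (2 * \<zeta>) *s a \<in> \<Omega>" "p + e *\<^sub>R \<nu> + (2 * \<zeta>) *s b \<in> \<Omega>"
      using c(3)[OF e(1) _ order_trans[OF *]] d(3)[OF e(1) _ order_trans[OF *]] e(2) by simp_all
    then have "(1/2) *\<^sub>R (p + e *\<^sub>R \<nu> + (2 * \<zeta>) *s a) + (1/2) *\<^sub>R (p + e *\<^sub>R \<nu> + (2 * \<zeta>) *s b) \<in> \<Omega>"
      by (intro convexD[OF assms(1)]) auto
    moreover have "(1/2) *\<^sub>R (p + e *\<^sub>R \<nu> + (2 * \<zeta>) *s a) + (1/2) *\<^sub>R (p + e *\<^sub>R \<nu> + (2 * \<zeta>) *s b)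
        = p + e *\<^sub>R \<nu> + \<zeta> *s (a + b)"
      by (simp add: vec_eq_iff) (simp add: scaleR_conv_of_real algebra_simps)
    ultimately show ?thesis by simp
  qed
  then show ?thesis unfolding contact_order_ge_def using c(1,2) d(1,2)
    by (intro exI[of _ "min c d / 2 ^ m"] exI[of _ "min e0 e1"] conjI) auto
qed

text \<open>Heights below \<open>1 / c\<close> force \<open>cmod \<zeta> < 1\<close>, where raising
  the exponent decreases the power.\<close>

lemma contact_order_ge_Suc:
  assumes "contact_order_ge \<Omega> p \<nu> (Suc m) a" "1 \<le> m"
  shows "contact_order_ge \<Omega> p \<nu> m a"
proof -
  obtain c e0 where c: "0 < c" "0 < e0" "\<And>e \<zeta>. 0 < e \<Longrightarrow> e < e0 \<Longrightarrow> cmod \<zeta> ^ Suc m \<le> c * e \<Longrightarrow> p + e *\<^sub>R \<nu> + \<zeta> *s a \<in> \<Omega>"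
    using assms(1) unfolding contact_order_ge_def by blast
  have "p + e *\<^sub>R \<nu> + \<zeta> *s a \<in> \<Omega>"
    if e: "0 < e" "e < min e0 (1 / c)" and \<zeta>: "cmod \<zeta> ^ m \<le> c * e" for e \<zeta>
  proof -
    have "c * e < 1" using e c(1) by (simp add: field_simps)
    then have "cmod \<zeta> ^ m < 1 ^ m" using \<zeta> by simp
    then have "cmod \<zeta> < 1" by (meson power_less_imp_less_base zero_le_one)
    then have "cmod \<zeta> ^ Suc m \<le> cmod \<zeta> ^ m" by (intro power_decreasing) auto
    then show ?thesis using c(3)[of e \<zeta>] e \<zeta> by simp
  qed
  then show ?thesis unfolding contact_order_ge_def using c(1,2)
    by (intro exI[of _ c] exI[of _ "min e0 (1 / c)"] conjI) auto
qed

text \<open>A member of least dimension in the decreasing chain equals all later ones, so its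
  non-zero vectors serve every order. The index is shifted by one because the orders start at
  1.\<close>

lemma infinite_contact_direction:
  fixes \<Omega> :: "(complex^'d) set"
  assumes \<Omega>: "convex \<Omega>" "open \<Omega>" "p \<in> closure \<Omega>" "p + \<nu> \<in> \<Omega>"
    and ex: "\<And>m. 1 \<le> m \<Longrightarrow> \<exists>a. a \<noteq> 0 \<and> contact_order_ge \<Omega> p \<nu> m a"
  obtains a where "a \<noteq> 0" "\<And>m. 1 \<le> m \<Longrightarrow> contact_order_ge \<Omega> p \<nu> m a"
proof -
  define L where "L m = {a. contact_order_ge \<Omega> p \<nu> (Suc m) a}" for m
  have sub: "subspace (L m)" for m
    unfolding subspace_def
  proof (intro conjI ballI allI)
    show "0 \<in> L m" using contact_order_ge_zero[OF \<Omega>] by (simp add: L_def)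
    show "x + y \<in> L m" if "x \<in> L m" "y \<in> L m" for x y
      using contact_order_ge_add[OF \<Omega>(1)] that by (simp add: L_def)
    show "c *\<^sub>R x \<in> L m" if "x \<in> L m" for c x
      using contact_order_ge_scaleR[of \<Omega> p \<nu> "Suc m" x c] contact_order_ge_zero[OF \<Omega>] that
      by (cases "c = 0") (auto simp: L_def)
  qed
  have "L (Suc m) \<subseteq> L m" for m
    using contact_order_ge_Suc[of \<Omega> p \<nu> "Suc m"] by (auto simp: L_def)
  then have dec: "L n \<subseteq> L m" if "m \<le> n" for m n using that lift_Suc_antimono_le[of L] by simp
  obtain m where m: "\<And>n. dim (L m) \<le> dim (L n)"
    using ex_has_least_nat[of "\<lambda>_. True" 0 "\<lambda>m. dim (L m)"] by auto
  have eq: "L n = L m" if "m \<le> n" for n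
    using subspace_dim_equal[OF sub sub dec[OF that]] m by simp
  obtain a where a: "a \<noteq> 0" "a \<in> L m" using ex[of "Suc m"] by (auto simp: L_def)
  have "contact_order_ge \<Omega> p \<nu> n a" if n: "1 \<le> n" for n
  proof -
    have "a \<in> L (max m (n - 1))" using a(2) eq[of "max m (n - 1)"] by simp
    then have "a \<in> L (n - 1)" using dec[of "n - 1" "max m (n - 1)"] by auto
    then show ?thesis using n by (simp add: L_def)
  qed
  then show ?thesis using that a(1) by blast
qed

section \<open>The product limit\<close>

lemma independent_pairI:
  fixes v w :: "complex^'d"
  assumes "\<And>s t. s *s v + t *s w = 0 \<Longrightarrow> s = 0 \<and> t = 0"
  shows "vec.independent {v, w}" "v \<noteq> w"
proof -
  show ne: "v \<noteq> w" using assms[of 1 "-1"] by auto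
  have "w \<noteq> 0" using assms[of 0 1] by auto
  moreover have "v \<notin> vec.span {w}"
  proof
    assume "v \<in> vec.span {w}"
    then obtain k where "v = k *s w" unfolding vec.span_singleton by blast
    then show False using assms[of 1 "-k"] by simp
  qed
  ultimately show "vec.independent {v, w}" using ne by (simp add: vec.independent_insert)
qed

lemma sublinear_less_one_segment:
  assumes "sublinear N" "N x < 1" "N y \<le> 1" "0 \<le> s" "s < 1"
  shows "N ((1 - s) *\<^sub>R x + s *\<^sub>R y) < 1"
proof -
  have "N ((1 - s) *\<^sub>R x + s *\<^sub>R y) \<le> (1 - s) * N x + s * N y"
    using sublinear_add[OF assms(1), of "(1 - s) *\<^sub>R x" "s *\<^sub>R y"] assms(4,5)
    by (simp add: sublinear_scaleR[OF assms(1)])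
  moreover have "(1 - s) * N x < (1 - s) * 1" using assms(2,5) by (intro mult_strict_left_mono) auto
  moreover have "s * N y \<le> s * 1" using assms(3,4) by (intro mult_left_mono) auto
  ultimately have "N ((1 - s) *\<^sub>R x + s *\<^sub>R y) < (1 - s) * 1 + s * 1"
    by (meson add_less_le_mono order_le_less_trans)
  then show ?thesis by simp
qed

section \<open>Bounds in the rescaled plane and the limit\<close>

context infinite_contact
begin

text \<open>The complex linear functional whose real part supports \<open>\<Omega>\<close> at
  \<open>p\<close>. Positivity is strict because the open set allows a small step against
  \<open>b\<close>.\<close>

lemma supporting_functional:
  obtains l :: "complex^'d \<Rightarrow> complex" where "\<And>x y. l (x + y) = l x + l y" "\<And>c x. l (c *s x) = c * l x"
    "\<And>x. x \<in> \<Omega> \<Longrightarrow> 0 < Re (l (x - p))"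
proof -
  obtain b c where b: "b \<noteq> 0" "b \<bullet> p \<le> c" "\<And>x. x \<in> \<Omega> \<Longrightarrow> c \<le> b \<bullet> x"
    using separating_hyperplane_sets[of "{p}" \<Omega>] convex_dom p(2) \<nu> by auto
  show ?thesis
  proof (rule that[of "\<lambda>x. \<Sum>i\<in>UNIV. cnj (b $ i) * x $ i"])
    show "(\<Sum>i\<in>UNIV. cnj (b $ i) * (x + y) $ i) = (\<Sum>i\<in>UNIV. cnj (b $ i) * x $ i) + (\<Sum>i\<in>UNIV. cnj (b $ i) * y $ i)" for x y
      by (simp add: distrib_left sum.distrib)
    show "(\<Sum>i\<in>UNIV. cnj (b $ i) * (c *s x) $ i) = c * (\<Sum>i\<in>UNIV. cnj (b $ i) * x $ i)" for c x
      by (simp add: sum_distrib_left mult_ac)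
    fix x assume x: "x \<in> \<Omega>"
    obtain e where e: "0 < e" "\<And>s. \<bar>s\<bar> < e \<Longrightarrow> x + s *\<^sub>R b \<in> \<Omega>"
      using open_contains_small_multiple[OF open_dom x] by metis
    have "x + (- (e / 2)) *\<^sub>R b \<in> \<Omega>" by (rule e(2)) (use e(1) in simp)
    then have "c \<le> b \<bullet> (x + (- (e / 2)) *\<^sub>R b)" by (rule b(3))
    moreover have "0 < e / 2 * (b \<bullet> b)" using e(1) b(1) by simp
    ultimately have "b \<bullet> p < b \<bullet> x" using b(2) by (simp add: inner_add_right inner_diff_right)
    then show "0 < Re (\<Sum>i\<in>UNIV. cnj (b $ i) * (x - p) $ i)"
      by (simp only: inner_complex_vec[symmetric]) (simp add: inner_diff_right)
  qed
qed

text \<open>Contact of order 2 already makes \<open>a\<close> complex tangential: a disc with radius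
  of order the square root of \<open>e\<close> contains points where a non-zero \<open>l a\<close>
  outweighs the positive contribution, of order \<open>e\<close>, of the height.\<close>

lemma functional_vanishes:
  assumes l: "\<And>x y. l (x + y) = l x + l y" "\<And>c x. l (c *s x) = c * l x" "\<And>x. x \<in> \<Omega> \<Longrightarrow> 0 < Re (l (x - p))"
  shows "l a = 0"
proof (rule ccontr)
  assume la: "l a \<noteq> 0"
  have lR: "l (r *\<^sub>R x) = of_real r * l x" for r x by (simp add: complex_scaleR_eq[symmetric] l(2))
  obtain c e0 where c: "0 < c" "0 < e0"
    "\<And>e \<zeta>. 0 < e \<Longrightarrow> e < e0 \<Longrightarrow> cmod \<zeta> ^ 2 \<le> c * e \<Longrightarrow> p + e *\<^sub>R \<nu> + \<zeta> *s a \<in> \<Omega>"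
    using contact[of 2] unfolding contact_order_ge_def by auto
  have pos: "0 < e * Re (l \<nu>) + Re (\<zeta> * l a)" if "0 < e" "e < e0" "cmod \<zeta> ^ 2 \<le> c * e" for e \<zeta>
  proof -
    have "p + e *\<^sub>R \<nu> + \<zeta> *s a - p = e *\<^sub>R \<nu> + \<zeta> *s a" by simp
    then show ?thesis using l(3)[OF c(3)[OF that]] by (simp add: l(1,2) lR)
  qed
  \<comment> \<open>Chosen so that \<zeta> \<open>= - e * k * cnj (l a)\<close> contributes
    \<open>- e * (1 + \<bar>Re (l \<nu>)\<bar>)\<close>, which exceeds the height term in
    modulus.\<close>
  define k where "k = (1 + \<bar>Re (l \<nu>)\<bar>) / (cmod (l a) ^ 2)"
  have k: "0 < k" using la by (simp add: k_def add_pos_nonneg)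
  \<comment> \<open>The second bound ensures \<open>cmod \<zeta> ^ 2 \<le> c * e\<close>, so that
    this \<zeta> lies in the disc.\<close>
  define e where "e = min (e0 / 2) (c / (2 * (k * cmod (l a))\<^sup>2))"
  have ka: "0 < k * cmod (l a)" using k la by simp
  have "0 < c / (2 * (k * cmod (l a))\<^sup>2)" using c(1) ka by (intro divide_pos_pos) auto
  then have e: "0 < e" "e < e0" using c(2) by (auto simp: e_def)
  have "e \<le> c / (2 * (k * cmod (l a))\<^sup>2)" by (simp add: e_def)
  then have "e * (2 * (k * cmod (l a))\<^sup>2) \<le> c" using ka by (simp only: pos_le_divide_eq zero_less_mult_iff zero_less_power zero_less_numeral simp_thms)
  moreover have "e * (2 * (k * cmod (l a))\<^sup>2) = 2 * (e * (k * cmod (l a))\<^sup>2)" by (simp only: mult.left_commute)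
  moreover have "0 \<le> e * (k * cmod (l a))\<^sup>2" using e(1) by simp
  ultimately have "e * (k * cmod (l a))\<^sup>2 \<le> c" by linarith
  then have "e * (e * (k * cmod (l a))\<^sup>2) \<le> e * c" using e(1) by (intro mult_left_mono) auto
  moreover have "cmod (- of_real (e * k) * cnj (l a)) ^ 2 = e * (e * (k * cmod (l a))\<^sup>2)"
    using e(1) k by (simp add: norm_mult power_mult_distrib power2_eq_square)
  ultimately have "cmod (- of_real (e * k) * cnj (l a)) ^ 2 \<le> c * e" by (simp add: mult.commute)
  from pos[OF e this] have "0 < e * Re (l \<nu>) + Re (- of_real (e * k) * cnj (l a) * l a)" .
  moreover have "- of_real (e * k) * cnj (l a) * l a = of_real (- (e * (k * cmod (l a) ^ 2)))"
    using complex_norm_square[of "l a"] by (simp add: mult_ac)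
  moreover have "k * cmod (l a) ^ 2 = 1 + \<bar>Re (l \<nu>)\<bar>" using la by (simp add: k_def)
  ultimately have "0 < e * Re (l \<nu>) + - (e * (1 + \<bar>Re (l \<nu>)\<bar>))" by (simp only: Re_complex_of_real)
  then have "0 < e * (Re (l \<nu>) - (1 + \<bar>Re (l \<nu>)\<bar>))" by (simp add: algebra_simps)
  then show False using e(1) by (simp add: zero_less_mult_iff)
qed

text \<open>The supporting functional annihilates \<open>a\<close> and so sees only
  \<open>s\<close>. It bounds the gauge below on one side, and the four rotations together recover
  the modulus.\<close>

lemma lower_bound_normal:
  assumes e: "0 < e" "e \<le> 1/2"
  shows "cmod s \<le> rotation_sum (G e) (s *s (e *\<^sub>R \<nu>) + t *s a)"
proof -
  obtain l :: "complex^'d \<Rightarrow> complex" where l: "\<And>x y. l (x + y) = l x + l y" "\<And>c x. l (c *s x) = c * l x"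
    "\<And>x. x \<in> \<Omega> \<Longrightarrow> 0 < Re (l (x - p))"
    by (rule supporting_functional) (rule that)
  have la: "l a = 0" by (rule functional_vanishes[OF l])
  have lR: "l (r *\<^sub>R x) = of_real r * l x" for r x by (simp add: complex_scaleR_eq[symmetric] l(2))
  have lmin: "l (- x) = - l x" for x using lR[of "-1" x] by simp
  have l\<nu>: "0 < Re (l \<nu>)" using l(3)[OF \<nu>] by simp
  have Gsub: "sublinear (G e)" using G_sublinear e by simp
  have low: "- Re (l v) / (e * Re (l \<nu>)) \<le> G e v" for v
  proof (rule field_le_epsilon)
    fix d :: real assume d: "0 < d"
    define u where "u = G e v + d"
    have u: "0 < u" "G e v < u" using sublinear_nonneg[OF Gsub, of v] d by (auto simp: u_def)
    then have "p + e *\<^sub>R \<nu> + inverse u *\<^sub>R v \<in> \<Omega>" using G_less_iff[of e u v] e by simp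
    moreover have "p + e *\<^sub>R \<nu> + inverse u *\<^sub>R v - p = e *\<^sub>R \<nu> + inverse u *\<^sub>R v" by simp
    ultimately have "0 < Re (l (e *\<^sub>R \<nu> + inverse u *\<^sub>R v))" using l(3) by metis
    moreover have "Re (l (e *\<^sub>R \<nu> + inverse u *\<^sub>R v)) = e * Re (l \<nu>) + inverse u * Re (l v)"
      unfolding l(1) lR by (simp del: of_real_inverse)
    ultimately have "0 < e * Re (l \<nu>) + inverse u * Re (l v)" by (simp only:)
    then have "- Re (l v) < u * (e * Re (l \<nu>))" using u(1) by (simp add: field_simps)
    moreover have "0 < e * Re (l \<nu>)" using e l\<nu> by simp
    ultimately show "- Re (l v) / (e * Re (l \<nu>)) \<le> G e v + d"
      unfolding u_def[symmetric] by (simp only: pos_divide_le_eq less_imp_le)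
  qed
  define v where "v = s *s (e *\<^sub>R \<nu>) + t *s a"
  define X where "X = l v / (of_real (e * Re (l \<nu>)))"
  have pos: "0 < e * Re (l \<nu>)" using e l\<nu> by simp
  have ReX: "Re X = Re (l v) / (e * Re (l \<nu>))" "Im X = Im (l v) / (e * Re (l \<nu>))"
    unfolding X_def by (simp_all only: Re_divide_of_real Im_divide_of_real)
  have "- Re X \<le> G e v" "Re X \<le> G e (- v)" "Im X \<le> G e (\<i> *s v)" "- Im X \<le> G e (- (\<i> *s v))"
    using low[of v] low[of "- v"] low[of "\<i> *s v"] low[of "- (\<i> *s v)"]
    by (simp_all add: ReX lmin l(2))
  then have "\<bar>Re X\<bar> + \<bar>Im X\<bar> \<le> rotation_sum (G e) v"
    unfolding rotation_sum_def
    using sublinear_nonneg[OF Gsub, of v] sublinear_nonneg[OF Gsub, of "- v"]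
      sublinear_nonneg[OF Gsub, of "\<i> *s v"] sublinear_nonneg[OF Gsub, of "- (\<i> *s v)"]
    by (auto simp: abs_if)
  moreover have "cmod X \<le> \<bar>Re X\<bar> + \<bar>Im X\<bar>" by (rule cmod_le)
  moreover have "cmod s \<le> cmod X"
  proof -
    have "l v = s * (of_real e * l \<nu>)" by (simp add: v_def l(1,2) lR la)
    then have "cmod X = cmod s * (e * cmod (l \<nu>)) / (e * Re (l \<nu>))"
      using e l\<nu> by (simp add: X_def norm_divide norm_mult)
    also have "\<dots> = cmod s * (cmod (l \<nu>) / Re (l \<nu>))" using e by simp
    also have "\<dots> \<ge> cmod s * 1"
      using l\<nu> complex_Re_le_cmod[of "l \<nu>"] by (intro mult_left_mono) (auto simp: pos_le_divide_eq)
    finally show ?thesis by simp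
  qed
  ultimately show ?thesis unfolding v_def by linarith
qed

text \<open>Shrinking towards \<open>p\<close> takes a ball around \<open>p + \<nu>\<close> to a
  ball around \<open>p + e *\<^sub>R \<nu>\<close> with radius proportional to \<open>e\<close>,
  which matches the scale of \<open>e *\<^sub>R \<nu>\<close>.\<close>

lemma upper_bound_normal:
  obtains B where "0 \<le> B" "\<And>e. 0 < e \<Longrightarrow> e \<le> 1/2 \<Longrightarrow> rotation_sum (G e) (e *\<^sub>R \<nu>) \<le> B"
proof -
  obtain \<eta> where \<eta>: "0 < \<eta>" "ball (p + \<nu>) \<eta> \<subseteq> \<Omega>" using open_dom \<nu> open_contains_ball by blast
  have up: "G e (e *\<^sub>R v) \<le> norm v / \<eta>" if e: "0 < e" "e \<le> 1/2" for e v
  proof (rule G_leI)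
    show "0 \<le> norm v / \<eta>" using \<eta>(1) by simp
    fix t assume t: "norm v / \<eta> < t"
    moreover have "0 \<le> norm v / \<eta>" using \<eta>(1) by simp
    ultimately have "0 < t" by linarith
    then have "norm (inverse t *\<^sub>R v) < \<eta>" using t \<eta>(1) by (simp add: field_simps)
    then have "p + \<nu> + inverse t *\<^sub>R v \<in> ball (p + \<nu>) \<eta>" by (simp add: dist_norm)
    then have "p + e *\<^sub>R (\<nu> + inverse t *\<^sub>R v) \<in> \<Omega>" using \<eta>(2) e by (intro cone_in) auto
    then show "p + e *\<^sub>R \<nu> + inverse t *\<^sub>R e *\<^sub>R v \<in> \<Omega>" by (simp add: algebra_simps)
  qed (use e in auto)
  show ?thesis
  proof (rule that[of "4 * (norm \<nu> / \<eta>)"])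
    show "0 \<le> 4 * (norm \<nu> / \<eta>)" using \<eta>(1) by simp
    fix e :: real assume e: "0 < e" "e \<le> 1/2"
    show "rotation_sum (G e) (e *\<^sub>R \<nu>) \<le> 4 * (norm \<nu> / \<eta>)"
      using up[OF e, of \<nu>] up[OF e, of "- \<nu>"] up[OF e, of "\<i> *s \<nu>"] up[OF e, of "- (\<i> *s \<nu>)"]
      by (simp add: rotation_sum_def smult_scaleR_commute norm_smult)
  qed
qed

lemma M_rotation_sum: "0 < e \<Longrightarrow> e \<le> 1/2 \<Longrightarrow> rotation_sum (G e) (inverse (M e) *\<^sub>R a) = 1 / (1 - e)"
proof -
  assume e: "0 < e" "e \<le> 1/2"
  have M: "0 < M e" using M_pos e by simp
  have "rotation_sum (G e) (inverse (M e) *\<^sub>R a) = inverse (M e) * rotation_sum (G e) a"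
    using rotation_sum_scaleR[OF G_sublinear] e M by simp
  also have "\<dots> = 1 / (1 - e)"
  proof -
    have "rotation_sum (G e) a \<noteq> 0" using M by (auto simp: M_def)
    then show ?thesis by (simp add: M_def inverse_eq_divide)
  qed
  finally show ?thesis .
qed

text \<open>The tangential part is the whole vector minus the normal part, whose coefficient is
  already bounded; the rescaled \<open>a\<close> itself has rotation sum at least 1.\<close>

lemma lower_bound_tangential:
  assumes B: "0 \<le> B" "\<And>e. 0 < e \<Longrightarrow> e \<le> 1/2 \<Longrightarrow> rotation_sum (G e) (e *\<^sub>R \<nu>) \<le> B"
    and e: "0 < e" "e \<le> 1/2"
  shows "cmod t \<le> 2 * (1 + 2 * B) * rotation_sum (G e) (s *s (e *\<^sub>R \<nu>) + t *s (inverse (M e) *\<^sub>R a))"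
proof (cases "t = 0")
  case True
  then show ?thesis using B(1) rotation_sum_nonneg[OF G_sublinear] e by simp
next
  case False
  have sub: "sublinear (G e)" using G_sublinear e by simp
  let ?e2 = "inverse (M e) *\<^sub>R a" and ?e1 = "e *\<^sub>R \<nu>"
  let ?v = "s *s ?e1 + t *s ?e2"
  have nn: "0 \<le> rotation_sum (G e) ?v" by (rule rotation_sum_nonneg[OF sub])
  have "?v = s *s ?e1 + (t * of_real (inverse (M e))) *s a"
    by (simp add: complex_scaleR_eq[symmetric] vector_smult_assoc)
  then have s: "cmod s \<le> rotation_sum (G e) ?v" using lower_bound_normal[OF e] by metis
  have "t *s ?e2 = ?v + (- s) *s ?e1" by simp
  then have "rotation_sum (G e) (t *s ?e2) \<le> rotation_sum (G e) ?v + rotation_sum (G e) ((- s) *s ?e1)"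
    using rotation_sum_add[OF sub] by metis
  also have "rotation_sum (G e) ((- s) *s ?e1) \<le> 2 * cmod s * rotation_sum (G e) ?e1"
    using rotation_sum_smult_le[OF sub, of "- s"] by simp
  also have "\<dots> \<le> 2 * rotation_sum (G e) ?v * B"
    using s B(2)[OF e] rotation_sum_nonneg[OF sub] nn by (intro mult_mono) auto
  finally have te: "rotation_sum (G e) (t *s ?e2) \<le> (1 + 2 * B) * rotation_sum (G e) ?v"
    by (simp add: algebra_simps)
  have "1 \<le> rotation_sum (G e) ?e2" using M_rotation_sum[OF e] e by simp
  also have "?e2 = inverse t *s (t *s ?e2)" using False by (simp add: vector_smult_assoc)
  also have "rotation_sum (G e) \<dots> \<le> 2 * cmod (inverse t) * rotation_sum (G e) (t *s ?e2)"
    by (rule rotation_sum_smult_le[OF sub])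
  finally have "cmod t * 1 \<le> cmod t * (2 * cmod (inverse t) * rotation_sum (G e) (t *s ?e2))"
    by (intro mult_left_mono) auto
  also have "\<dots> = 2 * (cmod t * cmod (inverse t)) * rotation_sum (G e) (t *s ?e2)" by (simp only: mult_ac)
  also have "cmod t * cmod (inverse t) = 1" using False by (simp add: norm_inverse)
  finally have "cmod t \<le> 2 * rotation_sum (G e) (t *s ?e2)" by simp
  then have "cmod t \<le> 2 * ((1 + 2 * B) * rotation_sum (G e) ?v)" using te by linarith
  then show ?thesis by (simp only: mult.assoc)
qed

text \<open>The limit gauge inherits two properties on the distinguished plane: conical shape in the
  normal direction, from blowing up at \<open>p\<close>, and equal slices over positive heights,
  from the slow sequence. These are the hypotheses for a product.\<close>

lemma limit_with_product_slice:
  obtains N C and i1 i2 :: 'd where "i1 \<noteq> i2" "sublinear N" "\<And>v. N v \<le> C * norm v"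
    "{v. N v < 1} \<in> affine_limits \<Omega>"
    "\<And>s t. N (axis i1 s + axis i2 t) < 1 \<longleftrightarrow> N (axis i1 s) < 1 \<and> N (axis i2 t) < 1"
proof -
  obtain \<epsilon> where \<epsilon>: "\<And>n. 0 < \<epsilon> n" "\<And>n. \<epsilon> n \<le> 1/2" "\<epsilon> \<longlonglongrightarrow> 0"
    "\<And>s \<zeta>. 0 < s \<Longrightarrow> (\<lambda>n. (g (s * \<epsilon> n) \<zeta> - g (\<epsilon> n) \<zeta>) / M (\<epsilon> n)) \<longlonglongrightarrow> 0"
    by (rule exists_slow_sequence) (rule that)
  obtain B where B: "0 \<le> B" "\<And>e. 0 < e \<Longrightarrow> e \<le> 1/2 \<Longrightarrow> rotation_sum (G e) (e *\<^sub>R \<nu>) \<le> B"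
    by (rule upper_bound_normal) (rule that)
  define e1 where "e1 n = \<epsilon> n *\<^sub>R \<nu>" for n
  define e2 where "e2 n = inverse (M (\<epsilon> n)) *\<^sub>R a" for n
  define z where "z n = p + \<epsilon> n *\<^sub>R \<nu>" for n
  have Gz: "minkowski_functional \<Omega> (z n) = G (\<epsilon> n)" for n by (simp add: G_def z_def)
  have sub: "sublinear (G (\<epsilon> n))" for n using G_sublinear[OF \<epsilon>(1)[of n]] \<epsilon>(2)[of n] by simp
  define k where "k = 2 * (1 + 2 * B)"
  have k: "1 \<le> k" using B(1) by (simp add: k_def)
  have low1: "cmod s \<le> k * rotation_sum (G (\<epsilon> n)) (s *s e1 n + t *s e2 n)" for n s t
  proof -
    have "t *s e2 n = (t * of_real (inverse (M (\<epsilon> n)))) *s a"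
      by (simp add: e2_def complex_scaleR_eq[symmetric] vector_smult_assoc)
    then have "cmod s \<le> rotation_sum (G (\<epsilon> n)) (s *s e1 n + t *s e2 n)"
      using lower_bound_normal[OF \<epsilon>(1,2)] unfolding e1_def by metis
    also have "\<dots> \<le> k * rotation_sum (G (\<epsilon> n)) (s *s e1 n + t *s e2 n)"
      using mult_right_mono[OF k rotation_sum_nonneg[OF sub]] by simp
    finally show ?thesis .
  qed
  have low2: "cmod t \<le> k * rotation_sum (G (\<epsilon> n)) (s *s e1 n + t *s e2 n)" for n s t
    unfolding k_def e1_def e2_def by (rule lower_bound_tangential[OF B \<epsilon>(1,2)])
  have zero: "s = 0 \<and> t = 0" if "s *s e1 n + t *s e2 n = 0" for n s t
    using low1[of s n t] low2[of t n s] unfolding that by (simp add: rotation_sum_def sublinear_zero[OF sub])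
  have ind: "vec.independent {e1 n, e2 n}" "e1 n \<noteq> e2 n" for n
    using independent_pairI[of "e1 n" "e2 n"] zero by blast+
  \<comment> \<open>A tangential direction of infinite contact exists only in complex dimension at
    least 2, which makes the two indices available.\<close>
  have "2 \<le> CARD('d)"
    using vec.independent_card_le_dim[OF subset_UNIV ind(1)[of 0]] ind(2)[of 0] by (simp add: card_cart_basis)
  then obtain i1 i2 :: 'd where i12: "i1 \<noteq> i2"
    using card_le_Suc0_iff_eq[of "UNIV :: 'd set"] by force
  have up: "rotation_sum (G (\<epsilon> n)) (e1 n) \<le> max B 2" "rotation_sum (G (\<epsilon> n)) (e2 n) \<le> max B 2" for n
  proof -
    show "rotation_sum (G (\<epsilon> n)) (e1 n) \<le> max B 2" using B(2)[OF \<epsilon>(1,2), of n] by (simp add: e1_def)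
    have "1 / (1 - \<epsilon> n) \<le> 2" using \<epsilon>(1,2)[of n] by (simp add: field_simps)
    then show "rotation_sum (G (\<epsilon> n)) (e2 n) \<le> max B 2"
      unfolding e2_def M_rotation_sum[OF \<epsilon>(1,2)] by simp
  qed
  have zin: "z n \<in> \<Omega>" for n using base_in[OF \<epsilon>(1)[of n]] \<epsilon>(2)[of n] by (simp add: z_def)
  have "z \<longlonglongrightarrow> p + 0 *\<^sub>R \<nu>" unfolding z_def[abs_def] by (intro tendsto_intros \<epsilon>(3))
  then have zlim: "z \<longlonglongrightarrow> p" by simp
  have k0: "0 \<le> k" using k by simp
  obtain r N C where r: "strict_mono (r :: nat \<Rightarrow> nat)" and N: "sublinear N" "\<And>v. N v \<le> C * norm v"
    "{v. N v < 1} \<in> affine_limits \<Omega>"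
    and lim: "\<And>s t. (\<lambda>n. G (\<epsilon> (r n)) (s *s e1 (r n) + t *s e2 (r n))) \<longlonglongrightarrow> N (axis i1 s + axis i2 t)"
    by (rule affine_limit_extraction[of \<Omega> z p i1 i2 e1 e2 "max B 2" k, unfolded Gz,
        OF dom zin zlim p(2) i12 ind up k0 low1 low2]) (rule that)
  define h where "h n = \<epsilon> (r n)" for n
  have h: "0 < h n" "h n \<le> 1/2" for n using \<epsilon>(1,2) by (auto simp: h_def)
  have hlim: "h \<longlonglongrightarrow> 0" using LIMSEQ_subseq_LIMSEQ[OF \<epsilon>(3) r] by (simp add: h_def[abs_def] o_def)
  define F where "F s t = N (axis i1 s + axis i2 t)" for s t
  have axc: "axis i1 (c *\<^sub>R s) + axis i2 (c *\<^sub>R t) = c *\<^sub>R (axis i1 s + axis i2 t :: complex^'d)" for c s t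
    by (simp add: vec_eq_iff axis_def scaleR_add_right)
  have axa: "axis i1 (s + s') + axis i2 (t + t') = (axis i1 s + axis i2 t) + (axis i1 s' + axis i2 t' :: complex^'d)" for s s' t t'
    by (simp add: vec_eq_iff axis_def)
  have Fscale: "F (c *\<^sub>R s) (c *\<^sub>R t) = c * F s t" if "0 \<le> c" for c s t
    unfolding F_def axc by (rule sublinear_scaleR[OF N(1) that])
  have Fseg: "F ((1 - u) *\<^sub>R s + u *\<^sub>R s') ((1 - u) *\<^sub>R t + u *\<^sub>R t') < 1"
    if "F s t < 1" "F s' t' \<le> 1" "0 \<le> u" "u < 1" for s t s' t' u
    unfolding F_def axa axc using sublinear_less_one_segment[OF N(1)] that unfolding F_def by blast
  \<comment> \<open>The point with heights measured from \<open>p\<close>. The gauge is based at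
    height 1 in these units, hence the shift between \<open>s\<close> and
    \<open>s + 1\<close>.\<close>
  define Q where "Q n w t = p + (w * of_real (h n)) *s \<nu> + (t * of_real (inverse (M (h n)))) *s a" for n w t
  have QG: "G (h n) (s *s e1 (r n) + t *s e2 (r n)) < 1 \<longleftrightarrow> Q n (s + 1) t \<in> \<Omega>" for n s t
  proof -
    have "p + h n *\<^sub>R \<nu> + (s *s e1 (r n) + t *s e2 (r n)) = Q n (s + 1) t"
      by (simp add: Q_def e1_def e2_def h_def[symmetric] complex_scaleR_eq[symmetric] vector_smult_assoc
          distrib_right vector_sadd_rdistrib)
    then show ?thesis using G_less_iff[OF h(1)[of n] _ zero_less_one, of "s *s e1 (r n) + t *s e2 (r n)"] h(2)[of n]
      by (simp add: add.assoc)
  qed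
  have F_lessD: "\<forall>\<^sub>F n in sequentially. Q n (s + 1) t \<in> \<Omega>" if "F s t < 1" for s t
    using order_tendstoD(2)[OF lim that[unfolded F_def]] unfolding h_def[symmetric] QG .
  \<comment> \<open>Pointwise limits lose strictness, so membership along the sequence gives only
    \<open>F \<le> 1\<close>; the strict inequality is regained below by convexity or
    scaling.\<close>
  have F_leI: "F s t \<le> 1" if "\<forall>\<^sub>F n in sequentially. Q n (s + 1) t \<in> \<Omega>" for s t
  proof -
    have "\<forall>\<^sub>F n in sequentially. G (\<epsilon> (r n)) (s *s e1 (r n) + t *s e2 (r n)) \<le> 1"
      using that unfolding QG[symmetric] h_def by (rule eventually_mono) simp
    then show ?thesis unfolding F_def by (intro tendsto_upperbound[OF lim]) auto
  qed
  have F00: "F 0 0 = 0" using Fscale[of 0 0 0] by simp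
  \<comment> \<open>The limit slice, translated so that the apex of the cone sits at first
    coordinate 0.\<close>
  define U where "U = {q. F (fst q - 1) (snd q) < 1}"
  have contF: "continuous_on UNIV (\<lambda>q. F (fst q - 1) (snd q))"
  proof -
    have "continuous_on UNIV (\<lambda>q. axis i1 (fst q - 1) + axis i2 (snd q) :: complex^'d)"
      by (intro continuous_intros bounded_linear.continuous_on[OF bounded_linear_axis])
    then show ?thesis unfolding F_def
      by (intro continuous_on_compose2[OF continuous_on_sublinear[OF N(1,2), of UNIV]]) auto
  qed
  have Uopen: "open U" unfolding U_def by (intro open_Collect_less contF) simp
  have Uconv: "convex U"
  proof (rule convexI)
    fix q q' :: "complex \<times> complex" and u v :: real
    assume q: "q \<in> U" "q' \<in> U" and uv: "0 \<le> u" "0 \<le> v" "u + v = 1"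
    have u: "u = 1 - v" using uv(3) by simp
    show "u *\<^sub>R q + v *\<^sub>R q' \<in> U"
    proof (cases "v = 1")
      case True
      then show ?thesis using q uv by simp
    next
      case False
      then have "v < 1" using uv by simp
      then have "F ((1 - v) *\<^sub>R (fst q - 1) + v *\<^sub>R (fst q' - 1)) ((1 - v) *\<^sub>R snd q + v *\<^sub>R snd q') < 1"
        using q uv by (intro Fseg) (auto simp: U_def)
      moreover have "(1 - v) *\<^sub>R (fst q - 1) + v *\<^sub>R (fst q' - 1) = ((1 - v) *\<^sub>R fst q + v *\<^sub>R fst q') - 1"
        by (simp add: algebra_simps)
      ultimately show ?thesis by (simp add: U_def u)
    qed
  qed
  have U10: "(1, 0) \<in> U" by (simp add: U_def F00)
  \<comment> \<open>One index \<open>m\<close> suffices: the segment from \<open>p\<close> to a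
    point of \<open>\<Omega>\<close> at scale \<open>h m\<close> contains all sufficiently small
    multiples, in particular those at scale \<open>s * h n\<close> for large
    \<open>n\<close>.\<close>
  have cone_le: "F (s *\<^sub>R w - 1) 0 \<le> 1" if w: "(w, 0) \<in> U" and s: "0 < s" for w s
  proof -
    have "F (w - 1) 0 < 1" using w by (simp add: U_def)
    from F_lessD[OF this] obtain m where m: "Q m w 0 \<in> \<Omega>" by (auto simp: eventually_sequentially)
    have "(\<lambda>n. s * h n) \<longlonglongrightarrow> s * 0" by (intro tendsto_intros hlim)
    then have "\<forall>\<^sub>F n in sequentially. s * h n < h m" using h(1)[of m] by (simp add: order_tendstoD(2))
    then have "\<forall>\<^sub>F n in sequentially. Q n (s *\<^sub>R w) 0 \<in> \<Omega>"
    proof (rule eventually_mono)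
      fix n assume n: "s * h n < h m"
      have "p + (s * h n / h m) *\<^sub>R ((w * of_real (h m)) *s \<nu>) \<in> \<Omega>"
        using m n s h(1)[of n] h(1)[of m]
        by (intro closure_shift_in[OF open_dom convex_dom p(1)]) (auto simp: Q_def)
      moreover have "(s * h n / h m) *\<^sub>R ((w * of_real (h m)) *s \<nu>) = (s *\<^sub>R w * of_real (h n)) *s \<nu>"
        using h(1)[of m] by (simp add: complex_scaleR_eq[symmetric] vector_smult_assoc scaleR_conv_of_real)
      ultimately show "Q n (s *\<^sub>R w) 0 \<in> \<Omega>" by (simp add: Q_def)
    qed
    then show ?thesis by (intro F_leI) simp
  qed
  have cone: "(s *\<^sub>R w, 0) \<in> U" if w: "(w, 0) \<in> U" and s: "0 < s" for w s
  proof -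
    have Fw: "F (w - 1) 0 < 1" using w by (simp add: U_def)
    \<comment> \<open>\<open>s\<close> is written as a mixture of 1, where the inequality is strict,
      and some \<open>s'\<close>, where it is only weak, with positive weight on 1.\<close>
    obtain u s' where u: "0 \<le> u" "u < 1" "0 < s'" "(1 - u) + u * s' = s"
    proof (cases "s \<le> 1")
      case True
      define u where "u = (1 - s) / (1 - s / 2)"
      have d: "0 < 1 - s / 2" using True by simp
      have "u * (1 - s / 2) = 1 - s" using d by (simp add: u_def)
      then have "(1 - u) + u * (s / 2) = s" by (simp add: algebra_simps)
      moreover have "0 \<le> u" "u < 1" using True s d by (auto simp: u_def divide_less_eq)
      ultimately show ?thesis using that[of u "s / 2"] s by simp
    next
      case False
      then show ?thesis using that[of "(s - 1) / s" "s + 1"] s by (simp add: field_simps)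
    qed
    have "F ((1 - u) *\<^sub>R (w - 1) + u *\<^sub>R (s' *\<^sub>R w - 1)) ((1 - u) *\<^sub>R 0 + u *\<^sub>R 0) < 1"
      by (rule Fseg[OF Fw cone_le[OF w u(3)] u(1,2)])
    moreover have "(1 - u) *\<^sub>R (w - 1) + u *\<^sub>R (s' *\<^sub>R w - 1) = ((1 - u) + u * s') *\<^sub>R w - 1"
      by (simp add: algebra_simps)
    ultimately show ?thesis using u(4) by (simp add: U_def)
  qed
  \<comment> \<open>The limit does not depend on \<open>s\<close>: between heights
    \<open>h n\<close> and \<open>s * h n\<close> the gauge changes by a vanishing fraction of
    \<open>M (h n)\<close>, and the weights \<open>1 - h n\<close> and \<open>1 - s * h n\<close>
    tend to 1.\<close>
  have slice_lim: "(\<lambda>n. G (s * h n) ((\<zeta> * of_real (inverse (M (h n)))) *s a)) \<longlonglongrightarrow> F 0 \<zeta>"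
    if s: "0 < s" for s \<zeta>
  proof -
    have G_g: "G e ((\<zeta> * of_real (inverse (M (h n)))) *s a) = g e \<zeta> / M (h n) / (1 - e)" if e: "0 < e" "e < 1" for e n
    proof -
      have "0 \<le> inverse (M (h n))" using M_pos[OF h(1)[of n]] h(2)[of n] by simp
      then have "G e (inverse (M (h n)) *\<^sub>R (\<zeta> *s a)) = inverse (M (h n)) * G e (\<zeta> *s a)"
        using sublinear_scaleR[OF G_sublinear] e by simp
      moreover have "(\<zeta> * of_real (inverse (M (h n)))) *s a = inverse (M (h n)) *\<^sub>R (\<zeta> *s a)"
        by (simp add: complex_scaleR_eq[symmetric] vector_smult_assoc mult.commute)
      moreover have "g e \<zeta> / M (h n) / (1 - e) = inverse (M (h n)) * G e (\<zeta> *s a)"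
        using e by (simp add: g_def divide_inverse mult.assoc mult.left_commute)
      ultimately show ?thesis by (simp only:)
    qed
    have "(\<lambda>n. G (h n) ((\<zeta> * of_real (inverse (M (h n)))) *s a)) \<longlonglongrightarrow> F 0 \<zeta>"
      using lim[of 0 \<zeta>] by (simp add: F_def e2_def h_def complex_scaleR_eq[symmetric] vector_smult_assoc)
    then have "(\<lambda>n. g (h n) \<zeta> / M (h n) / (1 - h n)) \<longlonglongrightarrow> F 0 \<zeta>"
      using G_g h by (simp add: order_le_less_trans[OF h(2)])
    then have "(\<lambda>n. (1 - h n) * (g (h n) \<zeta> / M (h n) / (1 - h n))) \<longlonglongrightarrow> (1 - 0) * F 0 \<zeta>"
      by (intro tendsto_intros hlim)
    moreover have "(1 - h n) * (g (h n) \<zeta> / M (h n) / (1 - h n)) = g (h n) \<zeta> / M (h n)" for n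
      using h(2)[of n] by simp
    ultimately have "(\<lambda>n. g (h n) \<zeta> / M (h n)) \<longlonglongrightarrow> F 0 \<zeta>" by simp
    moreover have "(\<lambda>n. (g (s * h n) \<zeta> - g (h n) \<zeta>) / M (h n)) \<longlonglongrightarrow> 0"
      using LIMSEQ_subseq_LIMSEQ[OF \<epsilon>(4)[OF s] r] by (simp add: h_def o_def)
    ultimately have "(\<lambda>n. g (h n) \<zeta> / M (h n) + (g (s * h n) \<zeta> - g (h n) \<zeta>) / M (h n)) \<longlonglongrightarrow> F 0 \<zeta> + 0"
      by (rule tendsto_add)
    then have "(\<lambda>n. g (s * h n) \<zeta> / M (h n)) \<longlonglongrightarrow> F 0 \<zeta>" by (simp add: diff_divide_distrib)
    then have "(\<lambda>n. g (s * h n) \<zeta> / M (h n) / (1 - s * h n)) \<longlonglongrightarrow> F 0 \<zeta> / (1 - s * 0)"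
      by (intro tendsto_intros hlim) simp_all
    moreover have "\<forall>\<^sub>F n in sequentially. g (s * h n) \<zeta> / M (h n) / (1 - s * h n) =
        G (s * h n) ((\<zeta> * of_real (inverse (M (h n)))) *s a)"
    proof -
      have "(\<lambda>n. s * h n) \<longlonglongrightarrow> s * 0" by (intro tendsto_intros hlim)
      then have "\<forall>\<^sub>F n in sequentially. s * h n < 1" by (simp add: order_tendstoD(2))
      then show ?thesis by (rule eventually_mono) (use G_g s h(1) in simp)
    qed
    ultimately show ?thesis using tendsto_cong by fastforce
  qed
  have slice_in: "\<forall>\<^sub>F n in sequentially. Q n (of_real s) \<zeta> \<in> \<Omega> \<longleftrightarrow> G (s * h n) ((\<zeta> * of_real (inverse (M (h n)))) *s a) < 1"
    if s: "0 < s" for s \<zeta>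
  proof -
    have "(\<lambda>n. s * h n) \<longlonglongrightarrow> s * 0" by (intro tendsto_intros hlim)
    then have "\<forall>\<^sub>F n in sequentially. s * h n < 1" by (simp add: order_tendstoD(2))
    then show ?thesis
    proof (rule eventually_mono)
      fix n assume n: "s * h n < 1"
      have "Q n (of_real s) \<zeta> = p + (s * h n) *\<^sub>R \<nu> + (\<zeta> * of_real (inverse (M (h n)))) *s a"
        by (simp add: Q_def complex_scaleR_eq[symmetric])
      then show "Q n (of_real s) \<zeta> \<in> \<Omega> \<longleftrightarrow> G (s * h n) ((\<zeta> * of_real (inverse (M (h n)))) *s a) < 1"
        using G_less_iff[of "s * h n" 1] s h(1)[of n] n by simp
    qed
  qed
  have slice: "(of_real s, \<zeta>) \<in> U \<longleftrightarrow> (1, \<zeta>) \<in> U" if s: "0 < s" for s \<zeta>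
  proof
    assume "(of_real s, \<zeta>) \<in> U"
    then obtain e where e: "0 < e" "\<And>x t. \<bar>x\<bar> < e \<Longrightarrow> \<bar>t\<bar> < e \<Longrightarrow> (of_real s + x *\<^sub>R 1, \<zeta> + t *\<^sub>R \<zeta>) \<in> U"
      using open_pair_small[OF Uopen] by metis
    \<comment> \<open>Openness allows \<zeta> to be enlarged first; homogeneity then turns the weak
      inequality for the enlarged vector into a strict one for \<zeta>.\<close>
    have "(of_real s, (1 + e / 2) *\<^sub>R \<zeta>) \<in> U" using e(1) e(2)[of 0 "e/2"] by (simp add: scaleR_left_distrib)
    then have "\<forall>\<^sub>F n in sequentially. Q n (of_real s) ((1 + e / 2) *\<^sub>R \<zeta>) \<in> \<Omega>"
      using F_lessD[of "of_real s - 1"] by (simp add: U_def)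
    then have "\<forall>\<^sub>F n in sequentially. G (s * h n) (((1 + e / 2) *\<^sub>R \<zeta> * of_real (inverse (M (h n)))) *s a) \<le> 1"
      using slice_in[OF s, of "(1 + e / 2) *\<^sub>R \<zeta>"] by eventually_elim simp
    then have "F 0 ((1 + e / 2) *\<^sub>R \<zeta>) \<le> 1" by (intro tendsto_upperbound[OF slice_lim[OF s]]) auto
    then have "(1 + e / 2) * F 0 \<zeta> \<le> 1" using Fscale[of "1 + e / 2" 0 \<zeta>] e(1) by simp
    moreover have "F 0 \<zeta> < (1 + e / 2) * F 0 \<zeta>" if "1 \<le> F 0 \<zeta>" using e(1) that by simp
    ultimately have "F 0 \<zeta> < 1" by (meson not_le order_less_le_trans order_less_imp_le)
    then show "(1, \<zeta>) \<in> U" by (simp add: U_def)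
  next
    assume "(1, \<zeta>) \<in> U"
    then obtain e where e: "0 < e" "\<And>x t. \<bar>x\<bar> < e \<Longrightarrow> \<bar>t\<bar> < e \<Longrightarrow> (1 + x *\<^sub>R 1, \<zeta> + t *\<^sub>R \<zeta>) \<in> U"
      using open_pair_small[OF Uopen] by metis
    define c where "c = 1 + e / 2"
    have c: "1 < c" using e(1) by (simp add: c_def)
    have "(1, c *\<^sub>R \<zeta>) \<in> U" using e(1) e(2)[of 0 "e/2"] by (simp add: c_def scaleR_left_distrib)
    then have "F 0 (c *\<^sub>R \<zeta>) < 1" by (simp add: U_def)
    from order_tendstoD(2)[OF slice_lim[OF s] this]
    have "\<forall>\<^sub>F n in sequentially. Q n (of_real s - 1 + 1) (c *\<^sub>R \<zeta>) \<in> \<Omega>"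
      using slice_in[OF s, of "c *\<^sub>R \<zeta>"] by eventually_elim simp
    then have le: "F (of_real s - 1) (c *\<^sub>R \<zeta>) \<le> 1" by (rule F_leI)
    have "F (of_real s - 1) 0 < 1" using cone[OF U10 s] by (simp add: U_def scaleR_conv_of_real)
    \<comment> \<open>Mixing with the centre of the slice over \<open>s\<close>, where the
      inequality is strict, brings the enlarged vector back to \<zeta>.\<close>
    from Fseg[OF this le, of "inverse c"]
    have "F ((1 - inverse c) *\<^sub>R (of_real s - 1) + inverse c *\<^sub>R (of_real s - 1)) ((1 - inverse c) *\<^sub>R 0 + inverse c *\<^sub>R c *\<^sub>R \<zeta>) < 1"
      using c by (simp add: inverse_less_1_iff)
    moreover have "(1 - inverse c) *\<^sub>R (complex_of_real s - 1) + inverse c *\<^sub>R (of_real s - 1) = of_real s - 1"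
      by (simp add: scaleR_left_diff_distrib)
    ultimately show "(of_real s, \<zeta>) \<in> U" using c by (simp add: U_def)
  qed
  have F_prod: "F s t < 1 \<longleftrightarrow> F s 0 < 1 \<and> F 0 t < 1" for s t
    using product_of_cone_and_slices[OF Uopen Uconv U10 cone slice, of "s + 1" t] by (simp add: U_def)
  have ax0: "axis i (0::complex) = (0 :: complex^'d)" for i by simp
  have "N (axis i1 s + axis i2 t) < 1 \<longleftrightarrow> N (axis i1 s) < 1 \<and> N (axis i2 t) < 1" for s t
    using F_prod[of s t] by (simp only: F_def ax0 add_0_left add_0_right)
  then show ?thesis by (rule that[OF i12 N])
qed

text \<open>\<open>V\<close> is the coordinate plane of \<open>i1\<close> and \<open>i2\<close>.
  Neither factor is the whole plane, since otherwise a coordinate axis would be a complex line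
  inside the limit, so both are conformally discs.\<close>

lemma bidisk_slice:
  "\<exists>\<Omega>'\<in>affine_limits \<Omega>. \<exists>V. complex_affine_plane 2 V \<and> biholomorphic (V \<inter> \<Omega>') bidisk"
proof -
  obtain N C and i1 i2 :: 'd where i12: "i1 \<noteq> i2" and N: "sublinear N" "\<And>v. N v \<le> C * norm v"
    and al: "{v. N v < 1} \<in> affine_limits \<Omega>"
    and prod: "\<And>s t. N (axis i1 s + axis i2 t) < 1 \<longleftrightarrow> N (axis i1 s) < 1 \<and> N (axis i2 t) < 1"
    by (rule limit_with_product_slice) (rule that)
  have dom': "{v. N v < 1} \<in> convex_domains" using al unfolding affine_limits_def by blast
  have slice: "open {s. N (axis i s) < 1}" "convex {s. N (axis i s) < 1}" "{s. N (axis i s) < 1} \<noteq> {}"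
    "{s. N (axis i s) < 1} \<noteq> UNIV" for i :: 'd
  proof -
    have "continuous_on UNIV (\<lambda>s. N (axis i s))"
      by (rule continuous_on_compose2[OF continuous_on_sublinear[OF N, of UNIV] linear_continuous_on[OF bounded_linear_axis]]) simp
    then show "open {s. N (axis i s) < 1}" by (intro open_Collect_less) auto
    have "{s. N (axis i s) < 1} = axis i -` {v. N v < 1}" by auto
    then show "convex {s. N (axis i s) < 1}"
      using convex_linear_vimage[OF bounded_linear.linear[OF bounded_linear_axis] convex_sublevel_sublinear[OF N(1)]] by metis
    have "axis i 0 = (0 :: complex^'d)" by (simp add: vec_eq_iff axis_def)
    then have "N (axis i 0) = 0" by (simp only: sublinear_zero[OF N(1)])
    then show "{s. N (axis i s) < 1} \<noteq> {}" by (metis (mono_tags) empty_iff mem_Collect_eq zero_less_one)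
    show "{s. N (axis i s) < 1} \<noteq> UNIV"
    proof
      assume *: "{s. N (axis i s) < 1} = UNIV"
      have ax: "c *s axis i (1::complex) = (axis i c :: complex^'d)" for c by (simp add: vec_eq_iff axis_def)
      have "(axis i 1 :: complex^'d) \<noteq> 0" by simp
      from complex_line_plane[OF this, of 0] have "complex_affine_plane 1 (range (\<lambda>c. axis i c :: complex^'d))"
        by (simp add: ax)
      moreover have "range (\<lambda>c. axis i c :: complex^'d) \<subseteq> {v. N v < 1}" using * by auto
      ultimately show False using dom' unfolding convex_domains_def by blast
    qed
  qed
  define V where "V = vec.span {axis i1 1, axis i2 1 :: complex^'d}"
  have ind: "vec.independent {axis i1 1, axis i2 1 :: complex^'d}" "axis i1 1 \<noteq> (axis i2 1 :: complex^'d)"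
  proof -
    have "s = 0 \<and> t = 0" if "s *s axis i1 1 + t *s axis i2 1 = (0 :: complex^'d)" for s t
      using arg_cong[OF that, of "\<lambda>v. v $ i1"] arg_cong[OF that, of "\<lambda>v. v $ i2"] i12
      by (simp add: axis_def)
    then show "vec.independent {axis i1 1, axis i2 1 :: complex^'d}" "axis i1 1 \<noteq> (axis i2 1 :: complex^'d)"
      using independent_pairI by blast+
  qed
  have "complex_affine_plane 2 V"
    unfolding complex_affine_plane_def
  proof (intro exI conjI)
    show "vec.subspace V" by (simp add: V_def)
    show "vec.dim V = 2" using ind by (simp add: V_def vec.dim_eq_card_independent)
    show "V = (+) 0 ` V" by simp
  qed
  moreover have "V \<inter> {v. N v < 1} = {axis i1 s + axis i2 t :: complex^'d | s t. s \<in> {s. N (axis i1 s) < 1} \<and> t \<in> {t. N (axis i2 t) < 1}}"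
  proof -
    have ax: "c *s axis i (1::complex) = (axis i c :: complex^'d)" for c i by (simp add: vec_eq_iff axis_def)
    have "V = {axis i1 s + axis i2 t | s t. True}"
    proof (intro equalityI subsetI)
      fix x assume "x \<in> V"
      then obtain k where "x - k *s axis i1 1 \<in> vec.span {axis i2 1}"
        unfolding V_def vec.span_insert by blast
      then obtain m where "x - k *s axis i1 1 = m *s axis i2 1" unfolding vec.span_singleton by blast
      then have "x = axis i1 k + axis i2 m" unfolding ax by (metis add.commute diff_add_cancel)
      then show "x \<in> {axis i1 s + axis i2 t | s t. True}" by blast
    next
      fix x :: "complex^'d" assume "x \<in> {axis i1 s + axis i2 t | s t. True}"
      then obtain s t where "x = s *s axis i1 1 + t *s axis i2 1" unfolding ax by blast
      moreover have "axis i1 1 \<in> V" "axis i2 1 \<in> V" unfolding V_def by (rule vec.span_base; simp)+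
      ultimately show "x \<in> V" unfolding V_def by (simp only: vec.span_add vec.span_scale)
    qed
    then show ?thesis using prod by auto
  qed
  moreover have "biholomorphic {axis i1 s + axis i2 t :: complex^'d | s t. s \<in> {s. N (axis i1 s) < 1} \<and> t \<in> {t. N (axis i2 t) < 1}} bidisk"
    by (rule biholomorphic_product_bidisk[OF i12 slice slice])
  ultimately show ?thesis using al by metis
qed

end

theorem theorem2p4:
  fixes \<Omega> :: "(complex^'d) set"
  assumes "\<Omega> \<in> convex_domains"
    and "(\<exists>f. holomorphic_curve_on f (ball 0 1) \<and> \<not> f constant_on ball 0 1 \<and>
              f ` ball 0 1 \<subseteq> frontier \<Omega>) \<or>
         (smooth_hypersurface (frontier \<Omega>) \<and> (\<exists>p\<in>frontier \<Omega>. infinite_type (frontier \<Omega>) p))"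
  shows "\<exists>\<Omega>'\<in>affine_limits \<Omega>. \<exists>V. complex_affine_plane 2 V \<and> biholomorphic (V \<inter> \<Omega>') bidisk"
proof -
  have \<Omega>: "open \<Omega>" "convex \<Omega>" "\<Omega> \<noteq> {}" using assms(1) by (auto simp: convex_domains_def)
  then obtain q where q: "q \<in> \<Omega>" by blast
  have "\<exists>p a. p \<in> frontier \<Omega> \<and> a \<noteq> 0 \<and> (\<forall>m\<ge>1. contact_order_ge \<Omega> p (q - p) m a)"
    using assms(2)
  proof (elim disjE exE conjE bexE)
    fix f assume f: "holomorphic_curve_on f (ball 0 1)" "\<not> f constant_on ball 0 1" "f ` ball 0 1 \<subseteq> frontier \<Omega>"
    have "f 0 + (q - f 0) \<in> \<Omega>" using q by simp
    from boundary_curve_contact[OF \<Omega>(1,2) f this] obtain a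
      where "a \<noteq> 0" "\<And>m. 1 \<le> m \<Longrightarrow> contact_order_ge \<Omega> (f 0) (q - f 0) m a" by metis
    moreover have "f 0 \<in> frontier \<Omega>" using f(3) by auto
    ultimately show ?thesis by blast
  next
    fix p assume p: "p \<in> frontier \<Omega>" "infinite_type (frontier \<Omega>) p"
    have pq: "p + (q - p) \<in> \<Omega>" using q by simp
    have "p \<in> closure \<Omega>" using p(1) by (simp add: frontier_def)
    moreover have "\<exists>a. a \<noteq> 0 \<and> contact_order_ge \<Omega> p (q - p) m a" if "1 \<le> m" for m
      using infinite_type_contact[OF \<Omega>(1,2) p(1) pq p(2) that] by metis
    ultimately obtain a where "a \<noteq> 0" "\<And>m. 1 \<le> m \<Longrightarrow> contact_order_ge \<Omega> p (q - p) m a"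
      using infinite_contact_direction[OF \<Omega>(2,1) _ pq] by metis
    then show ?thesis using p(1) by blast
  qed
  then obtain p a where pa: "p \<in> frontier \<Omega>" "a \<noteq> 0" "\<And>m. 1 \<le> m \<Longrightarrow> contact_order_ge \<Omega> p (q - p) m a"
    by blast
  \<comment> \<open>The vector from \<open>p\<close> to an arbitrary point \<open>q\<close> of the
    domain serves as \<nu>.\<close>
  interpret infinite_contact \<Omega> p "q - p" a
    by unfold_locales (use assms(1) pa q \<Omega>(1) in \<open>auto simp: frontier_def interior_open\<close>)
  show ?thesis by (rule bidisk_slice)
qed

end
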